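(* Let $V\in L^\infty_{loc}(Q_T)$ satisfy $0\le V(x,t)\le C_1/t$ in $Q_T$ for some $C_1>0$, let $\mu\in\mathfrak{M}_T(\mathbb{R}^n)$ be nonnegative, and let $\mu^*$ be the reduced measure associated to $\mu$. Then: (i) $(\mu-\mu^* )\big(\mathbb{R}^n\setminus\mathcal{S}ing_V\big)=0$. (ii) If $\mu\big(\mathbb{R}^n\setminus\mathcal{S}ing_V\big)=0$, then $\mu^*=0$. (iii) $\mathcal{S}ing_V=Z_V$.
   Context: Here $n\ge 1$, $T>0$, $Q_T=\mathbb{R}^n\times(0,T]$, $H(x,t)=(4\pi t)^{-n/2}e^{-|x|^2/(4t)}$, $\mathbb{H}[\mu](x,t)=\int_{\mathbb{R}^n}H(x-y,t)\,d\mu(y)$. $\mathfrak M_T(\mathbb{R}^n)$ is the set of Radon measures $\mu$ with $\int_{\mathbb{R}^n}e^{-|y|^2/(4T)}d|\mu|(y)<\infty$. The kernel $H_V$: for a bounded nonnegative measurable $W$ on $Q_T$, $H_W(x,y,t)$ denotes the heat kernel (fundamental solution) of $\partial_t-\Delta+W$, i.e. $(x,t)\mapsto H_W(x,y,t)$ is the solution, with $0\le H_W(x,y,t)\le H(x-y,t)$, of $\partial_tw-\Delta w+Ww=0$ in $Q_T$ with $w(\cdot,0)=\delta_y$. With $V^k=\min\{V,k\}$, the kernels $H_{V^k}$ decrease as $k\to\infty$, and $H_V(x,y,t):=\lim_{k\to\infty}H_{V^k}(x,y,t)$. $\mathcal{S}ing_V=\{y\in\mathbb{R}^n:\ H_V(x,y,t)=0\text{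 for all }(x,t)\in Q_T\}$ and $Z_V=\{x\in\mathbb{R}^n:\ \iint_{Q_T}H(x-y,t)V(y,t)\,dy\,dt=\infty\}$. Reduced measure: for nonnegative $\mu\in\mathfrak M_T(\mathbb{R}^n)$ put $u(x,t)=\int_{\mathbb{R}^n}H_V(x,y,t)\,d\mu(y)$. The function $u(x,t)+\int_0^t\int_{\mathbb{R}^n}H(x-y,t-s)V(y,s)u(y,s)\,dy\,ds$ is a nonnegative solution of the heat equation, and $\mu^*$ is its initial trace, i.e. the unique nonnegative measure $\mu^*\in\mathfrak M_T(\mathbb{R}^n)$ with $$u(x,t)+\int_0^t\int_{\mathbb{R}^n}H(x-y,t-s)V(y,s)u(y,s)\,dy\,ds=\mathbb{H}[\mu^*](x,t)\qquad\text{for } x\in\mathbb{R}^n,\ 0<t<T.$$ One has $\mu^*\le\mu$. *)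

theory Defs
  imports "HOL-Analysis.Analysis"
begin

definition QT :: "real \<Rightarrow> ('a::euclidean_space \<times> real) set" where
  "QT T = UNIV \<times> {0<..T}"

definition heat :: "'a::euclidean_space \<Rightarrow> real \<Rightarrow> real" where
  "heat x t = (4 * pi * t) powr (- (real DIM('a) / 2)) * exp (- (norm x)\<^sup>2 / (4 * t))"

definition heat_pot :: "'a::euclidean_space measure \<Rightarrow> 'a \<Rightarrow> real \<Rightarrow> ennreal" where
  "heat_pot \<mu> x t = (\<integral>\<^sup>+ y. ennreal (heat (x - y) t) \<partial>\<mu>)"

text \<open>The nonnegative elements of the class of Radon measures with Gaussian weight. On a Euclidean
  space a Borel measure that is finite on compact sets is automatically Radon.\<close>

definition MT_nonneg :: "real \<Rightarrow> 'a::euclidean_space measure set" where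
  "MT_nonneg T = {\<mu>. sets \<mu> = sets borel \<and> (\<forall>K. compact K \<longrightarrow> emeasure \<mu> K < \<infinity>) \<and>
     (\<integral>\<^sup>+ y. ennreal (exp (- (norm y)\<^sup>2 / (4 * T))) \<partial>\<mu>) < \<infinity>}"

definition Linf_loc :: "'b::euclidean_space set \<Rightarrow> ('b \<Rightarrow> real) set" where
  "Linf_loc S = {f. f \<in> borel_measurable (lebesgue_on S) \<and>
     (\<forall>K. compact K \<and> K \<subseteq> S \<longrightarrow> (\<exists>C. AE z in lebesgue_on K. \<bar>f z\<bar> \<le> C))}"

definition dir_deriv :: "'b::real_normed_vector \<Rightarrow> ('b \<Rightarrow> real) \<Rightarrow> 'b \<Rightarrow> real" where
  "dir_deriv v f z = deriv (\<lambda>r. f (z + r *\<^sub>R v)) 0"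

definition C1_dir :: "'b::real_normed_vector \<Rightarrow> ('b \<Rightarrow> real) \<Rightarrow> bool" where
  "C1_dir v f \<longleftrightarrow> (\<forall>z. (\<lambda>r. f (z + r *\<^sub>R v)) field_differentiable at 0) \<and>
     continuous_on UNIV (dir_deriv v f)"

definition time_deriv :: "('a::euclidean_space \<times> real \<Rightarrow> real) \<Rightarrow> 'a \<times> real \<Rightarrow> real" where
  "time_deriv \<phi> = dir_deriv (0, 1) \<phi>"

definition space_deriv :: "'a::euclidean_space \<Rightarrow> ('a \<times> real \<Rightarrow> real) \<Rightarrow> 'a \<times> real \<Rightarrow> real" where
  "space_deriv b \<phi> = dir_deriv (b, 0) \<phi>"

definition laplacian :: "('a::euclidean_space \<times> real \<Rightarrow> real) \<Rightarrow> 'a \<times> real \<Rightarrow> real" where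
  "laplacian \<phi> z = (\<Sum>b\<in>Basis. space_deriv b (space_deriv b \<phi>) z)"

definition C21 :: "('a::euclidean_space \<times> real \<Rightarrow> real) \<Rightarrow> bool" where
  "C21 \<phi> \<longleftrightarrow> continuous_on UNIV \<phi> \<and> C1_dir (0, 1) \<phi> \<and>
     (\<forall>b\<in>Basis. C1_dir (b, 0) \<phi> \<and> (\<forall>c\<in>Basis. C1_dir (c, 0) (space_deriv b \<phi>)))"

text \<open>Test functions have compact support in space-time and vanish near and after time \<open>T\<close>.
  They need not vanish at time \<open>0\<close>, where they see the initial datum. For convenience they are
  defined at negative times too; only their restriction to nonnegative times is used.\<close>

definition test_fun :: "real \<Rightarrow> ('a::euclidean_space \<times> real \<Rightarrow> real) \<Rightarrow> bool" where
  "test_fun T \<phi> \<longleftrightarrow> C21 \<phi> \<and>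
     (\<exists>K. compact K \<and> K \<subseteq> UNIV \<times> {..<T} \<and> (\<forall>z. z \<notin> K \<longrightarrow> \<phi> z = 0))"

text \<open>The problem \<open>\<partial>\<^sub>t w - \<Delta>w + W w = 0\<close> in \<open>QT T\<close>, \<open>w(\<cdot>,0) = \<delta>\<^sub>y\<close>, in the weak sense, the
  initial datum being incorporated by integration by parts (hence the term \<open>\<phi> (y, 0)\<close>). Since
  \<open>W\<close> is merely bounded and measurable, there are no classical solutions in general. A weak
  solution is only determined almost everywhere; continuity fixes its pointwise values.\<close>

definition fundamental_solution ::
    "real \<Rightarrow> ('a::euclidean_space \<times> real \<Rightarrow> real) \<Rightarrow> 'a \<Rightarrow> ('a \<times> real \<Rightarrow> real) \<Rightarrow> bool" where
  "fundamental_solution T W y w \<longleftrightarrow>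
     continuous_on (QT T) w \<and>
     (\<forall>(x, t) \<in> QT T. 0 \<le> w (x, t) \<and> w (x, t) \<le> heat (x - y) t) \<and>
     (\<forall>\<phi>. test_fun T \<phi> \<longrightarrow>
        (LINT z:QT T|lebesgue. w z * (- time_deriv \<phi> z - laplacian \<phi> z + W z * \<phi> z)) = \<phi> (y, 0))"

text \<open>The solution is extended by \<open>0\<close> outside \<open>QT T\<close> so that it is unique as a total function.\<close>

definition heat_kernel ::
    "real \<Rightarrow> ('a::euclidean_space \<times> real \<Rightarrow> real) \<Rightarrow> 'a \<Rightarrow> 'a \<Rightarrow> real \<Rightarrow> real" where
  "heat_kernel T W x y t =
     (THE w. fundamental_solution T W y w \<and> (\<forall>z. z \<notin> QT T \<longrightarrow> w z = 0)) (x, t)"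

definition sing_kernel ::
    "real \<Rightarrow> ('a::euclidean_space \<times> real \<Rightarrow> real) \<Rightarrow> 'a \<Rightarrow> 'a \<Rightarrow> real \<Rightarrow> real" where
  "sing_kernel T V x y t = lim (\<lambda>k::nat. heat_kernel T (\<lambda>z. min (V z) (real k)) x y t)"

definition Sing :: "real \<Rightarrow> ('a::euclidean_space \<times> real \<Rightarrow> real) \<Rightarrow> 'a set" where
  "Sing T V = {y. \<forall>(x, t) \<in> QT T. sing_kernel T V x y t = 0}"

definition Zset :: "real \<Rightarrow> ('a::euclidean_space \<times> real \<Rightarrow> real) \<Rightarrow> 'a set" where
  "Zset T V = {x. (\<integral>\<^sup>+ (y, t) \<in> QT T. ennreal (heat (x - y) t * V (y, t)) \<partial>lebesgue) = \<infinity>}"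

definition kernel_pot ::
    "real \<Rightarrow> ('a::euclidean_space \<times> real \<Rightarrow> real) \<Rightarrow> 'a measure \<Rightarrow> 'a \<Rightarrow> real \<Rightarrow> ennreal" where
  "kernel_pot T V \<mu> x t = (\<integral>\<^sup>+ y. ennreal (sing_kernel T V x y t) \<partial>\<mu>)"

text \<open>\<open>\<mu>'\<close> is determined by \<open>\<mu>\<close>, since a nonnegative solution of the heat equation has only one
  initial trace.\<close>

definition reduced_measure ::
    "real \<Rightarrow> ('a::euclidean_space \<times> real \<Rightarrow> real) \<Rightarrow> 'a measure \<Rightarrow> 'a measure \<Rightarrow> bool" where
  "reduced_measure T V \<mu> \<mu>' \<longleftrightarrow> \<mu>' \<in> MT_nonneg T \<and>
     (\<forall>x t. 0 < t \<and> t < T \<longrightarrow>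
        kernel_pot T V \<mu> x t +
        (\<integral>\<^sup>+ (y, s) \<in> UNIV \<times> {0<..<t}.
           ennreal (heat (x - y) (t - s) * V (y, s)) * kernel_pot T V \<mu> y s \<partial>lebesgue)
        = heat_pot \<mu>' x t)"

text \<open>\<open>\<rho> = \<mu> - \<nu>\<close> for nonnegative Borel measures with \<open>\<nu> \<le> \<mu>\<close>. Setwise subtraction is not available,
  because both measures may be infinite on an unbounded set. When \<open>\<nu>\<close> is \<open>\<sigma>\<close>-finite,
  \<open>\<rho>\<close> is unique.\<close>

definition is_diff_measure ::
    "'a::topological_space measure \<Rightarrow> 'a measure \<Rightarrow> 'a measure \<Rightarrow> bool" where
  "is_diff_measure \<mu> \<nu> \<rho> \<longleftrightarrow> sets \<rho> = sets borel \<and>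
     (\<forall>A\<in>sets borel. emeasure \<mu> A = emeasure \<nu> A + emeasure \<rho> A)"

end

theory Submission
  imports Defs "HOL-Probability.Probability"
begin

text \<open>Write \<open>H\<close> for the heat kernel, extended by \<open>0\<close> to nonpositive times. For bounded \<open>W\<close> the weak problem
  is equivalent to the Duhamel equation \<open>w + H * (W w) = H(\<cdot> - y, \<cdot>)\<close>, where \<open>*\<close> is convolution on
  space-time; this yields existence, uniqueness and comparison for \<open>H\<^sub>W\<close>. Restarting at time \<open>\<tau>\<close>, where \<open>V\<close> is
  bounded, and letting \<open>\<tau>\<close> tend to \<open>0\<close> gives \<open>w + H * (V w) = c(y) H(\<cdot> - y, \<cdot>)\<close> for the limit \<open>w = H\<^sub>V(\<cdot>, y, \<cdot>)\<close>.
  Comparison then gives \<open>w \<le> c(y) w\<close>, so \<open>c(y)\<close> is \<open>0\<close> or \<open>1\<close>, and it is \<open>0\<close> exactly on the singular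
  set. Integrating in \<open>y\<close>, the reduced measure is \<open>c \<mu>\<close>, which gives (i) and (ii).

  For (iii), if \<open>\<integral>\<integral> H V < \<infinity>\<close> then no mass escapes in the limit of the truncations and \<open>c = 1\<close>. If the integral
  is infinite, a second moment argument applies: since \<open>V \<le> C\<^sub>1 / t\<close>, the values of \<open>V\<close> along a Brownian path
  decorrelate exponentially in logarithmic time, hence the second moment of the additive functional of \<open>V\<close>
  is bounded by a multiple of the square of its first moment, and a fixed fraction of the mass is
  lost before any positive time, which is incompatible with \<open>c = 1\<close>.\<close>

section \<open>The heat kernel\<close>

text \<open>The obstacle is the initial time. The bound \<open>C1 / t\<close> is not integrable at
  \<open>0\<close>, so nothing dominates the products of truncated potentials and kernels there, and
  in the limit mass can disappear at the pole itself, at time zero. The weight \<open>c\<close>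
  measures what survives. It exists because every kernel lies below the heat kernel: whatever their
  shape, its time slices concentrate at the pole, so a restarted heat flow sees only their mass.
  Kernels and Duhamel integrals take extended nonnegative values. Tonelli and the associativity of
  convolution then hold without integrability conditions; where equations have to be subtracted, the
  common term is shown to be finite and cancelled. The given potential is determined only up to null
  sets, while the arguments are pointwise, so they are carried out for a Borel version whose bounds
  hold everywhere. The factor \<open>16\<close> in the second moment bound separates time scales:
  beyond it the error factors are at most \<open>exp (|x|^2 / (16 s))\<close>, and even their
  squares are integrable against the Gaussian \<open>exp (- |x|^2 / (4 s))\<close>.\<close>

lemma heat_pos: "0 < t \<Longrightarrow> 0 < heat x t"
  by (simp add: heat_def)

lemma heat_nonneg [simp]: "0 \<le> heat x t"
  by (simp add: heat_def)

lemma heat_commute: "heat (x - y) t = heat (y - x) t"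
  by (simp add: heat_def norm_minus_commute)

lemma measurable_heat [measurable]:
  "(\<lambda>p. heat (fst p) (snd p)) \<in> borel_measurable (borel :: ('a::euclidean_space \<times> real) measure)"
  unfolding heat_def borel_prod[symmetric] by measurable

lemma measurable_heat' [measurable (raw)]:
  assumes [measurable]: "f \<in> borel_measurable M" "g \<in> borel_measurable M"
  shows "(\<lambda>z. heat (f z) (g z)) \<in> borel_measurable M"
  unfolding heat_def by measurable

lemma tendsto_heat:
  fixes x :: "'a::euclidean_space"
  assumes "(f \<longlongrightarrow> x) F" "(g \<longlongrightarrow> t) F" "0 < t"
  shows "((\<lambda>z. heat (f z) (g z)) \<longlongrightarrow> heat x t) F"
  unfolding heat_def using assms by (auto intro!: tendsto_intros)

text \<open>\<open>heat\<close> is a Gaussian with independent coordinates of variance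
  \<open>2 * t\<close>, the variance that belongs to the generator \<Delta> rather than \<Delta>/2.
  Its unit mass thus reduces to one dimension.\<close>

lemma heat_eq_prod:
  fixes x :: "'a::euclidean_space"
  assumes "0 < t"
  shows "heat x t = (\<Prod>b\<in>Basis. normal_density 0 (sqrt (2 * t)) (x \<bullet> b))"
proof -
  have 1: "normal_density 0 (sqrt (2 * t)) u = (4 * pi * t) powr (-1/2) * exp (- (u\<^sup>2 / (4 * t)))" for u
    using assms by (simp add: normal_density_def powr_minus powr_half_sqrt field_simps)
  have 2: "(\<Prod>b\<in>(Basis::'a set). (4 * pi * t) powr (-1/2)) = (4 * pi * t) powr (- (real DIM('a) / 2))"
    using assms by (simp add: powr_realpow[symmetric] powr_powr)
  have 3: "(\<Prod>b\<in>(Basis::'a set). exp (- ((x \<bullet> b)\<^sup>2 / (4 * t)))) = exp (- (norm x)\<^sup>2 / (4 * t))"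
    by (simp add: exp_sum[symmetric] sum_negf sum_divide_distrib[symmetric]
        power2_norm_eq_inner euclidean_inner[of x x] flip: power2_eq_square)
  show ?thesis
    unfolding heat_def 1 prod.distrib 2 3 ..
qed

lemma nn_integral_heat:
  assumes "0 < t"
  shows "(\<integral>\<^sup>+ x. ennreal (heat (x::'a::euclidean_space) t) \<partial>lborel) = 1"
proof -
  have "(\<integral>\<^sup>+ u. ennreal (normal_density 0 (sqrt (2 * t)) u) \<partial>lborel) = 1"
    using assms prob_space.emeasure_space_1[OF prob_space_normal_density[of "sqrt (2*t)" 0]]
    by (simp add: emeasure_density)
  then have "(\<integral>\<^sup>+ x. (\<Prod>b\<in>Basis. ennreal (normal_density 0 (sqrt (2 * t)) ((x::'a) \<bullet> b))) \<partial>lborel) = 1"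
    by (subst nn_integral_lborel_prod) auto
  then show ?thesis
    using assms by (simp add: heat_eq_prod prod_ennreal)
qed

lemma nn_integral_lborel_shift:
  fixes f :: "'a::euclidean_space \<Rightarrow> ennreal"
  assumes [measurable]: "f \<in> borel_measurable borel"
  shows "(\<integral>\<^sup>+ x. f (c + x) \<partial>lborel) = (\<integral>\<^sup>+ x. f x \<partial>lborel)"
proof -
  have "(\<integral>\<^sup>+ x. f x \<partial>lborel) = (\<integral>\<^sup>+ x. f x \<partial>distr lborel borel ((+) c))"
    by (simp add: lborel_distr_plus)
  also have "\<dots> = (\<integral>\<^sup>+ x. f (c + x) \<partial>lborel)"
    by (subst nn_integral_distr) auto
  finally show ?thesis ..
qed

lemma nn_integral_lborel_shift_minus:
  fixes f :: "'a::euclidean_space \<Rightarrow> ennreal"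
  assumes [measurable]: "f \<in> borel_measurable borel"
  shows "(\<integral>\<^sup>+ x. f (x - c) \<partial>lborel) = (\<integral>\<^sup>+ x. f x \<partial>lborel)"
  using nn_integral_lborel_shift[OF assms, of "- c"] by simp

lemma nn_integral_lborel_scale:
  fixes f :: "'a::euclidean_space \<Rightarrow> ennreal"
  assumes [measurable]: "f \<in> borel_measurable borel" and "c \<noteq> 0"
  shows "(\<integral>\<^sup>+ x. f x \<partial>lborel) = ennreal (\<bar>c\<bar> ^ DIM('a)) * (\<integral>\<^sup>+ x. f (c *\<^sub>R x) \<partial>lborel)"
proof -
  have "(\<integral>\<^sup>+ x. f x \<partial>lborel)
      = (\<integral>\<^sup>+ x. f x \<partial>density (distr lborel borel (\<lambda>x. 0 + c *\<^sub>R x)) (\<lambda>_. \<bar>c\<bar> ^ DIM('a)))"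
    using lborel_affine[OF assms(2), of "0::'a"] by simp
  also have "\<dots> = ennreal (\<bar>c\<bar> ^ DIM('a)) * (\<integral>\<^sup>+ x. f (c *\<^sub>R x) \<partial>lborel)"
    by (subst nn_integral_density) (auto simp: nn_integral_distr nn_integral_cmult)
  finally show ?thesis .
qed

lemma nn_integral_lborel_reflect:
  fixes f :: "'a::euclidean_space \<Rightarrow> ennreal"
  assumes [measurable]: "f \<in> borel_measurable borel"
  shows "(\<integral>\<^sup>+ x. f (c - x) \<partial>lborel) = (\<integral>\<^sup>+ x. f x \<partial>lborel)"
proof -
  have "(\<integral>\<^sup>+ x. f x \<partial>lborel) = (\<integral>\<^sup>+ x. f (c + x) \<partial>lborel)"
    by (rule nn_integral_lborel_shift[symmetric]) simp
  also have "\<dots> = (\<integral>\<^sup>+ x. f (c - x) \<partial>lborel)"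
    by (subst nn_integral_lborel_scale[where c="-1"]) auto
  finally show ?thesis ..
qed

lemma nn_integral_lborel_pair:
  fixes f :: "'a::euclidean_space \<times> 'b::euclidean_space \<Rightarrow> ennreal"
  assumes [measurable]: "f \<in> borel_measurable borel"
  shows "(\<integral>\<^sup>+ p. f p \<partial>lborel) = (\<integral>\<^sup>+ s. \<integral>\<^sup>+ x. f (x, s) \<partial>lborel \<partial>lborel)"
    and "(\<integral>\<^sup>+ p. f p \<partial>lborel) = (\<integral>\<^sup>+ x. \<integral>\<^sup>+ s. f (x, s) \<partial>lborel \<partial>lborel)"
proof -
  have m: "f \<in> borel_measurable (lborel \<Otimes>\<^sub>M lborel)"
    by (simp add: lborel_prod)
  show "(\<integral>\<^sup>+ p. f p \<partial>lborel) = (\<integral>\<^sup>+ s. \<integral>\<^sup>+ x. f (x, s) \<partial>lborel \<partial>lborel)"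
    unfolding lborel_prod[symmetric] by (rule lborel_pair.nn_integral_snd[symmetric]) (use m in simp)
  show "(\<integral>\<^sup>+ p. f p \<partial>lborel) = (\<integral>\<^sup>+ x. \<integral>\<^sup>+ s. f (x, s) \<partial>lborel \<partial>lborel)"
    unfolding lborel_prod[symmetric] by (rule lborel.nn_integral_fst[symmetric]) (use m in simp)
qed

text \<open>Completing the square.\<close>

lemma heat_mult_heat:
  fixes x y z :: "'a::euclidean_space"
  assumes "0 < s" "0 < t"
  shows "heat (x - z) t * heat (z - y) s
    = heat (x - y) (t + s) * heat (z - (s / (t + s)) *\<^sub>R x - (t / (t + s)) *\<^sub>R y) (t * s / (t + s))"
proof -
  have ts: "t + s \<noteq> 0" "t \<noteq> 0" "s \<noteq> 0" using assms by auto
  define d where "d = real DIM('a) / 2"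
  have A: "(4 * pi * t) powr (-d) * (4 * pi * s) powr (-d)
      = (4 * pi * (t + s)) powr (-d) * (4 * pi * (t * s / (t + s))) powr (-d)"
  proof -
    have "4 * pi * t * (4 * pi * s) = 4 * pi * (t + s) * (4 * pi * (t * s / (t + s)))"
      using assms by (simp add: field_simps)
    then show ?thesis using assms
      by (metis powr_mult mult_nonneg_nonneg)
  qed
  have sq: "s * (norm (x - z))\<^sup>2 * (t + s) + t * (norm (z - y))\<^sup>2 * (t + s) =
        t * s * (norm (x - y))\<^sup>2 + (norm ((t + s) *\<^sub>R z - s *\<^sub>R x - t *\<^sub>R y))\<^sup>2"
    unfolding power2_norm_eq_inner
    by (simp add: inner_simps inner_commute algebra_simps)
  have m: "z - (s / (t + s)) *\<^sub>R x - (t / (t + s)) *\<^sub>R y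
      = (1 / (t + s)) *\<^sub>R ((t + s) *\<^sub>R z - s *\<^sub>R x - t *\<^sub>R y)"
    using ts by (simp add: scaleR_diff_right scaleR_scaleR)
  have "(norm (x - z))\<^sup>2 / (4 * t) + (norm (z - y))\<^sup>2 / (4 * s)
     = (s * (norm (x - z))\<^sup>2 * (t + s) + t * (norm (z - y))\<^sup>2 * (t + s)) / (4 * t * s * (t + s))"
    using ts by (simp add: divide_simps) algebra
  also have "\<dots> = (norm (x - y))\<^sup>2 / (4 * (t + s))
      + (norm (z - (s / (t + s)) *\<^sub>R x - (t / (t + s)) *\<^sub>R y))\<^sup>2 / (4 * (t * s / (t + s)))"
  proof -
    have "(t * s * P + Q) / (4 * t * s * (t + s))
        = P / (4 * (t + s)) + (\<bar>1 / (t + s)\<bar>\<^sup>2 * Q) / (4 * (t * s / (t + s)))" for P Q :: real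
      using ts by (simp add: divide_simps power2_eq_square) algebra
    then show ?thesis
      unfolding sq m norm_scaleR power_mult_distrib by blast
  qed
  finally have B: "exp (- (norm (x - z))\<^sup>2 / (4 * t)) * exp (- (norm (z - y))\<^sup>2 / (4 * s))
     = exp (- (norm (x - y))\<^sup>2 / (4 * (t + s)))
       * exp (- (norm (z - (s / (t + s)) *\<^sub>R x - (t / (t + s)) *\<^sub>R y))\<^sup>2 / (4 * (t * s / (t + s))))"
    by (simp add: exp_add[symmetric])
  have "heat (x - z) t * heat (z - y) s = ((4 * pi * t) powr (-d) * (4 * pi * s) powr (-d)) *
     (exp (- (norm (x - z))\<^sup>2 / (4 * t)) * exp (- (norm (z - y))\<^sup>2 / (4 * s)))"
    by (simp add: heat_def d_def)
  then show ?thesis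
    unfolding A B by (simp add: heat_def d_def)
qed

text \<open>After the square is completed, the intermediate point \<open>z\<close> enters through a
  single Gaussian of unit mass.\<close>

lemma heat_semigroup:
  fixes x y :: "'a::euclidean_space"
  assumes "0 < s" "0 < t"
  shows "(\<integral>\<^sup>+ z. ennreal (heat (x - z) t) * ennreal (heat (z - y) s) \<partial>lborel) = ennreal (heat (x - y) (t + s))"
proof -
  define a where "a = (s / (t + s)) *\<^sub>R x + (t / (t + s)) *\<^sub>R y"
  have "(\<integral>\<^sup>+ z. ennreal (heat (x - z) t) * ennreal (heat (z - y) s) \<partial>lborel)
     = (\<integral>\<^sup>+ z. ennreal (heat (x - y) (t + s)) * ennreal (heat (z - a) (t * s / (t + s))) \<partial>lborel)"
    using assms by (simp add: ennreal_mult[symmetric] heat_mult_heat a_def diff_diff_eq)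
  also have "\<dots> = ennreal (heat (x - y) (t + s)) * (\<integral>\<^sup>+ z. ennreal (heat (z - a) (t * s / (t + s))) \<partial>lborel)"
    by (rule nn_integral_cmult) simp
  also have "(\<integral>\<^sup>+ z. ennreal (heat (z - a) (t * s / (t + s))) \<partial>lborel) = 1"
    using assms
    by (subst nn_integral_lborel_shift_minus[where f="\<lambda>z. ennreal (heat z (t * s / (t + s)))"])
       (auto simp: nn_integral_heat)
  finally show ?thesis by simp
qed

lemma heat_scale:
  fixes v :: "'a::euclidean_space"
  assumes "0 < r"
  shows "sqrt r ^ DIM('a) * heat (sqrt r *\<^sub>R v) r = heat v 1"
proof -
  have "sqrt r ^ DIM('a) = r powr (real DIM('a) / 2)"
    using assms by (simp add: powr_half_sqrt[symmetric] powr_realpow[symmetric] powr_powr)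
  moreover have "(4 * pi * r) powr (- (real DIM('a) / 2)) = (4 * pi) powr (- (real DIM('a) / 2)) * r powr (- (real DIM('a) / 2))"
    using assms by (subst powr_mult) auto
  ultimately show ?thesis
    using assms by (simp add: heat_def power_mult_distrib powr_minus field_simps)
qed

section \<open>Space-time convolution\<close>

text \<open>Extending the heat kernel by \<open>0\<close> to nonpositive times turns Duhamel integrals into
  convolutions on space-time.\<close>

definition hk :: "'a::euclidean_space \<times> real \<Rightarrow> ennreal" where
  "hk p = (if 0 < snd p then ennreal (heat (fst p) (snd p)) else 0)"

definition conv :: "('a::euclidean_space \<Rightarrow> ennreal) \<Rightarrow> ('a \<Rightarrow> ennreal) \<Rightarrow> 'a \<Rightarrow> ennreal" where
  "conv g f p = (\<integral>\<^sup>+ q. g (p - q) * f q \<partial>lborel)"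

text \<open>The kernel of \<open>\<partial>\<^sub>t - \<Delta> + k\<close>. With it the equation for a potential \<open>W \<le> k\<close> becomes a fixed point
  problem with the nonnegative coefficient \<open>k - W\<close>, to which monotone iteration applies.\<close>

definition hkd :: "real \<Rightarrow> 'a::euclidean_space \<times> real \<Rightarrow> ennreal" where
  "hkd k p = ennreal (exp (- k * snd p)) * hk p"

lemma measurable_hk [measurable]: "hk \<in> borel_measurable borel"
proof -
  have "hk \<in> borel_measurable (borel \<Otimes>\<^sub>M borel)"
    unfolding hk_def[abs_def] by measurable
  then show ?thesis by (simp add: borel_prod)
qed

lemma measurable_hkd [measurable]: "hkd k \<in> borel_measurable borel"
proof -
  have [measurable]: "hk \<in> borel_measurable (borel \<Otimes>\<^sub>M borel)"
    by (simp add: borel_prod)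
  have "hkd k \<in> borel_measurable (borel \<Otimes>\<^sub>M borel)"
    unfolding hkd_def[abs_def] by measurable
  then show ?thesis by (simp add: borel_prod)
qed

lemma measurable_snd_borel [measurable]:
  "snd \<in> borel_measurable (borel :: ('a::second_countable_topology \<times> 'b::second_countable_topology) measure)"
  "fst \<in> borel_measurable (borel :: ('a::second_countable_topology \<times> 'b::second_countable_topology) measure)"
  by (simp_all add: borel_prod[symmetric])

section \<open>Algebra of the space-time convolution\<close>

lemma measurable_conv [measurable]:
  assumes [measurable]: "g \<in> borel_measurable borel" "f \<in> borel_measurable borel"
  shows "conv g f \<in> borel_measurable borel"
  unfolding conv_def[abs_def] by measurable

lemma measurable_conv' [measurable (raw)]:
  assumes [measurable]: "g \<in> borel_measurable borel"
    "case_prod f \<in> borel_measurable (M \<Otimes>\<^sub>M borel)" "h \<in> borel_measurable M"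
  shows "(\<lambda>y. conv g (f y) (h y)) \<in> borel_measurable M"
  unfolding conv_def by measurable

lemma conv_mono: "(\<And>q. f q \<le> f' q) \<Longrightarrow> conv g f p \<le> conv g f' p"
  unfolding conv_def by (intro nn_integral_mono mult_left_mono) auto

lemma conv_mono_left: "(\<And>q. g q \<le> g' q) \<Longrightarrow> conv g f p \<le> conv g' f p"
  unfolding conv_def by (intro nn_integral_mono mult_right_mono) auto

lemma conv_add:
  assumes [measurable]: "g \<in> borel_measurable borel" "f \<in> borel_measurable borel" "f' \<in> borel_measurable borel"
  shows "conv g (\<lambda>q. f q + f' q) p = conv g f p + conv g f' p"
  unfolding conv_def by (simp add: distrib_left nn_integral_add)

lemma conv_add_left:
  assumes [measurable]: "g \<in> borel_measurable borel" "g' \<in> borel_measurable borel" "f \<in> borel_measurable borel"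
  shows "conv (\<lambda>q. g q + g' q) f p = conv g f p + conv g' f p"
  unfolding conv_def by (simp add: distrib_right nn_integral_add)

lemma conv_cmult:
  assumes [measurable]: "g \<in> borel_measurable borel" "f \<in> borel_measurable borel"
  shows "conv g (\<lambda>q. c * f q) p = c * conv g f p"
  unfolding conv_def by (simp add: nn_integral_cmult mult.left_commute)

lemma conv_cmult_left:
  assumes [measurable]: "g \<in> borel_measurable borel" "f \<in> borel_measurable borel"
  shows "conv (\<lambda>q. c * g q) f p = c * conv g f p"
  unfolding conv_def by (simp add: nn_integral_cmult mult.assoc)

lemma conv_commute:
  assumes [measurable]: "g \<in> borel_measurable borel" "f \<in> borel_measurable borel"
  shows "conv g f p = conv f g p"
  unfolding conv_def
  by (subst nn_integral_lborel_reflect[of "\<lambda>q. g (p - q) * f q" p, symmetric]) (auto simp: mult.commute)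

text \<open>Tonelli and a translation. For extended nonnegative values no finiteness is involved, so
  Duhamel equations can be composed freely.\<close>

lemma conv_assoc:
  fixes f g h :: "'a::euclidean_space \<Rightarrow> ennreal"
  assumes [measurable]: "g \<in> borel_measurable borel" "f \<in> borel_measurable borel" "h \<in> borel_measurable borel"
  shows "conv g (conv h f) p = conv (conv g h) f p"
proof -
  have "conv g (conv h f) p = (\<integral>\<^sup>+ q. \<integral>\<^sup>+ r. g (p - q) * (h (q - r) * f r) \<partial>lborel \<partial>lborel)"
    unfolding conv_def by (simp add: nn_integral_cmult)
  also have "\<dots> = (\<integral>\<^sup>+ r. \<integral>\<^sup>+ q. g (p - q) * (h (q - r) * f r) \<partial>lborel \<partial>lborel)"
    by (rule lborel_pair.Fubini') simp
  also have "\<dots> = (\<integral>\<^sup>+ r. (\<integral>\<^sup>+ q. g (p - q) * h (q - r) \<partial>lborel) * f r \<partial>lborel)"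
    by (simp add: mult.assoc[symmetric] nn_integral_multc)
  also have "\<dots> = (\<integral>\<^sup>+ r. (\<integral>\<^sup>+ q. g (p - r - q) * h q \<partial>lborel) * f r \<partial>lborel)"
  proof -
    have "(\<integral>\<^sup>+ q. g (p - q) * h (q - r) \<partial>lborel) = (\<integral>\<^sup>+ q. g (p - r - q) * h q \<partial>lborel)" for r
      by (subst nn_integral_lborel_shift[of "\<lambda>q. g (p - q) * h (q - r)" r, symmetric])
         (auto simp: diff_diff_eq)
    then show ?thesis by simp
  qed
  finally show ?thesis unfolding conv_def .
qed

lemma conv_SUP:
  assumes [measurable]: "g \<in> borel_measurable borel" "\<And>j. f j \<in> borel_measurable borel"
    and "\<And>q. incseq (\<lambda>j. f j q)"
  shows "conv g (\<lambda>q. SUP j. f j q) p = (SUP j. conv g (f j) p)"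
  unfolding conv_def SUP_mult_left_ennreal
proof (rule nn_integral_monotone_convergence_SUP)
  show "incseq (\<lambda>j q. g (p - q) * f j q)"
    using assms(3) by (auto simp: incseq_def le_fun_def intro!: mult_left_mono)
qed simp

lemma hk_semigroup:
  fixes x y :: "'a::euclidean_space"
  assumes "0 < s"
  shows "(\<integral>\<^sup>+ z. hk (x - z, t - s) * hk (z - y, s) \<partial>lborel) = (if s < t then hk (x - y, t) else 0)"
  using assms heat_semigroup[of s "t - s" x y] by (auto simp: hk_def)

text \<open>By the semigroup law the space integral at an intermediate time \<open>s\<close> does
  not depend on \<open>s\<close>, so only the time integral of \<open>\<phi>\<close> is left. The
  weights \<open>exp (- k * s)\<close> and the powers of \<open>s\<close> below are both computed
  this way.\<close>

lemma conv_hk_weighted: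
  fixes y :: "'a::euclidean_space" and \<phi> :: "real \<Rightarrow> ennreal"
  assumes [measurable]: "\<phi> \<in> borel_measurable borel"
  shows "conv hk (\<lambda>q. \<phi> (snd q) * hk (q - (y, 0))) p
    = (\<integral>\<^sup>+ s\<in>{0<..<snd p}. \<phi> s \<partial>lborel) * hk (p - (y, 0))"
proof -
  obtain x t where p: "p = (x, t)" by (cases p)
  have "conv hk (\<lambda>q. \<phi> (snd q) * hk (q - (y, 0))) p
     = (\<integral>\<^sup>+ s. \<integral>\<^sup>+ z. \<phi> s * (hk (x - z, t - s) * hk (z - y, s)) \<partial>lborel \<partial>lborel)"
    unfolding conv_def p by (subst nn_integral_lborel_pair(1)) (auto simp: mult.left_commute)
  also have "\<dots> = (\<integral>\<^sup>+ s. (\<phi> s * indicator {0<..<t} s) * hk (x - y, t) \<partial>lborel)"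
  proof (rule nn_integral_cong)
    fix s
    show "(\<integral>\<^sup>+ z. \<phi> s * (hk (x - z, t - s) * hk (z - y, s)) \<partial>lborel) = (\<phi> s * indicator {0<..<t} s) * hk (x - y, t)"
    proof (cases "0 < s")
      case True
      have [measurable]: "(\<lambda>z. hk (x - z, t - s) * hk (z - y, s)) \<in> borel_measurable borel"
        by measurable
      show ?thesis
        using True by (subst nn_integral_cmult) (auto simp: hk_semigroup split: split_indicator)
    next
      case False
      then show ?thesis by (simp add: hk_def)
    qed
  qed
  also have "\<dots> = (\<integral>\<^sup>+ s\<in>{0<..<t}. \<phi> s \<partial>lborel) * hk (x - y, t)"
    by (rule nn_integral_multc) simp
  finally show ?thesis by (simp add: p)
qed

lemma hkd_0 [simp]: "hkd 0 = hk"
  by (auto simp: hkd_def fun_eq_iff)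

lemma hkd_le_hk: "0 \<le> k \<Longrightarrow> hkd k p \<le> hk p"
  by (cases "0 < snd p") (auto simp: hkd_def hk_def ennreal_mult[symmetric] mult_le_cancel_right1 intro!: ennreal_leI mult_left_le_one_le)

lemma hk_eq_0 [simp]: "snd p \<le> 0 \<Longrightarrow> hk p = 0"
  by (simp add: hk_def)

lemma hk_less_top [simp]: "hk p < \<top>" "hk p \<noteq> \<top>"
  by (simp_all add: hk_def)

lemma hk_pos: "0 < snd p \<Longrightarrow> 0 < hk p"
  by (simp add: hk_def heat_pos)

text \<open>Duhamel's formula for the constant potential \<open>k\<close>, whose kernel is explicit:
  the absorbed part is the fraction \<open>1 - exp (- k * t)\<close> of the heat kernel at time
  \<open>t\<close>.\<close>

lemma conv_hk_hkd:
  assumes "0 < k"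
  shows "hkd k p + ennreal k * conv hk (hkd k) p = hk p"
proof (cases "0 < snd p")
  case True
  have I: "((\<lambda>s. exp (- k * s)) has_integral (1 - exp (- k * snd p)) / k) {0..snd p}"
  proof -
    have "((\<lambda>s. exp (- k * s)) has_integral (- exp (- k * snd p) / k - - exp (- k * 0) / k)) {0..snd p}"
      using True assms
      by (intro fundamental_theorem_of_calculus)
         (auto intro!: derivative_eq_intros simp: has_real_derivative_iff_has_vector_derivative[symmetric])
    then show ?thesis by (simp add: diff_divide_distrib)
  qed
  have "(\<integral>\<^sup>+ s\<in>{0<..<snd p}. ennreal (exp (- k * s)) \<partial>lborel) = (\<integral>\<^sup>+ s\<in>{0..snd p}. ennreal (exp (- k * s)) \<partial>lborel)"
    by (intro nn_integral_cong_AE) (use AE_lborel_singleton[of 0] AE_lborel_singleton[of "snd p"] in eventually_elim, auto split: split_indicator)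
  also have "\<dots> = ennreal ((1 - exp (- k * snd p)) / k)"
    using nn_integral_has_integral_lebesgue'[OF _ I] by (simp add: nn_integral_set_ennreal)
  finally have i: "(\<integral>\<^sup>+ s\<in>{0<..<snd p}. ennreal (exp (- k * s)) \<partial>lborel) = ennreal ((1 - exp (- k * snd p)) / k)" .
  have "conv hk (hkd k) p = ennreal ((1 - exp (- k * snd p)) / k) * hk p"
    using conv_hk_weighted[of "\<lambda>s. ennreal (exp (- k * s))" 0 p] unfolding i
    by (simp add: hkd_def[abs_def] zero_prod_def[symmetric])
  then have "ennreal k * conv hk (hkd k) p = ennreal (1 - exp (- k * snd p)) * hk p"
    using assms by (simp add: mult.assoc[symmetric] ennreal_mult'[symmetric])
  then show ?thesis
    using assms True by (simp add: hkd_def distrib_right[symmetric] ennreal_plus[symmetric] del: ennreal_plus)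
next
  case False
  have "conv hk (hkd k) p = 0"
    unfolding conv_def hkd_def
    by (intro nn_integral_zero' AE_I2) (use False in \<open>auto simp: hk_def\<close>)
  with False show ?thesis by (simp add: hkd_def)
qed

section \<open>Kernels of bounded potentials\<close>

abbreviation hk_at :: "'a::euclidean_space \<Rightarrow> 'a \<times> real \<Rightarrow> ennreal" where
  "hk_at y p \<equiv> hk (p - (y, 0))"

lemma conv_shift:
  fixes f :: "'a::euclidean_space \<Rightarrow> ennreal"
  assumes [measurable]: "g \<in> borel_measurable borel" "f \<in> borel_measurable borel"
  shows "conv g (\<lambda>q. f (q - a)) p = conv g f (p - a)"
  unfolding conv_def
  by (subst nn_integral_lborel_shift[of "\<lambda>q. g (p - q) * f (q - a)" a, symmetric]) (auto simp: diff_diff_eq)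

lemma conv_hk_at:
  "conv hk (\<lambda>q. c * hk_at y q) p = c * ennreal (snd p) * hk_at y p"
proof -
  have "(\<integral>\<^sup>+ s\<in>{0<..<snd p}. c \<partial>lborel) = c * ennreal (snd p)"
    by (cases "0 \<le> snd p") (auto simp: nn_integral_cmult_indicator ennreal_neg)
  then show ?thesis
    using conv_hk_weighted[of "\<lambda>_. c" y p] by simp
qed

lemma conv_hk_finite:
  assumes "\<And>q. f q \<le> ennreal c * hk_at y q"
  shows "conv hk f p < \<top>"
proof -
  have "conv hk f p \<le> conv hk (\<lambda>q. ennreal c * hk_at y q) p"
    by (rule conv_mono) (rule assms)
  also have "\<dots> < \<top>"
    unfolding conv_hk_at by (simp add: ennreal_mult_less_top)
  finally show ?thesis .
qed

section \<open>Iterated heat potentials and a Gronwall argument\<close>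

definition heat_rem :: "real \<Rightarrow> nat \<Rightarrow> 'a::euclidean_space \<Rightarrow> 'a \<times> real \<Rightarrow> ennreal" where
  "heat_rem k j y p = ennreal ((k * snd p) ^ j / fact j) * hk_at y p"

lemma measurable_heat_rem [measurable]: "heat_rem k j y \<in> borel_measurable borel"
  unfolding heat_rem_def[abs_def] by measurable

lemma heat_rem_0 [simp]: "heat_rem k 0 y p = hk_at y p"
  by (simp add: heat_rem_def)

text \<open>\<open>heat_rem k j y\<close> is the \<open>j\<close>-th term of the series for
  \<open>exp (k * t)\<close> times the heat kernel: each heat potential with constant coefficient
  \<open>k\<close> integrates the power of time once more. It serves as the error term of the
  iterations.\<close>

lemma conv_heat_rem:
  assumes "0 \<le> k"
  shows "conv hk (\<lambda>q. ennreal k * heat_rem k j y q) p = heat_rem k (Suc j) y p"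
proof (cases "0 < snd p")
  case True
  have I: "((\<lambda>s. k * ((k * s) ^ j / fact j)) has_integral (k * snd p) ^ Suc j / fact (Suc j)) {0..snd p}"
  proof -
    have "((\<lambda>s. (k * s) ^ Suc j / fact (Suc j)) has_vector_derivative k * ((k * s) ^ j / fact j)) (at s within A)" for s A
    proof -
      have "((\<lambda>s. (k * s) ^ Suc j / fact (Suc j)) has_real_derivative real (Suc j) * (k * (k * s) ^ j) / fact (Suc j)) (at s within A)"
        by (intro DERIV_cdivide) (use DERIV_power[OF DERIV_cmult_Id[of k s A], of "Suc j"] in simp)
      moreover have "real (Suc j) * (k * (k * s) ^ j) / fact (Suc j) = k * ((k * s) ^ j / fact j)"
        by (simp add: fact_Suc del: of_nat_Suc)
      ultimately show ?thesis
        unfolding has_real_derivative_iff_has_vector_derivative[symmetric] by (simp only:)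
    qed
    then have "((\<lambda>s. k * ((k * s) ^ j / fact j)) has_integral (k * snd p) ^ Suc j / fact (Suc j) - (k * 0) ^ Suc j / fact (Suc j)) {0..snd p}"
      using True by (intro fundamental_theorem_of_calculus) auto
    then show ?thesis by simp
  qed
  have "(\<integral>\<^sup>+ s\<in>{0<..<snd p}. ennreal (k * ((k * s) ^ j / fact j)) \<partial>lborel) = (\<integral>\<^sup>+ s\<in>{0..snd p}. ennreal (k * ((k * s) ^ j / fact j)) \<partial>lborel)"
    by (intro nn_integral_cong_AE) (use AE_lborel_singleton[of 0] AE_lborel_singleton[of "snd p"] in eventually_elim, auto split: split_indicator)
  also have "\<dots> = ennreal ((k * snd p) ^ Suc j / fact (Suc j))"
    using nn_integral_has_integral_lebesgue'[OF _ I] assms by (simp add: nn_integral_set_ennreal)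
  finally have i: "(\<integral>\<^sup>+ s\<in>{0<..<snd p}. ennreal (k * ((k * s) ^ j / fact j)) \<partial>lborel) = ennreal ((k * snd p) ^ Suc j / fact (Suc j))" .
  have "conv hk (\<lambda>q. ennreal k * heat_rem k j y q) p = conv hk (\<lambda>q. ennreal (k * ((k * snd q) ^ j / fact j)) * hk_at y q) p"
    using assms by (simp add: heat_rem_def ennreal_mult' mult.assoc del: times_divide_eq_right)
  also have "\<dots> = heat_rem k (Suc j) y p"
    unfolding heat_rem_def i[symmetric] by (rule conv_hk_weighted) simp
  finally show ?thesis .
next
  case False
  have "conv hk (\<lambda>q. ennreal k * heat_rem k j y q) p = 0"
    unfolding conv_def heat_rem_def
    by (intro nn_integral_zero' AE_I2) (use False in \<open>auto simp: hk_def\<close>)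
  with False show ?thesis by (simp add: heat_rem_def)
qed

lemma heat_rem_tendsto: "(\<lambda>j. heat_rem k j y p) \<longlonglongrightarrow> 0"
proof -
  have "(\<lambda>j. (k * snd p) ^ j / fact j) \<longlonglongrightarrow> 0"
    using summable_exp[of "k * snd p"] by (intro summable_LIMSEQ_zero) (simp add: field_simps)
  then have "(\<lambda>j. ennreal ((k * snd p) ^ j / fact j) * hk_at y p) \<longlonglongrightarrow> ennreal 0 * hk_at y p"
    by (intro tendsto_mult_ennreal tendsto_ennrealI) auto
  then show ?thesis
    by (simp add: heat_rem_def)
qed

text \<open>Iterating the inequality turns the a priori bound into \<open>C\<close> times the
  \<open>j\<close>-th exponential term, which tends to zero. The a priori bound excludes the value
  infinity, which for positive \<open>k\<close> is itself a solution of the inequality.\<close>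

lemma heat_gronwall:
  assumes [measurable]: "d \<in> borel_measurable borel"
    and k: "0 \<le> k" and d: "\<And>p. d p \<le> ennreal k * conv hk d p" and C: "\<And>p. d p \<le> ennreal C * hk_at y p"
  shows "d p = 0"
proof -
  have "d p \<le> ennreal C * heat_rem k j y p" for j p
  proof (induction j arbitrary: p)
    case 0
    then show ?case using C by simp
  next
    case (Suc j)
    have "d p \<le> conv hk (\<lambda>q. ennreal k * d q) p"
      using d[of p] by (subst conv_cmult) auto
    also have "\<dots> \<le> conv hk (\<lambda>q. ennreal k * (ennreal C * heat_rem k j y q)) p"
      by (intro conv_mono mult_left_mono Suc) simp
    also have "\<dots> = conv hk (\<lambda>q. ennreal C * (ennreal k * heat_rem k j y q)) p"
      by (simp add: ac_simps)
    also have "\<dots> = ennreal C * heat_rem k (Suc j) y p"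
      by (subst conv_cmult) (use k in \<open>auto simp: conv_heat_rem\<close>)
    finally show ?case .
  qed
  note le = this
  have "(\<lambda>j. ennreal C * heat_rem k j y p) \<longlonglongrightarrow> ennreal C * 0"
    by (intro tendsto_mult_ennreal heat_rem_tendsto tendsto_const) auto
  then have "d p \<le> ennreal C * 0"
    by (rule LIMSEQ_le_const) (use le in blast)
  then show ?thesis by simp
qed

text \<open>Both orders of the two commuting kernels are recorded. The first turns the fixed point
  equation for \<open>kern\<close> into the Duhamel equation, the second eliminates heat potentials
  in the comparison argument.\<close>

lemma conv_resolvent:
  assumes [measurable]: "f \<in> borel_measurable borel" and k: "0 < k"
  shows "conv (hkd k) f p + ennreal k * conv hk (conv (hkd k) f) p = conv hk f p"
    and "conv (hkd k) f p + ennreal k * conv (hkd k) (conv hk f) p = conv hk f p"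
proof -
  have "conv (hkd k) f p + ennreal k * conv (conv hk (hkd k)) f p
      = conv (\<lambda>q. hkd k q + ennreal k * conv hk (hkd k) q) f p"
    by (subst conv_add_left) (auto simp: conv_cmult_left)
  then have *: "conv (hkd k) f p + ennreal k * conv (conv hk (hkd k)) f p = conv hk f p"
    using k by (simp add: conv_hk_hkd)
  then show "conv (hkd k) f p + ennreal k * conv hk (conv (hkd k) f) p = conv hk f p"
    by (simp add: conv_assoc)
  have "conv (hkd k) hk q = conv hk (hkd k) q" for q :: "'a \<times> real"
    by (rule conv_commute) auto
  then have "conv (hkd k) hk = conv hk (hkd k :: 'a \<times> real \<Rightarrow> ennreal)" by auto
  with * show "conv (hkd k) f p + ennreal k * conv (hkd k) (conv hk f) p = conv hk f p"
    by (simp add: conv_assoc)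
qed

lemma conv_resolvent_at:
  assumes k: "0 < k"
  shows "hkd k (p - (y, 0)) + ennreal k * conv hk (\<lambda>q. hkd k (q - (y, 0))) p = hk_at y p"
    and "hkd k (p - (y, 0)) + ennreal k * conv (hkd k) (hk_at y) p = hk_at y p"
  using conv_hk_hkd[OF k, of "p - (y, 0)"]
  by (auto simp: conv_shift conv_commute[of "hkd k" hk])

text \<open>Starting from \<open>0\<close> makes the iterates increase, because the coefficient
  \<open>k - W\<close> is nonnegative; their supremum is then a solution by monotone convergence,
  without a contraction estimate.\<close>

primrec picard :: "('a::euclidean_space \<times> real \<Rightarrow> real) \<Rightarrow> real \<Rightarrow> nat \<Rightarrow> 'a \<Rightarrow> 'a \<times> real \<Rightarrow> ennreal" where
  "picard W k 0 y = (\<lambda>p. 0)"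
| "picard W k (Suc j) y =
    (\<lambda>p. hkd k (p - (y, 0)) + conv (hkd k) (\<lambda>q. ennreal (k - W q) * picard W k j y q) p)"

definition kern :: "('a::euclidean_space \<times> real \<Rightarrow> real) \<Rightarrow> real \<Rightarrow> 'a \<Rightarrow> 'a \<times> real \<Rightarrow> ennreal" where
  "kern W k y p = (SUP j. picard W k j y p)"

locale bounded_potential =
  fixes W :: "'a::euclidean_space \<times> real \<Rightarrow> real" and k :: real
  assumes W_measurable [measurable]: "W \<in> borel_measurable borel"
    and W_nonneg: "\<And>q. 0 \<le> W q" and W_le: "\<And>q. W q \<le> k" and k_pos: "0 < k"
begin

lemma split_k: "ennreal k * u = ennreal (k - W q) * u + ennreal (W q) * u"
  using W_nonneg[of q] W_le[of q] by (simp add: distrib_right[symmetric] ennreal_plus[symmetric] del: ennreal_plus)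

lemma k_minus_W_le: "ennreal (k - W q) \<le> ennreal k"
  using W_nonneg[of q] by (intro ennreal_leI) auto

lemma W_le_k: "ennreal (W q) \<le> ennreal k"
  using W_le by (intro ennreal_leI)

text \<open>Measurability is proved jointly in the pole and the point: the pole is later integrated
  against \<mu>, and Tonelli is applied to the pair.\<close>

lemma measurable_picard: "case_prod (picard W k j) \<in> borel_measurable (borel \<Otimes>\<^sub>M borel)"
proof (induction j)
  case 0
  then show ?case by (simp add: case_prod_beta')
next
  case (Suc j)
  note [measurable] = Suc
  have [measurable]: "(\<lambda>y::'a. (y, 0::real)) \<in> borel_measurable borel"
    unfolding borel_prod[symmetric] by measurable
  have "(\<lambda>(y, p). hkd k (p - (y, 0)) + conv (hkd k) (\<lambda>q. ennreal (k - W q) * picard W k j y q) p)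
      \<in> borel_measurable (borel \<Otimes>\<^sub>M borel)"
    by measurable
  then show ?case by (simp add: case_prod_beta')
qed

lemma measurable_picard' [measurable]: "picard W k j y \<in> borel_measurable borel"
proof -
  have "(\<lambda>p. case_prod (picard W k j) (y, p)) \<in> borel_measurable borel"
    by (rule measurable_compose[OF _ measurable_picard]) measurable
  then show ?thesis by simp
qed

lemma measurable_kern: "case_prod (kern W k) \<in> borel_measurable (borel \<Otimes>\<^sub>M borel)"
proof -
  have "(\<lambda>z. SUP j. case_prod (picard W k j) z) \<in> borel_measurable (borel \<Otimes>\<^sub>M borel)"
    by (intro borel_measurable_SUP measurable_picard) auto
  then show ?thesis by (simp add: kern_def[abs_def] case_prod_beta')
qed

lemma measurable_kern' [measurable]: "kern W k y \<in> borel_measurable borel"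
  unfolding kern_def[abs_def] by measurable

lemma picard_Suc_mono: "picard W k j y p \<le> picard W k (Suc j) y p"
proof (induction j arbitrary: p)
  case 0
  then show ?case by simp
next
  case (Suc j)
  then show ?case
    unfolding picard.simps by (intro add_left_mono conv_mono mult_left_mono) (simp_all del: picard.simps)
qed

lemma incseq_picard: "incseq (\<lambda>j. picard W k j y p)"
  by (rule incseq_SucI) (rule picard_Suc_mono)

text \<open>The heat kernel solves the fixed point equation with \<open>W\<close> replaced by
  \<open>0\<close>; since \<open>k - W\<close> is at most \<open>k\<close>, it dominates every
  iterate.\<close>

lemma picard_le: "picard W k j y p \<le> hk_at y p"
proof (induction j arbitrary: p)
  case 0
  then show ?case by simp
next
  case (Suc j)
  have "picard W k (Suc j) y p \<le> hkd k (p - (y, 0)) + conv (hkd k) (\<lambda>q. ennreal k * hk_at y q) p"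
    unfolding picard.simps by (intro add_left_mono conv_mono mult_mono k_minus_W_le Suc) auto
  also have "\<dots> = hk_at y p"
    using k_pos by (simp add: conv_cmult conv_resolvent_at)
  finally show ?case .
qed

lemma kern_le: "kern W k y p \<le> hk_at y p"
  unfolding kern_def by (intro SUP_least picard_le)

lemma kern_eq: "kern W k y p = hkd k (p - (y, 0)) + conv (hkd k) (\<lambda>q. ennreal (k - W q) * kern W k y q) p"
proof -
  have "conv (hkd k) (\<lambda>q. ennreal (k - W q) * kern W k y q) p
     = conv (hkd k) (\<lambda>q. SUP j. ennreal (k - W q) * picard W k j y q) p"
    unfolding kern_def SUP_mult_left_ennreal ..
  also have "\<dots> = (SUP j. conv (hkd k) (\<lambda>q. ennreal (k - W q) * picard W k j y q) p)"
    by (intro conv_SUP) (auto intro!: incseq_SucI mult_left_mono picard_Suc_mono simp del: picard.simps)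
  finally have "hkd k (p - (y, 0)) + conv (hkd k) (\<lambda>q. ennreal (k - W q) * kern W k y q) p
     = (SUP j. picard W k (Suc j) y p)"
    by (simp add: ennreal_SUP_add_right)
  also have "\<dots> = kern W k y p"
    unfolding kern_def using LIMSEQ_SUP[OF incseq_picard[of y p]]
    by (intro LIMSEQ_unique[OF LIMSEQ_SUP] LIMSEQ_Suc) (auto intro!: incseq_SucI picard_Suc_mono simp del: picard.simps)
  finally show ?thesis ..
qed

text \<open>Adding \<open>k\<close> times its heat potential to the fixed point equation turns every
  \<open>hkd\<close> into \<open>hk\<close> by the resolvent identities. The heat potential of
  \<open>(k - W) * w\<close> then stands on both sides; it is finite and cancels.\<close>

lemma kern_duhamel: "kern W k y p + conv hk (\<lambda>q. ennreal (W q) * kern W k y q) p = hk_at y p"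
proof -
  let ?K = "kern W k y" let ?g = "\<lambda>q. ennreal (k - W q) * kern W k y q"
  have fin: "conv hk ?g p < \<top>"
    by (rule conv_hk_finite[of _ k y]) (intro mult_mono k_minus_W_le kern_le; simp)
  have "?K p + ennreal k * conv hk ?K p
     = (hkd k (p - (y, 0)) + ennreal k * conv hk (\<lambda>q. hkd k (q - (y, 0))) p)
       + (conv (hkd k) ?g p + ennreal k * conv hk (conv (hkd k) ?g) p)"
  proof -
    have "conv hk ?K p = conv hk (\<lambda>q. hkd k (q - (y, 0)) + conv (hkd k) ?g q) p"
      by (rule arg_cong[where f="\<lambda>f. conv hk f p"], rule ext, rule kern_eq)
    also have "\<dots> = conv hk (\<lambda>q. hkd k (q - (y, 0))) p + conv hk (conv (hkd k) ?g) p"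
      by (rule conv_add) auto
    finally have 2: "conv hk ?K p = conv hk (\<lambda>q. hkd k (q - (y, 0))) p + conv hk (conv (hkd k) ?g) p" .
    have 3: "?K p = hkd k (p - (y, 0)) + conv (hkd k) ?g p"
      by (rule kern_eq)
    show ?thesis
      unfolding 2 3 by (simp add: distrib_left ac_simps)
  qed
  also have "\<dots> = conv hk ?g p + hk_at y p"
    using k_pos by (simp add: conv_resolvent_at conv_resolvent add.commute)
  also have "ennreal k * conv hk ?K p = conv hk (\<lambda>q. ennreal k * ?K q) p"
    by (rule conv_cmult[symmetric]) auto
  also have "\<dots> = conv hk ?g p + conv hk (\<lambda>q. ennreal (W q) * ?K q) p"
    unfolding split_k[of "kern W k y q" q for q] by (rule conv_add) auto
  finally have "conv hk ?g p + (?K p + conv hk (\<lambda>q. ennreal (W q) * ?K q) p) = conv hk ?g p + hk_at y p"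
    by (simp add: ac_simps)
  then show ?thesis using fin by (auto simp: ennreal_add_left_cancel)
qed

text \<open>Here \<open>u\<close> has initial mass \<open>c\<close> and suffers an additional
  absorption \<open>f\<close>, which can only lower it. This one form gives the monotonicity in the
  potential, the bound of the limit kernel by its own truncations, and the comparison with a damped
  potential.\<close>

lemma comparison:
  fixes u f :: "'a \<times> real \<Rightarrow> ennreal"
  assumes [measurable]: "u \<in> borel_measurable borel" "f \<in> borel_measurable borel"
    and u_le: "\<And>p. u p \<le> hk_at y p"
    and eq: "\<And>p. u p + conv hk (\<lambda>q. ennreal (W q) * u q) p + conv hk f p = c * hk_at y p"
    and c: "c < \<top>"
  shows "u p \<le> c * kern W k y p"
proof -
  let ?Wu = "\<lambda>q. ennreal (W q) * u q" let ?g = "\<lambda>q. ennreal (k - W q) * u q"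
  \<comment> \<open>Convolving the equation with \<open>k * hkd k\<close> and eliminating heat
    potentials by the resolvent identity leaves the fixed point equation for \<open>u\<close>, with
    \<open>conv (hkd k) f\<close> added on the side of \<open>u\<close>. This term is nonnegative
    and is dropped at the end.\<close>
  have le: "u p \<le> c * hkd k (p - (y, 0)) + conv (hkd k) ?g p" for p
  proof -
    have fin1: "conv hk ?Wu p + conv hk f p < \<top>"
    proof -
      have "conv hk ?Wu p + conv hk f p \<le> c * hk_at y p"
        unfolding eq[symmetric] by (simp add: add.assoc)
      also have "\<dots> < \<top>" using c by (simp add: ennreal_mult_less_top)
      finally show ?thesis .
    qed
    have "conv (hkd k) ?Wu p \<le> conv hk ?Wu p"
      using k_pos by (intro conv_mono_left hkd_le_hk) simp
    also have "\<dots> < \<top>"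
      by (rule conv_hk_finite[of _ k y]) (intro mult_mono W_le_k u_le; simp)
    finally have fin2: "conv (hkd k) ?Wu p < \<top>" .
    have "conv (hkd k) (\<lambda>q. c * hk_at y q) p = conv (hkd k) (\<lambda>q. u q + conv hk ?Wu q + conv hk f q) p"
      unfolding eq ..
    also have "\<dots> = conv (hkd k) u p + conv (hkd k) (conv hk ?Wu) p + conv (hkd k) (conv hk f) p"
      by (simp add: conv_add)
    finally have 0: "c * conv (hkd k) (hk_at y) p
       = conv (hkd k) u p + conv (hkd k) (conv hk ?Wu) p + conv (hkd k) (conv hk f) p"
      by (simp add: conv_cmult)
    have 1: "ennreal k * conv (hkd k) u p + ennreal k * conv (hkd k) (conv hk ?Wu) p
       + ennreal k * conv (hkd k) (conv hk f) p = c * (ennreal k * conv (hkd k) (hk_at y) p)"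
      by (simp add: distrib_left[symmetric] 0[symmetric] mult.left_commute)
    have 2: "ennreal k * conv (hkd k) u p = conv (hkd k) ?g p + conv (hkd k) ?Wu p"
    proof -
      have "ennreal k * conv (hkd k) u p = conv (hkd k) (\<lambda>q. ennreal k * u q) p"
        by (rule conv_cmult[symmetric]) auto
      also have "\<dots> = conv (hkd k) ?g p + conv (hkd k) ?Wu p"
        unfolding split_k[of "u q" q for q] by (rule conv_add) auto
      finally show ?thesis .
    qed
    have "ennreal k * conv (hkd k) u p + (conv hk ?Wu p + conv hk f p) + c * hkd k (p - (y, 0))
      = ennreal k * conv (hkd k) u p
       + ((conv (hkd k) ?Wu p + ennreal k * conv (hkd k) (conv hk ?Wu) p)
         + (conv (hkd k) f p + ennreal k * conv (hkd k) (conv hk f) p)) + c * hkd k (p - (y, 0))"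
      using k_pos by (simp add: conv_resolvent)
    also have "\<dots> = (ennreal k * conv (hkd k) u p + ennreal k * conv (hkd k) (conv hk ?Wu) p
       + ennreal k * conv (hkd k) (conv hk f) p) + c * hkd k (p - (y, 0)) + conv (hkd k) ?Wu p + conv (hkd k) f p"
      by (simp add: ac_simps)
    also have "\<dots> = c * (hkd k (p - (y, 0)) + ennreal k * conv (hkd k) (hk_at y) p) + conv (hkd k) ?Wu p + conv (hkd k) f p"
      unfolding 1 by (simp add: distrib_left ac_simps)
    also have "\<dots> = (u p + conv hk ?Wu p + conv hk f p) + conv (hkd k) ?Wu p + conv (hkd k) f p"
      unfolding eq using k_pos by (simp add: conv_resolvent_at)
    finally have "(conv hk ?Wu p + conv hk f p) + (ennreal k * conv (hkd k) u p + c * hkd k (p - (y, 0)))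
       = (conv hk ?Wu p + conv hk f p) + (u p + conv (hkd k) ?Wu p + conv (hkd k) f p)"
      by (simp add: ac_simps)
    then have "ennreal k * conv (hkd k) u p + c * hkd k (p - (y, 0)) = u p + conv (hkd k) ?Wu p + conv (hkd k) f p"
      using fin1 by (auto simp only: ennreal_add_left_cancel infinity_ennreal_def less_irrefl)
    then have "conv (hkd k) ?Wu p + (c * hkd k (p - (y, 0)) + conv (hkd k) ?g p)
      = conv (hkd k) ?Wu p + (u p + conv (hkd k) f p)"
      unfolding 2 by (simp add: ac_simps)
    then have "c * hkd k (p - (y, 0)) + conv (hkd k) ?g p = u p + conv (hkd k) f p"
      using fin2 by (auto simp only: ennreal_add_left_cancel infinity_ennreal_def less_irrefl)
    then show ?thesis by simp
  qed
  \<comment> \<open>The gap to the iterates starts as the full heat kernel, which is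
    \<open>heat_rem k 0\<close>, and each iteration integrates it once more in time.\<close>
  have step: "u p \<le> c * picard W k j y p + heat_rem k j y p" for j p
  proof (induction j arbitrary: p)
    case 0
    then show ?case using u_le by simp
  next
    case (Suc j)
    have "conv (hkd k) ?g p \<le> conv (hkd k) (\<lambda>q. ennreal (k - W q) * (c * picard W k j y q + heat_rem k j y q)) p"
      by (intro conv_mono mult_left_mono Suc) simp
    also have "\<dots> = conv (hkd k) (\<lambda>q. c * (ennreal (k - W q) * picard W k j y q) + ennreal (k - W q) * heat_rem k j y q) p"
      by (simp add: distrib_left ac_simps)
    also have "\<dots> = c * conv (hkd k) (\<lambda>q. ennreal (k - W q) * picard W k j y q) p
       + conv (hkd k) (\<lambda>q. ennreal (k - W q) * heat_rem k j y q) p"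
      by (simp add: conv_add conv_cmult)
    also have "conv (hkd k) (\<lambda>q. ennreal (k - W q) * heat_rem k j y q) p \<le> conv (hkd k) (\<lambda>q. ennreal k * heat_rem k j y q) p"
      by (intro conv_mono mult_right_mono k_minus_W_le) simp
    also have "\<dots> \<le> conv hk (\<lambda>q. ennreal k * heat_rem k j y q) p"
      using k_pos by (intro conv_mono_left hkd_le_hk) simp
    also have "\<dots> = heat_rem k (Suc j) y p"
      using k_pos by (simp add: conv_heat_rem)
    finally have "conv (hkd k) ?g p \<le> c * conv (hkd k) (\<lambda>q. ennreal (k - W q) * picard W k j y q) p + heat_rem k (Suc j) y p"
      by simp
    then show ?case
      using le[of p] by (simp add: distrib_left) (metis (no_types, lifting) add.assoc add_left_mono order_trans)
  qed
  have "u p \<le> c * kern W k y p + heat_rem k j y p" for j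
    unfolding kern_def
    by (rule order_trans[OF step[of p j]]) (intro add_right_mono mult_left_mono SUP_upper; simp)
  note le' = this
  have "(\<lambda>j. c * kern W k y p + heat_rem k j y p) \<longlonglongrightarrow> c * kern W k y p + 0"
    by (intro tendsto_add heat_rem_tendsto tendsto_const)
  then have "u p \<le> c * kern W k y p + 0"
    by (rule LIMSEQ_le_const) (use le' in blast)
  then show ?thesis by simp
qed

end

section \<open>Continuity of Duhamel integrals\<close>

lemma hk_tendsto:
  assumes "p \<longlonglongrightarrow> q" "0 < snd q"
  shows "(\<lambda>n. hk (p n)) \<longlonglongrightarrow> hk q"
proof -
  have s: "(\<lambda>n. snd (p n)) \<longlonglongrightarrow> snd q" using assms(1) by (rule tendsto_snd)
  have ev: "\<forall>\<^sub>F n in sequentially. hk (p n) = ennreal (heat (fst (p n)) (snd (p n)))"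
    using order_tendstoD(1)[OF s assms(2)] by eventually_elim (simp add: hk_def)
  have "(\<lambda>n. ennreal (heat (fst (p n)) (snd (p n)))) \<longlonglongrightarrow> ennreal (heat (fst q) (snd q))"
    by (intro tendsto_ennrealI tendsto_heat tendsto_fst assms s)
  then show ?thesis
    using assms(2) by (subst tendsto_cong[OF ev]) (simp add: hk_def)
qed

lemma hk_at_tendsto:
  assumes "p \<longlonglongrightarrow> q" "0 < snd q"
  shows "(\<lambda>n. hk_at y (p n)) \<longlonglongrightarrow> hk_at y q"
  by (rule hk_tendsto) (use assms in \<open>auto intro!: tendsto_intros\<close>)

text \<open>Where the limit argument has positive time \<open>hk\<close> is continuous, elsewhere
  its value is \<open>0\<close>, the smallest possible. So \<open>hk\<close> is lower
  semicontinuous, and Fatou's lemma passes this on to the convolution.\<close>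

lemma conv_hk_lsc:
  fixes f :: "'a::euclidean_space \<times> real \<Rightarrow> ennreal"
  assumes [measurable]: "f \<in> borel_measurable borel" and fin: "\<And>q. f q < \<top>" and p: "p \<longlonglongrightarrow> q"
  shows "conv hk f q \<le> liminf (\<lambda>n. conv hk f (p n))"
proof -
  have "hk (q - z) * f z \<le> liminf (\<lambda>n. hk (p n - z) * f z)" for z
  proof (cases "0 < snd (q - z)")
    case True
    have "(\<lambda>n. hk (p n - z)) \<longlonglongrightarrow> hk (q - z)"
      by (rule hk_tendsto) (use True p in \<open>auto intro!: tendsto_intros\<close>)
    then have "(\<lambda>n. hk (p n - z) * f z) \<longlonglongrightarrow> hk (q - z) * f z"
      by (intro tendsto_mult_ennreal tendsto_const) (use fin[of z] in auto)
    from lim_imp_Liminf[OF _ this] show ?thesis by simp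
  qed simp
  then have "conv hk f q \<le> (\<integral>\<^sup>+ z. liminf (\<lambda>n. hk (p n - z) * f z) \<partial>lborel)"
    unfolding conv_def by (intro nn_integral_mono)
  also have "\<dots> \<le> liminf (\<lambda>n. conv hk f (p n))"
    unfolding conv_def by (rule nn_integral_liminf) simp
  finally show ?thesis .
qed

text \<open>A lower bound for \<open>b\<close> is an upper bound for \<open>a\<close>, since the sum
  converges to a finite limit. Continuity thus costs only two applications of Fatou's lemma and no
  dominating function.\<close>

lemma tendsto_of_lsc_sum:
  fixes a b L :: "nat \<Rightarrow> ennreal"
  assumes sum: "\<And>n. a n + b n = L n" "a0 + b0 = L0" and L: "L \<longlonglongrightarrow> L0" "L0 < \<top>"
    and a: "a0 \<le> liminf a" and b: "b0 \<le> liminf b"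
  shows "a \<longlonglongrightarrow> a0"
proof (rule order_tendstoI)
  fix x assume "x < a0"
  then show "\<forall>\<^sub>F n in sequentially. x < a n"
    using a by (auto simp: le_Liminf_iff)
next
  fix x assume x: "a0 < x"
  have b0: "b0 < \<top>" using sum(2) L(2) by (metis add_top le_iff_add linorder_not_le top_greatest top.not_eq_extremum add.commute)
  have a0: "a0 < \<top>" using x by (simp add: order_less_le_trans)
  show "\<forall>\<^sub>F n in sequentially. a n < x"
  \<comment> \<open>For \<open>b0 = 0\<close> the lower bound on \<open>b\<close> carries no
    information and there is no room for an \<open>e\<close> below it; then
    \<open>a n \<le> L n\<close> suffices.\<close>
  proof (cases "b0 = 0")
    case True
    then have "\<forall>\<^sub>F n in sequentially. L n < x"
      using x sum(2) L(1) by (intro order_tendstoD(2)) auto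
    then show ?thesis
    proof eventually_elim
      case (elim n)
      have "a n \<le> L n" unfolding sum(1)[symmetric] by simp
      with elim show ?case by (rule le_less_trans[rotated])
    qed
  next
    case False
    obtain x' where x': "a0 < x'" "x' < x" using dense[OF x] by blast
    have x'fin: "x' < \<top>" using x' by (simp add: order_less_le_trans)
    obtain A where A: "a0 = ennreal A" "0 \<le> A" using a0 by (cases a0) auto
    obtain B where B: "b0 = ennreal B" "0 \<le> B" using b0 by (cases b0) auto
    obtain X where X: "x' = ennreal X" "0 \<le> X" using x'fin by (cases x') auto
    have AX: "A < X" using x'(1) A X by (simp add: ennreal_less_iff)
    have B0: "0 < B" using False B by (metis ennreal_0 less_eq_real_def)
    define e where "e = min ((X - A) / 2) (B / 2)"
    have e: "0 < e" "e < B" "2 * e \<le> X - A" using AX B0 by (auto simp: e_def min_def)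
    have 1: "\<forall>\<^sub>F n in sequentially. ennreal (B - e) < b n"
      using b e B by (auto simp: le_Liminf_iff ennreal_less_iff)
    have 2: "\<forall>\<^sub>F n in sequentially. L n < ennreal (A + B + e)"
      using L(1) sum(2)[symmetric] A B e
      by (intro order_tendstoD(2)) (auto simp: ennreal_plus[symmetric] ennreal_less_iff simp del: ennreal_plus)
    show ?thesis using 1 2
    proof eventually_elim
      case (elim n)
      have "a n + ennreal (B - e) \<le> a n + b n" using elim by (intro add_left_mono) auto
      also have "\<dots> < ennreal (A + B + e)" using elim sum by simp
      also have "\<dots> \<le> ennreal X + ennreal (B - e)"
        using e A X by (simp add: ennreal_plus[symmetric] ennreal_leI del: ennreal_plus)
      finally have "a n + ennreal (B - e) < ennreal X + ennreal (B - e)" .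
      then have "a n < ennreal X" by (metis add_right_mono linorder_not_le)
      then show ?case using x' X by (auto intro: less_trans)
    qed
  qed
qed

text \<open>The complementary density is \<open>C * hk_at y - f\<close>: the two heat potentials add
  up to \<open>C * t\<close> times the heat kernel, which is explicit and continuous at positive
  times.\<close>

lemma conv_hk_tendsto:
  fixes f :: "'a::euclidean_space \<times> real \<Rightarrow> ennreal"
  assumes [measurable]: "f \<in> borel_measurable borel"
    and f: "\<And>q. f q \<le> ennreal C * hk_at y q" and p: "p \<longlonglongrightarrow> q" "0 < snd q"
  shows "(\<lambda>n. conv hk f (p n)) \<longlonglongrightarrow> conv hk f q"
proof (rule tendsto_of_lsc_sum[where b="\<lambda>n. conv hk (\<lambda>z. ennreal C * hk_at y z - f z) (p n)"
      and L="\<lambda>n. ennreal C * ennreal (snd (p n)) * hk_at y (p n)"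
      and ?b0.0="conv hk (\<lambda>z. ennreal C * hk_at y z - f z) q"
      and ?L0.0="ennreal C * ennreal (snd q) * hk_at y q"])
  have "conv hk f r + conv hk (\<lambda>z. ennreal C * hk_at y z - f z) r = ennreal C * ennreal (snd r) * hk_at y r" for r
    by (subst conv_add[symmetric]) (auto simp: f conv_hk_at add_diff_inverse_ennreal)
  then show "conv hk f (p n) + conv hk (\<lambda>z. ennreal C * hk_at y z - f z) (p n) = ennreal C * ennreal (snd (p n)) * hk_at y (p n)"
    "conv hk f q + conv hk (\<lambda>z. ennreal C * hk_at y z - f z) q = ennreal C * ennreal (snd q) * hk_at y q" for n
    by auto
  have "(\<lambda>n. ennreal C * ennreal (snd (p n))) \<longlonglongrightarrow> ennreal C * ennreal (snd q)"
    by (intro tendsto_mult_ennreal tendsto_const tendsto_ennrealI tendsto_snd p) auto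
  then show "(\<lambda>n. ennreal C * ennreal (snd (p n)) * hk_at y (p n)) \<longlonglongrightarrow> ennreal C * ennreal (snd q) * hk_at y q"
    by (rule tendsto_mult_ennreal[OF _ hk_at_tendsto[OF p]]) (auto simp: ennreal_mult_eq_top_iff)
  show "ennreal C * ennreal (snd q) * hk_at y q < \<top>"
    by (auto simp: ennreal_mult_less_top)
  have fin: "ennreal C * hk_at y z < \<top>" for z
    by (auto simp: ennreal_mult_less_top)
  show "conv hk f q \<le> liminf (\<lambda>n. conv hk f (p n))"
    using le_less_trans[OF f fin] by (intro conv_hk_lsc p) auto
  show "conv hk (\<lambda>z. ennreal C * hk_at y z - f z) q \<le> liminf (\<lambda>n. conv hk (\<lambda>z. ennreal C * hk_at y z - f z) (p n))"
    using le_less_trans[OF diff_le_self_ennreal fin] by (intro conv_hk_lsc p) auto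
qed

section \<open>Directional derivatives\<close>

lemma C1_dir_has_derivative:
  assumes "C1_dir v f"
  shows "((\<lambda>s. f (z + s *\<^sub>R v)) has_real_derivative dir_deriv v f z) (at 0)"
  using assms by (simp add: C1_dir_def dir_deriv_def DERIV_deriv_iff_field_differentiable)

lemma dir_deriv_eqI:
  "((\<lambda>s. f (z + s *\<^sub>R v)) has_real_derivative D) (at 0) \<Longrightarrow> dir_deriv v f z = D"
  by (simp add: dir_deriv_def DERIV_imp_deriv)

lemma C1_dirI:
  assumes "\<And>z. ((\<lambda>s. f (z + s *\<^sub>R v)) has_real_derivative D z) (at 0)" "continuous_on UNIV D"
  shows "C1_dir v f" "dir_deriv v f = D"
proof -
  show "dir_deriv v f = D" using dir_deriv_eqI[OF assms(1)] by auto
  then show "C1_dir v f"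
    using assms by (auto simp: C1_dir_def field_differentiable_def)
qed

lemma has_derivative_along_line:
  fixes f D :: "'b::real_normed_vector \<Rightarrow> real"
  assumes "\<And>z. ((\<lambda>s. f (z + s *\<^sub>R v)) has_real_derivative D z) (at 0)"
  shows "((\<lambda>s. f (z + s *\<^sub>R v)) has_real_derivative D (z + r *\<^sub>R v)) (at r)"
proof -
  have "((\<lambda>s. f ((z + r *\<^sub>R v) + (s + - r) *\<^sub>R v)) has_real_derivative D (z + r *\<^sub>R v)) (at r)"
    using assms[of "z + r *\<^sub>R v"] DERIV_shift[of "\<lambda>s. f ((z + r *\<^sub>R v) + s *\<^sub>R v)" _ r "- r"] by simp
  then show ?thesis by (simp add: algebra_simps)
qed

lemma dir_deriv_zero_outside:
  fixes f :: "'b::real_normed_vector \<Rightarrow> real" and D :: real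
  assumes "((\<lambda>s. f (z + s *\<^sub>R v)) has_real_derivative D) (at 0)"
    and "closed K" "\<And>z. z \<notin> K \<Longrightarrow> f z = 0" "z \<notin> K"
  shows "D = 0"
proof -
  have "((\<lambda>s. z + s *\<^sub>R v) \<longlongrightarrow> z + 0 *\<^sub>R v) (nhds (0::real))"
    by (intro tendsto_intros filterlim_ident)
  then have "\<forall>\<^sub>F s in nhds (0::real). z + s *\<^sub>R v \<in> - K"
    using assms by (intro topological_tendstoD) auto
  then have "\<forall>\<^sub>F s in nhds (0::real). f (z + s *\<^sub>R v) = 0"
    by eventually_elim (use assms in auto)
  then have "((\<lambda>s. 0) has_real_derivative D) (at 0)"
    using assms(1) DERIV_cong_ev[OF refl _ refl, of "\<lambda>s. f (z + s *\<^sub>R v)" "\<lambda>s. 0" "0::real" D] by blast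
  then show ?thesis
    using DERIV_unique[OF _ DERIV_const] by blast
qed

lemma integrable_compact_support:
  fixes f :: "'b::euclidean_space \<Rightarrow> real"
  assumes "continuous_on UNIV f" "compact K" "\<And>z. z \<notin> K \<Longrightarrow> f z = 0"
  shows "integrable lborel f"
proof -
  have "integrable lborel (\<lambda>x. indicator K x *\<^sub>R f x)"
    using assms by (intro borel_integrable_compact continuous_on_subset[OF assms(1)]) auto
  moreover have "(\<lambda>x. indicator K x *\<^sub>R f x) = f"
    using assms(3) by (auto simp: fun_eq_iff indicator_def)
  ultimately show ?thesis by simp
qed

lemma bounded_compact_support:
  fixes f :: "'b::euclidean_space \<Rightarrow> real"
  assumes "continuous_on UNIV f" "compact K" "\<And>z. z \<notin> K \<Longrightarrow> f z = 0"
  obtains B where "0 \<le> B" "\<And>z. \<bar>f z\<bar> \<le> B"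
proof -
  have "bounded (f ` K)"
    using assms by (intro compact_imp_bounded compact_continuous_image continuous_on_subset[OF assms(1)]) auto
  then obtain B where B: "\<And>z. z \<in> K \<Longrightarrow> \<bar>f z\<bar> \<le> B"
    by (auto simp: bounded_iff)
  show thesis
  proof (rule that[of "max 0 B"])
    fix z show "\<bar>f z\<bar> \<le> max 0 B"
      using B[of z] assms(3)[of z] by (cases "z \<in> K") auto
  qed simp
qed

lemma difference_quotient_bound:
  fixes f D :: "'b::real_normed_vector \<Rightarrow> real"
  assumes der: "\<And>z. ((\<lambda>s. f (z + s *\<^sub>R v)) has_real_derivative D z) (at 0)"
    and B: "\<And>z. \<bar>D z\<bar> \<le> B" and h: "0 < h"
  shows "\<bar>(f (z + h *\<^sub>R v) - f z) / h\<bar> \<le> B"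
proof -
  obtain r where "f (z + h *\<^sub>R v) - f (z + 0 *\<^sub>R v) = (h - 0) * D (z + r *\<^sub>R v)"
    using MVT2[OF h, of "\<lambda>s. f (z + s *\<^sub>R v)" "\<lambda>s. D (z + s *\<^sub>R v)"] has_derivative_along_line[OF der] by blast
  then show ?thesis using B h by simp
qed

lemma difference_quotient_tendsto:
  fixes f :: "'b::real_normed_vector \<Rightarrow> real"
  assumes "((\<lambda>s. f (z + s *\<^sub>R v)) has_real_derivative D) (at 0)"
  shows "(\<lambda>n. (f (z + inverse (real (Suc n)) *\<^sub>R v) - f z) / inverse (real (Suc n))) \<longlonglongrightarrow> D"
proof -
  have "filterlim (\<lambda>n. inverse (real (Suc n))) (at 0) sequentially"
    using LIMSEQ_inverse_real_of_nat by (auto simp: filterlim_at)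
  moreover have "((\<lambda>h. (f (z + h *\<^sub>R v) - f z) / h) \<longlongrightarrow> D) (at 0)"
    using assms by (simp add: DERIV_def)
  ultimately show ?thesis
    by (rule filterlim_compose[rotated])
qed

text \<open>Translation invariance makes the integral of every difference quotient vanish, and the
  mean value bound lets the step tend to \<open>0\<close>. Only the derivative along
  \<open>v\<close> enters, which is the form in which \<open>C21\<close> provides
  derivatives.\<close>

lemma integral_dir_deriv_zero:
  fixes F D :: "'b::euclidean_space \<Rightarrow> real"
  assumes cF: "continuous_on UNIV F" and cD: "continuous_on UNIV D"
    and der: "\<And>z. ((\<lambda>s. F (z + s *\<^sub>R v)) has_real_derivative D z) (at 0)"
    and K: "compact K" "\<And>z. z \<notin> K \<Longrightarrow> F z = 0"
  shows "(\<integral>z. D z \<partial>lborel) = 0"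
proof -
  let ?h = "\<lambda>n. inverse (real (Suc n))"
  have D0: "D z = 0" if "z \<notin> K" for z
    by (rule dir_deriv_zero_outside[OF der compact_imp_closed[OF K(1)] K(2) that])
  obtain B where B: "0 \<le> B" "\<And>z. \<bar>D z\<bar> \<le> B"
    using bounded_compact_support[OF cD K(1) D0] by blast
  \<comment> \<open>The support swept back along \<open>v\<close> for parameters between
    \<open>0\<close> and \<open>1\<close>; it contains the supports of all difference quotients with
    step at most \<open>1\<close>.\<close>
  define K' where "K' = (\<lambda>(a, s). a - s *\<^sub>R v) ` (K \<times> {0..1::real})"
  have K': "compact K'"
    unfolding K'_def case_prod_beta by (intro compact_continuous_image compact_Times K continuous_intros) auto
  have [measurable]: "F \<in> borel_measurable borel" "D \<in> borel_measurable borel"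
    using cF cD by (auto intro: borel_measurable_continuous_onI)
  have intF: "integrable lborel F" by (rule integrable_compact_support[OF cF K])
  have q0: "(\<integral>z. (F (z + ?h n *\<^sub>R v) - F z) / ?h n \<partial>lborel) = 0" for n
  proof -
    have i: "integrable lborel (\<lambda>z. F (?h n *\<^sub>R v + z))"
    proof -
      have "integrable (distr lborel borel ((+) (?h n *\<^sub>R v))) F"
        using intF by (simp add: lborel_distr_plus)
      then show ?thesis by (subst (asm) integrable_distr_eq) auto
    qed
    have "(\<integral>z. F (?h n *\<^sub>R v + z) \<partial>lborel) = (\<integral>z. F z \<partial>distr lborel borel ((+) (?h n *\<^sub>R v)))"
      by (subst integral_distr) auto
    also have "\<dots> = (\<integral>z. F z \<partial>lborel)" by (simp add: lborel_distr_plus)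
    finally show ?thesis
      using i intF by (simp add: add.commute)
  qed
  have "(\<lambda>n. \<integral>z. (F (z + ?h n *\<^sub>R v) - F z) / ?h n \<partial>lborel) \<longlonglongrightarrow> (\<integral>z. D z \<partial>lborel)"
  proof (rule integral_dominated_convergence[where w="\<lambda>z. B * indicator K' z"])
    have "emeasure lborel K' < \<infinity>"
      by (rule emeasure_bounded_finite[OF compact_imp_bounded[OF K']])
    then show "integrable lborel (\<lambda>z. B * indicator K' z)"
      using borel_compact[OF K'] by (intro integrable_mult_right integrable_real_indicator) auto
    show "AE z in lborel. (\<lambda>n. (F (z + ?h n *\<^sub>R v) - F z) / ?h n) \<longlonglongrightarrow> D z"
      using difference_quotient_tendsto[OF der] by auto
    show "AE z in lborel. norm ((F (z + ?h n *\<^sub>R v) - F z) / ?h n) \<le> B * indicator K' z" for n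
    proof (rule AE_I2)
      fix z :: 'b
      have h: "0 < ?h n" "?h n \<le> 1" by (auto simp: field_simps)
      show "norm ((F (z + ?h n *\<^sub>R v) - F z) / ?h n) \<le> B * indicator K' z"
      proof (cases "z \<in> K'")
        case True
        then show ?thesis using difference_quotient_bound[OF der B(2) h(1), of z] by simp
      next
        case False
        have "z \<notin> K"
        proof
          assume "z \<in> K"
          then have "z \<in> K'" unfolding K'_def by (intro image_eqI[of _ _ "(z, 0)"]) auto
          with False show False ..
        qed
        moreover have "z + ?h n *\<^sub>R v \<notin> K"
        proof
          assume "z + ?h n *\<^sub>R v \<in> K"
          then have "z \<in> K'" unfolding K'_def using h by (intro image_eqI[of _ _ "(z + ?h n *\<^sub>R v, ?h n)"]) auto
          with False show False ..
        qed
        ultimately show ?thesis using False K by simp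
      qed
    qed
  qed auto
  then show ?thesis
    unfolding q0 using LIMSEQ_unique tendsto_const by blast
qed

section \<open>The heat kernel as a fundamental solution\<close>

lemma heat_inner: "heat u r = (4 * pi * r) powr (- (real DIM('a) / 2)) * exp (- (u \<bullet> u) / (4 * r))"
  for u :: "'a::euclidean_space"
  by (simp add: heat_def power2_norm_eq_inner)

lemma heat_space_derivative:
  fixes u b :: "'a::euclidean_space"
  assumes "0 < r"
  shows "((\<lambda>s. heat (u + s *\<^sub>R b) r) has_real_derivative - (u \<bullet> b) / (2 * r) * heat u r) (at 0)"
proof -
  have e: "heat (u + s *\<^sub>R b) r = (4 * pi * r) powr (- (real DIM('a) / 2))
      * exp (- (u \<bullet> u + 2 * s * (u \<bullet> b) + s * s * (b \<bullet> b)) / (4 * r))" for s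
    by (simp add: heat_inner inner_simps inner_commute algebra_simps)
  show ?thesis
    unfolding e using assms
    by (auto intro!: derivative_eq_intros simp: heat_inner)
qed

lemma heat_time_derivative:
  fixes u :: "'a::euclidean_space"
  assumes "0 < r"
  shows "((\<lambda>r. heat u r) has_real_derivative ((u \<bullet> u) / (4 * r\<^sup>2) - real DIM('a) / (2 * r)) * heat u r) (at r)"
proof -
  define a where "a = - (real DIM('a) / 2)"
  have 1: "((\<lambda>r. (4 * pi * r) powr a) has_real_derivative a / r * (4 * pi * r) powr a) (at r)"
  proof -
    have "((\<lambda>r. (4 * pi * r) powr a) has_real_derivative a * (4 * pi * r) powr (a - 1) * (4 * pi)) (at r)"
      using assms by (auto intro!: derivative_eq_intros)
    moreover have "a * (4 * pi * r) powr (a - 1) * (4 * pi) = a / r * (4 * pi * r) powr a"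
      using assms by (simp add: powr_diff)
    ultimately show ?thesis by (simp only:)
  qed
  have 2: "((\<lambda>r. - (u \<bullet> u) / (4 * r)) has_real_derivative (u \<bullet> u) / (4 * r\<^sup>2)) (at r)"
    using assms by (auto intro!: derivative_eq_intros simp: power2_eq_square)
  have "((\<lambda>r. (4 * pi * r) powr a * exp (- (u \<bullet> u) / (4 * r))) has_real_derivative
      ((u \<bullet> u) / (4 * r\<^sup>2) + a / r) * ((4 * pi * r) powr a * exp (- (u \<bullet> u) / (4 * r)))) (at r)"
    by (rule DERIV_cong[OF DERIV_mult[OF 1 DERIV_fun_exp[OF 2]]]) (simp add: algebra_simps)
  moreover have "(u \<bullet> u) / (4 * r\<^sup>2) + a / r = (u \<bullet> u) / (4 * r\<^sup>2) - real DIM('a) / (2 * r)"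
    by (simp add: a_def)
  ultimately show ?thesis
    unfolding heat_inner a_def[symmetric] by (simp only:)
qed

lemma integral_lborel_scale:
  fixes f :: "'a::euclidean_space \<Rightarrow> real"
  assumes [measurable]: "f \<in> borel_measurable borel" and r: "0 < r"
  shows "(\<integral> z. heat z r * f z \<partial>lborel) = (\<integral> v. heat v 1 * f (sqrt r *\<^sub>R v) \<partial>lborel)"
proof -
  have "(\<integral> z. heat z r * f z \<partial>lborel)
      = (\<integral> z. heat z r * f z \<partial>density (distr lborel borel (\<lambda>x. 0 + sqrt r *\<^sub>R x)) (\<lambda>_. \<bar>sqrt r\<bar> ^ DIM('a)))"
    using lborel_affine[of "sqrt r" "0::'a"] r by simp
  also have "\<dots> = (\<integral> v. sqrt r ^ DIM('a) * (heat (sqrt r *\<^sub>R v) r * f (sqrt r *\<^sub>R v)) \<partial>lborel)"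
    using r by (subst integral_density) (auto simp: integral_distr)
  also have "\<dots> = (\<integral> v. heat v 1 * f (sqrt r *\<^sub>R v) \<partial>lborel)"
    using r by (simp add: mult.assoc[symmetric] heat_scale)
  finally show ?thesis .
qed

lemma integrable_heat: "0 < r \<Longrightarrow> integrable lborel (\<lambda>x::'a::euclidean_space. heat x r)"
  by (rule integrableI_nonneg) (auto simp: nn_integral_heat)

lemma integral_heat: "0 < r \<Longrightarrow> (\<integral>x. heat (x::'a::euclidean_space) r \<partial>lborel) = 1"
  using nn_integral_heat[of r, where 'a='a] integrable_heat[of r, where 'a='a]
  by (subst integral_eq_nn_integral) auto

text \<open>In the variable \<open>z / sqrt (r n)\<close> the kernel is fixed, so dominated
  convergence applies. The functions may vary with \<open>n\<close> and need to converge only on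
  this parabolic scale.\<close>

lemma heat_concentrates:
  fixes F :: "nat \<Rightarrow> 'a::euclidean_space \<Rightarrow> real"
  assumes [measurable]: "\<And>n. F n \<in> borel_measurable borel"
    and B: "\<And>n z. \<bar>F n z\<bar> \<le> B" and r: "\<And>n. 0 < r n"
    and F: "\<And>v. (\<lambda>n. F n (sqrt (r n) *\<^sub>R v)) \<longlonglongrightarrow> L"
  shows "(\<lambda>n. \<integral>z. heat z (r n) * F n z \<partial>lborel) \<longlonglongrightarrow> L"
proof -
  have "(\<lambda>n. \<integral>v. heat v 1 * F n (sqrt (r n) *\<^sub>R v) \<partial>lborel) \<longlonglongrightarrow> (\<integral>v. heat (v::'a) 1 * L \<partial>lborel)"
  proof (rule integral_dominated_convergence[where w="\<lambda>v. heat v 1 * B"])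
    show "integrable lborel (\<lambda>v::'a. heat v 1 * B)"
      by (simp add: integrable_heat)
    show "AE v in lborel. (\<lambda>n. heat v 1 * F n (sqrt (r n) *\<^sub>R v)) \<longlonglongrightarrow> heat v 1 * L"
      by (intro AE_I2 tendsto_intros F)
    show "AE v in lborel. norm (heat v 1 * F n (sqrt (r n) *\<^sub>R v)) \<le> heat v 1 * B" for n
      using B by (auto simp: abs_mult intro!: mult_left_mono)
  qed auto
  moreover have "(\<integral>z. heat z (r n) * F n z \<partial>lborel) = (\<integral>v. heat v 1 * F n (sqrt (r n) *\<^sub>R v) \<partial>lborel)" for n
    by (rule integral_lborel_scale) (use r in auto)
  ultimately show ?thesis
    by (simp add: integral_heat)
qed

text \<open>The real-valued version of \<open>hk\<close>, for integrals against functions of either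
  sign.\<close>

definition hkr :: "'a::euclidean_space \<times> real \<Rightarrow> real" where
  "hkr p = (if 0 < snd p then heat (fst p) (snd p) else 0)"

lemma hk_eq_hkr: "hk p = ennreal (hkr p)"
  by (simp add: hk_def hkr_def)

lemma hkr_nonneg [simp]: "0 \<le> hkr p"
  by (simp add: hkr_def)

lemma hkr_eq_0 [simp]: "snd p \<le> 0 \<Longrightarrow> hkr p = 0"
  by (simp add: hkr_def)

lemma measurable_hkr [measurable]: "hkr \<in> borel_measurable borel"
proof -
  have "hkr \<in> borel_measurable (borel \<Otimes>\<^sub>M borel)"
    unfolding hkr_def[abs_def] by measurable
  then show ?thesis by (simp add: borel_prod)
qed

lemma nn_integral_hk_strip:
  fixes y :: "'a::euclidean_space"
  assumes [measurable]: "\<phi> \<in> borel_measurable borel"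
  shows "(\<integral>\<^sup>+ q. \<phi> (snd q) * hk_at y q \<partial>lborel) = (\<integral>\<^sup>+ s\<in>{0<..}. \<phi> s \<partial>lborel)"
proof -
  have "(\<integral>\<^sup>+ q. \<phi> (snd q) * hk_at y q \<partial>lborel) = (\<integral>\<^sup>+ s. \<integral>\<^sup>+ z. \<phi> s * hk (z - y, s) \<partial>lborel \<partial>lborel)"
    by (subst nn_integral_lborel_pair(1)) auto
  also have "\<dots> = (\<integral>\<^sup>+ s\<in>{0<..}. \<phi> s \<partial>lborel)"
  proof (rule nn_integral_cong)
    fix s
    have "(\<integral>\<^sup>+ z. ennreal (heat (z - y) s) \<partial>lborel) = 1" if "0 < s"
      using that nn_integral_lborel_shift_minus[of "\<lambda>z. ennreal (heat z s)" y] by (simp add: nn_integral_heat)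
    then show "(\<integral>\<^sup>+ z. \<phi> s * hk (z - y, s) \<partial>lborel) = \<phi> s * indicator {0<..} s"
      by (cases "0 < s") (auto simp: hk_def nn_integral_cmult)
  qed
  finally show ?thesis .
qed

lemma integrable_hkr_strip: "integrable lborel (\<lambda>z. hkr (z - (y, 0)) * indicator {..R} (snd z))"
proof (rule integrableI_nonneg)
  have "(\<integral>\<^sup>+ z. ennreal (hkr (z - (y, 0)) * indicator {..R} (snd z)) \<partial>lborel)
      = (\<integral>\<^sup>+ z. indicator {..R} (snd z) * hk_at y z \<partial>lborel)"
    by (intro nn_integral_cong) (auto simp: hk_eq_hkr split: split_indicator)
  also have "\<dots> = (\<integral>\<^sup>+ s\<in>{0<..}. indicator {..R} s \<partial>lborel)"
    by (rule nn_integral_hk_strip) simp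
  also have "\<dots> = (\<integral>\<^sup>+ s. indicator {0<..R} s \<partial>lborel)"
    by (rule nn_integral_cong) (auto split: split_indicator)
  also have "\<dots> < \<infinity>"
    by (cases "0 \<le> R") auto
  finally show "(\<integral>\<^sup>+ z. ennreal (hkr (z - (y, 0)) * indicator {..R} (snd z)) \<partial>lborel) < \<infinity>" .
qed auto

section \<open>Integration by parts against a test function\<close>

locale test_function =
  fixes \<psi> :: "'a::euclidean_space \<times> real \<Rightarrow> real" and K :: "('a \<times> real) set"
  assumes C21: "C21 \<psi>" and K: "compact K" and out: "\<And>z. z \<notin> K \<Longrightarrow> \<psi> z = 0"
begin

lemma cont: "continuous_on UNIV \<psi>" "continuous_on UNIV (time_deriv \<psi>)"
  "b \<in> Basis \<Longrightarrow> continuous_on UNIV (space_deriv b \<psi>)"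
  "b \<in> Basis \<Longrightarrow> c \<in> Basis \<Longrightarrow> continuous_on UNIV (space_deriv c (space_deriv b \<psi>))"
  using C21 unfolding C21_def C1_dir_def time_deriv_def space_deriv_def by blast+

lemma cont_laplacian: "continuous_on UNIV (laplacian \<psi>)"
  unfolding laplacian_def[abs_def] by (rule continuous_on_sum) (rule cont(4))

lemma deriv_time: "((\<lambda>s. \<psi> (z + s *\<^sub>R (0, 1))) has_real_derivative time_deriv \<psi> z) (at 0)"
  unfolding time_deriv_def by (rule C1_dir_has_derivative) (use C21 in \<open>unfold C21_def, blast\<close>)

lemma deriv_space: "b \<in> Basis \<Longrightarrow> ((\<lambda>s. \<psi> (z + s *\<^sub>R (b, 0))) has_real_derivative space_deriv b \<psi> z) (at 0)"
  unfolding space_deriv_def[of b \<psi>] by (rule C1_dir_has_derivative) (use C21 in \<open>unfold C21_def, blast\<close>)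

lemma deriv_space2: "b \<in> Basis \<Longrightarrow> c \<in> Basis \<Longrightarrow>
    ((\<lambda>s. space_deriv b \<psi> (z + s *\<^sub>R (c, 0))) has_real_derivative space_deriv c (space_deriv b \<psi>) z) (at 0)"
  unfolding space_deriv_def[of c] by (rule C1_dir_has_derivative) (use C21 in \<open>unfold C21_def, blast\<close>)

lemma out_time: "z \<notin> K \<Longrightarrow> time_deriv \<psi> z = 0"
  by (rule dir_deriv_zero_outside[OF deriv_time compact_imp_closed[OF K] out])

lemma out_space: "b \<in> Basis \<Longrightarrow> z \<notin> K \<Longrightarrow> space_deriv b \<psi> z = 0"
  by (rule dir_deriv_zero_outside[OF deriv_space compact_imp_closed[OF K] out])

lemma out_space2: "b \<in> Basis \<Longrightarrow> c \<in> Basis \<Longrightarrow> z \<notin> K \<Longrightarrow> space_deriv c (space_deriv b \<psi>) z = 0"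
  by (rule dir_deriv_zero_outside[OF deriv_space2 compact_imp_closed[OF K] out_space])

lemma out_laplacian: "z \<notin> K \<Longrightarrow> laplacian \<psi> z = 0"
  by (simp add: laplacian_def out_space2)

lemma meas [measurable]: "\<psi> \<in> borel_measurable borel" "time_deriv \<psi> \<in> borel_measurable borel"
  "laplacian \<psi> \<in> borel_measurable borel"
  by (rule borel_measurable_continuous_onI[OF cont(1)] borel_measurable_continuous_onI[OF cont(2)]
      borel_measurable_continuous_onI[OF cont_laplacian])+

text \<open>The adjoint of the heat operator; weak solutions are tested against
  \<open>L + W * \<psi>\<close>.\<close>

definition L :: "'a \<times> real \<Rightarrow> real" where "L z = - time_deriv \<psi> z - laplacian \<psi> z"

lemma measurable_L [measurable]: "L \<in> borel_measurable borel"
  unfolding L_def[abs_def] by measurable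

lemma cont_L: "continuous_on UNIV L"
  unfolding L_def[abs_def] by (intro continuous_intros cont cont_laplacian)

lemma out_L: "z \<notin> K \<Longrightarrow> L z = 0"
  by (simp add: L_def out_time out_laplacian)

lemma time_bound: obtains R where "0 < R" "\<And>z::'a \<times> real. R \<le> snd z \<Longrightarrow> z \<notin> K"
proof -
  have "bounded (snd ` K)"
    using K by (intro compact_imp_bounded compact_continuous_image continuous_intros)
  then obtain R where R: "0 < R" "\<forall>x\<in>snd ` K. norm x < R"
    unfolding bounded_pos_less by blast
  show thesis
  proof (rule that[OF R(1)])
    fix z :: "'a \<times> real" assume "R \<le> snd z"
    show "z \<notin> K"
    proof
      assume "z \<in> K"
      with R(2) have "norm (snd z) < R" by blast
      with \<open>R \<le> snd z\<close> show False by simp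
    qed
  qed
qed

lemma integrable_cut:
  fixes g :: "'a \<times> real \<Rightarrow> real"
  assumes "0 < \<epsilon>" "continuous_on {z. 0 < snd z} g" "\<And>z. z \<notin> K \<Longrightarrow> g z = 0"
  shows "integrable lborel (\<lambda>z. indicator {\<epsilon>..} (snd z) * g z)"
proof -
  have "integrable lborel (\<lambda>z. indicator (K \<inter> {z. \<epsilon> \<le> snd z}) z *\<^sub>R g z)"
  proof (rule borel_integrable_compact)
    show "compact (K \<inter> {z. \<epsilon> \<le> snd z})"
      by (intro compact_Int_closed K closed_Collect_le continuous_intros)
    show "continuous_on (K \<inter> {z. \<epsilon> \<le> snd z}) g"
      using assms by (intro continuous_on_subset[OF assms(2)]) auto
  qed
  moreover have "(\<lambda>z. indicator (K \<inter> {z. \<epsilon> \<le> snd z}) z *\<^sub>R g z) = (\<lambda>z. indicator {\<epsilon>..} (snd z) * g z)"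
    using assms(3) by (auto simp: fun_eq_iff indicator_def)
  ultimately show ?thesis by simp
qed

text \<open>This expression is both the time derivative and the Laplacian of the heat kernel.
  Sharing it between the integrations by parts in time and in space makes its contributions cancel;
  this is where the heat equation enters.\<close>

definition heat_t :: "'a \<times> real \<Rightarrow> real" where
  "heat_t z = ((fst z \<bullet> fst z) / (4 * (snd z)\<^sup>2) - real DIM('a) / (2 * snd z)) * heat (fst z) (snd z)"

lemma continuous_heat: "continuous_on {z. 0 < snd z} (\<lambda>z. heat (fst z :: 'a) (snd z))"
  unfolding heat_inner by (intro continuous_intros) auto

lemma continuous_heat_t: "continuous_on {z. 0 < snd z} heat_t"
  unfolding heat_t_def[abs_def] by (intro continuous_intros continuous_heat) auto

lemma space_parts:
  assumes r: "0 < r"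
  shows "(\<integral>u. heat u r * laplacian \<psi> (u, r) - heat_t (u, r) * \<psi> (u, r) \<partial>lborel) = 0"
proof -
  define D where "D b u = heat u r * space_deriv b (space_deriv b \<psi>) (u, r)
      - ((u \<bullet> b)\<^sup>2 / (4 * r\<^sup>2) - 1 / (2 * r)) * heat u r * \<psi> (u, r)" for b u
  have K': "compact (fst ` K)" by (intro compact_continuous_image K continuous_intros)
  have sl: "continuous_on UNIV (\<lambda>u. f (u, r))" if "continuous_on UNIV f" for f :: "'a \<times> real \<Rightarrow> real"
    by (rule continuous_on_compose2[OF that]) (auto intro!: continuous_intros)
  note sls = sl[OF cont(1)] sl[OF cont(3)] sl[OF cont(4)]
  have ch: "continuous_on UNIV (\<lambda>u::'a. heat u r)"
    unfolding heat_inner using r by (intro continuous_intros) auto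
  have cD: "continuous_on UNIV (D b)" if "b \<in> Basis" for b
    unfolding D_def[abs_def] using r that by (intro continuous_intros ch sls) auto
  have D0: "D b u = 0" if "b \<in> Basis" "u \<notin> fst ` K" for b u
  proof -
    have "(u, r) \<notin> K" using that by force
    then show ?thesis using that by (simp add: D_def out out_space2)
  qed
  have "(\<integral>u. D b u \<partial>lborel) = 0" if b: "b \<in> Basis" for b
  proof (rule integral_dir_deriv_zero[OF _ cD[OF b] _ K'])
    \<comment> \<open>A component of the field in Green's second identity: the kernel times the
      derivative of \<open>\<psi>\<close>, minus the derivative of the kernel, which is
      \<open>- (u \<bullet> b) / (2 * r) * heat u r\<close>, times \<open>\<psi>\<close>. Its
      derivative along \<open>b\<close> is \<open>D b\<close>.\<close>
    let ?F = "\<lambda>u. heat u r * space_deriv b \<psi> (u, r) + (u \<bullet> b) / (2 * r) * heat u r * \<psi> (u, r)"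
    show "continuous_on UNIV ?F"
      using r b by (intro continuous_intros ch sls) auto
    show "?F z = 0" if "z \<notin> fst ` K" for z
    proof -
      have "(z, r) \<notin> K" using that by force
      then show ?thesis using b by (simp add: out out_space)
    qed
    fix u
    have 1: "((\<lambda>s. \<psi> (u + s *\<^sub>R b, r)) has_real_derivative space_deriv b \<psi> (u, r)) (at 0)"
      using deriv_space[OF b, of "(u, r)"] by simp
    have 2: "((\<lambda>s. space_deriv b \<psi> (u + s *\<^sub>R b, r)) has_real_derivative space_deriv b (space_deriv b \<psi>) (u, r)) (at 0)"
      using deriv_space2[OF b b, of "(u, r)"] by simp
    have 3: "((\<lambda>s. ((u + s *\<^sub>R b) \<bullet> b) / (2 * r)) has_real_derivative 1 / (2 * r)) (at 0)"
    proof -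
      have "(u + s *\<^sub>R b) \<bullet> b = u \<bullet> b + s" for s
        using b by (simp add: inner_simps)
      then show ?thesis
        using r by (auto intro!: derivative_eq_intros)
    qed
    show "((\<lambda>s. ?F (u + s *\<^sub>R b)) has_real_derivative D b u) (at 0)"
      by (rule DERIV_cong[OF DERIV_add[OF DERIV_mult[OF heat_space_derivative[OF r] 2]
            DERIV_mult[OF DERIV_mult[OF 3 heat_space_derivative[OF r]] 1]]])
         (use r in \<open>simp add: D_def field_simps power2_eq_square\<close>)
  qed
  then have "(\<Sum>b\<in>Basis. \<integral>u. D b u \<partial>lborel) = 0" by simp
  also have "(\<Sum>b\<in>Basis. \<integral>u. D b u \<partial>lborel) = (\<integral>u. (\<Sum>b\<in>Basis. D b u) \<partial>lborel)"
    by (rule Bochner_Integration.integral_sum[symmetric]) (rule integrable_compact_support[OF cD K' D0])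
  also have "(\<lambda>u. \<Sum>b\<in>Basis. D b u) = (\<lambda>u. heat u r * laplacian \<psi> (u, r) - heat_t (u, r) * \<psi> (u, r))"
  proof
    fix u
    have "(\<Sum>b\<in>Basis. ((u \<bullet> b)\<^sup>2 / (4 * r\<^sup>2) - 1 / (2 * r)) * heat u r * \<psi> (u, r))
       = (\<Sum>b\<in>Basis. (u \<bullet> b)\<^sup>2 / (4 * r\<^sup>2) - 1 / (2 * r)) * heat u r * \<psi> (u, r)"
      by (simp only: sum_distrib_right)
    also have "(\<Sum>b\<in>Basis. (u \<bullet> b)\<^sup>2 / (4 * r\<^sup>2) - 1 / (2 * r)) = (u \<bullet> u) / (4 * r\<^sup>2) - real DIM('a) / (2 * r)"
      unfolding sum_subtractf sum_divide_distrib[symmetric]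
      by (simp add: euclidean_inner[of u u] power2_eq_square)
    finally show "(\<Sum>b\<in>Basis. D b u) = heat u r * laplacian \<psi> (u, r) - heat_t (u, r) * \<psi> (u, r)"
      by (simp add: D_def sum_subtractf laplacian_def sum_distrib_left heat_t_def)
  qed
  finally show ?thesis .
qed

lemma time_parts:
  assumes \<epsilon>: "0 < \<epsilon>"
  shows "(\<integral>r. indicator {\<epsilon>..} r * (heat u r * time_deriv \<psi> (u, r) + heat_t (u, r) * \<psi> (u, r)) \<partial>lborel)
    = - heat u \<epsilon> * \<psi> (u, \<epsilon>)"
proof -
  obtain R0 where R0: "\<And>z. R0 \<le> snd z \<Longrightarrow> z \<notin> K" using time_bound by metis
  define R where "R = max R0 \<epsilon>"
  have R: "\<And>z. R \<le> snd z \<Longrightarrow> z \<notin> K" "\<epsilon> \<le> R" using R0 by (auto simp: R_def)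
  let ?f = "\<lambda>r. heat u r * time_deriv \<psi> (u, r) + heat_t (u, r) * \<psi> (u, r)"
  have "has_bochner_integral lborel (\<lambda>r. ?f r * indicator {\<epsilon>..R} r) (heat u R * \<psi> (u, R) - heat u \<epsilon> * \<psi> (u, \<epsilon>))"
  proof (rule has_bochner_integral_FTC_Icc_real[OF R(2)])
    fix r assume r: "\<epsilon> \<le> r" "r \<le> R"
    have "((\<lambda>r. \<psi> ((u, 0) + r *\<^sub>R (0, 1))) has_real_derivative time_deriv \<psi> ((u, 0) + r *\<^sub>R (0, 1))) (at r)"
      by (rule has_derivative_along_line[OF deriv_time])
    then have "((\<lambda>r. \<psi> (u, r)) has_real_derivative time_deriv \<psi> (u, r)) (at r)" by simp
    moreover have "((\<lambda>r. heat u r) has_real_derivative heat_t (u, r)) (at r)"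
      using heat_time_derivative[of r u] r \<epsilon> by (simp add: heat_t_def)
    ultimately show "((\<lambda>r. heat u r * \<psi> (u, r)) has_real_derivative ?f r) (at r)"
      by (auto intro!: derivative_eq_intros)
    have c: "continuous_on {0<..} (\<lambda>r. f (u, r))" if "continuous_on {z. 0 < snd z} f" for f :: "'a \<times> real \<Rightarrow> real"
      by (rule continuous_on_compose2[OF that]) (auto intro!: continuous_intros)
    have c': "continuous_on {z. 0 < snd z} f" if "continuous_on UNIV f" for f :: "'a \<times> real \<Rightarrow> real"
      by (rule continuous_on_subset[OF that]) simp
    have "continuous_on {0<..} ?f"
      using c[OF continuous_heat]
      by (intro continuous_intros c[OF continuous_heat_t] c[OF c'[OF cont(1)]] c[OF c'[OF cont(2)]]) simp
    then show "isCont ?f r"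
      using r \<epsilon> by (simp add: continuous_on_eq_continuous_at)
  qed
  then have "(\<integral>r. ?f r * indicator {\<epsilon>..R} r \<partial>lborel) = - heat u \<epsilon> * \<psi> (u, \<epsilon>)"
    using out[OF R(1), of "(u, R)"] by (simp add: has_bochner_integral_integral_eq)
  moreover have "(\<lambda>r. ?f r * indicator {\<epsilon>..R} r) = (\<lambda>r. indicator {\<epsilon>..} r * ?f r)"
    using out[OF R(1)] out_time[OF R(1)] by (auto simp: fun_eq_iff indicator_def)
  ultimately show ?thesis by simp
qed

text \<open>The derivatives of the kernel are not integrable near its singularity, so the
  integrations by parts are carried out above time \<open>\<epsilon>\<close> only. What remains is
  the boundary term at the cut.\<close>

lemma cut_identity:
  assumes \<epsilon>: "0 < \<epsilon>"
  shows "(\<integral>z. indicator {\<epsilon>..} (snd z) * (heat (fst z) (snd z) * L z) \<partial>lborel) = (\<integral>u. heat u \<epsilon> * \<psi> (u, \<epsilon>) \<partial>lborel)"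
proof -
  let ?A = "\<lambda>z. indicator {\<epsilon>..} (snd z) * (heat (fst z) (snd z) * time_deriv \<psi> z + heat_t z * \<psi> z)"
  let ?B = "\<lambda>z. indicator {\<epsilon>..} (snd z) * (heat (fst z) (snd z) * laplacian \<psi> z - heat_t z * \<psi> z)"
  have c': "continuous_on {z. 0 < snd z} f" if "continuous_on UNIV f" for f :: "'a \<times> real \<Rightarrow> real"
    by (rule continuous_on_subset[OF that]) simp
  have iA: "integrable lborel ?A"
    by (intro integrable_cut \<epsilon> continuous_intros continuous_heat continuous_heat_t c'[OF cont(1)] c'[OF cont(2)])
       (auto simp: out out_time)
  have iB: "integrable lborel ?B"
    by (intro integrable_cut \<epsilon> continuous_intros continuous_heat continuous_heat_t c'[OF cont(1)] c'[OF cont_laplacian])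
       (auto simp: out out_laplacian)
  have "(\<integral>z. ?A z \<partial>lborel) = (\<integral>u. (\<integral>r. ?A (u, r) \<partial>lborel) \<partial>lborel)"
    using lborel_pair.integral_fst'[of ?A] iA by (simp add: lborel_prod)
  also have "\<dots> = - (\<integral>u. heat u \<epsilon> * \<psi> (u, \<epsilon>) \<partial>lborel)"
    by (simp add: time_parts[OF \<epsilon>])
  finally have A: "(\<integral>z. ?A z \<partial>lborel) = - (\<integral>u. heat u \<epsilon> * \<psi> (u, \<epsilon>) \<partial>lborel)" .
  have "(\<integral>z. ?B z \<partial>lborel) = (\<integral>r. (\<integral>u. ?B (u, r) \<partial>lborel) \<partial>lborel)"
    using lborel_pair.integral_snd[of "\<lambda>u r. ?B (u, r)"] iB by (simp add: lborel_prod case_prod_beta')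
  also have "\<dots> = (\<integral>r. 0 \<partial>(lborel :: real measure))"
  proof (rule Bochner_Integration.integral_cong)
    fix r
    show "(\<integral>u. ?B (u, r) \<partial>lborel) = 0"
      using space_parts[of r] \<epsilon> by (cases "\<epsilon> \<le> r") auto
  qed simp
  finally have B: "(\<integral>z. ?B z \<partial>lborel) = 0" by simp
  have "(\<integral>z. indicator {\<epsilon>..} (snd z) * (heat (fst z) (snd z) * L z) \<partial>lborel) = (\<integral>z. - ?A z - ?B z \<partial>lborel)"
    by (intro Bochner_Integration.integral_cong) (auto simp: L_def algebra_simps)
  also have "\<dots> = (\<integral>u. heat u \<epsilon> * \<psi> (u, \<epsilon>) \<partial>lborel)"
    using iA iB by (simp add: A B)
  finally show ?thesis .
qed

lemma integrable_heat_L: "integrable lborel (\<lambda>z. hkr (z - (y, 0)) * L z)"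
proof -
  obtain R where R: "\<And>z. R \<le> snd z \<Longrightarrow> z \<notin> K" using time_bound by metis
  obtain B where B: "0 \<le> B" "\<And>z. \<bar>L z\<bar> \<le> B"
    using bounded_compact_support[OF cont_L K out_L] by blast
  show ?thesis
  proof (rule Bochner_Integration.integrable_bound)
    show "integrable lborel (\<lambda>z. B * (hkr (z - (y, 0)) * indicator {..R} (snd z)))"
      by (intro integrable_mult_right integrable_hkr_strip)
    show "AE z in lborel. norm (hkr (z - (y, 0)) * L z) \<le> norm (B * (hkr (z - (y, 0)) * indicator {..R} (snd z)))"
    proof (rule AE_I2)
      fix z :: "'a \<times> real"
      show "norm (hkr (z - (y, 0)) * L z) \<le> norm (B * (hkr (z - (y, 0)) * indicator {..R} (snd z)))"
        using B(1) B(2)[of z] out_L[OF R, of z]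
        by (cases "R \<le> snd z") (auto simp: abs_mult mult.commute[of B] intro!: mult_left_mono)
    qed
  qed simp
qed

text \<open>As the cut tends to \<open>0\<close>, the boundary term concentrates at the origin, and
  the other side converges because the kernel itself, unlike its derivatives, is integrable on
  bounded time intervals.\<close>

lemma heat_fundamental_0: "(\<integral>z. hkr z * L z \<partial>lborel) = \<psi> (0, 0)"
proof -
  let ?e = "\<lambda>n. inverse (real (Suc n))"
  have e: "0 < ?e n" for n by simp
  have elim: "?e \<longlonglongrightarrow> 0" by (rule LIMSEQ_inverse_real_of_nat)
  obtain Bp where Bp: "\<And>z. \<bar>\<psi> z\<bar> \<le> Bp"
    using bounded_compact_support[OF cont(1) K out] by blast
  have "(\<lambda>n. \<integral>z. heat z (?e n) * \<psi> (z, ?e n) \<partial>lborel) \<longlonglongrightarrow> \<psi> (0, 0)"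
  proof (rule heat_concentrates[OF _ Bp e])
    show "(\<lambda>z. \<psi> (z, ?e n)) \<in> borel_measurable borel" for n
      by (intro borel_measurable_continuous_onI continuous_on_compose2[OF cont(1)]) (auto intro!: continuous_intros)
    fix v :: 'a
    have "(\<lambda>n. (sqrt (?e n) *\<^sub>R v, ?e n)) \<longlonglongrightarrow> (sqrt 0 *\<^sub>R v, 0)"
      by (intro tendsto_intros elim)
    then have "(\<lambda>n. (sqrt (?e n) *\<^sub>R v, ?e n)) \<longlonglongrightarrow> (0, 0)" by simp
    moreover have "isCont \<psi> (0, 0)" using cont(1) by (simp add: continuous_on_eq_continuous_at)
    ultimately show "(\<lambda>n. \<psi> (sqrt (?e n) *\<^sub>R v, ?e n)) \<longlonglongrightarrow> \<psi> (0, 0)"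
      by (rule isCont_tendsto_compose[rotated])
  qed
  then have 1: "(\<lambda>n. \<integral>z. indicator {?e n..} (snd z) * (heat (fst z) (snd z) * L z) \<partial>lborel) \<longlonglongrightarrow> \<psi> (0, 0)"
    unfolding cut_identity[OF e] .
  have "(\<lambda>n. \<integral>z. indicator {?e n..} (snd z) * (heat (fst z) (snd z) * L z) \<partial>lborel) \<longlonglongrightarrow> (\<integral>z. hkr z * L z \<partial>lborel)"
  proof (rule integral_dominated_convergence[where w="\<lambda>z. \<bar>hkr z * L z\<bar>"])
    show "integrable lborel (\<lambda>z. \<bar>hkr z * L z\<bar>)"
      using integrable_heat_L[of 0] by (simp add: zero_prod_def[symmetric])
    show "AE z in lborel. (\<lambda>n. indicator {?e n..} (snd z) * (heat (fst z) (snd z) * L z)) \<longlonglongrightarrow> hkr z * L z"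
    proof (rule AE_I2)
      fix z :: "'a \<times> real"
      have "\<forall>\<^sub>F n in sequentially. indicator {?e n..} (snd z) * (heat (fst z) (snd z) * L z) = hkr z * L z"
      proof (cases "0 < snd z")
        case True
        from order_tendstoD(2)[OF elim this] show ?thesis
          by eventually_elim (use True in \<open>auto simp: hkr_def indicator_def\<close>)
      next
        case False
        have "\<not> ?e n \<le> snd z" for n using e[of n] False by linarith
        with False show ?thesis by (auto simp: indicator_def)
      qed
      then show "(\<lambda>n. indicator {?e n..} (snd z) * (heat (fst z) (snd z) * L z)) \<longlonglongrightarrow> hkr z * L z"
        by (rule tendsto_eventually)
    qed
    show "AE z in lborel. norm (indicator {?e n..} (snd z) * (heat (fst z) (snd z) * L z)) \<le> \<bar>hkr z * L z\<bar>" for n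
    proof (rule AE_I2)
      fix z :: "'a \<times> real"
      show "norm (indicator {?e n..} (snd z) * (heat (fst z) (snd z) * L z)) \<le> \<bar>hkr z * L z\<bar>"
        using less_le_trans[OF e[of n], of "snd z"] by (auto simp: hkr_def indicator_def)
    qed
  qed auto
  with 1 show ?thesis by (rule LIMSEQ_unique[rotated])
qed

end

section \<open>Smoothing of test functions\<close>

lemma dir_deriv_shift: "dir_deriv v (\<lambda>z. f (z + a)) z = dir_deriv v f (z + a)"
  for f :: "'b::real_normed_vector \<Rightarrow> real"
  by (simp add: dir_deriv_def add_ac)

lemma C1_dir_shift:
  fixes f :: "'b::real_normed_vector \<Rightarrow> real"
  assumes "C1_dir v f"
  shows "C1_dir v (\<lambda>z. f (z + a))"
proof (rule C1_dirI(1))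
  show "((\<lambda>s. f (z + s *\<^sub>R v + a)) has_real_derivative dir_deriv v f (z + a)) (at 0)" for z
    using C1_dir_has_derivative[OF assms, of "z + a"] by (simp add: add_ac)
  show "continuous_on UNIV (\<lambda>z. dir_deriv v f (z + a))"
  proof (rule continuous_on_compose2[where g="dir_deriv v f" and t=UNIV])
    show "continuous_on UNIV (dir_deriv v f)" using assms by (simp add: C1_dir_def)
  qed (auto intro!: continuous_intros)
qed

lemma space_deriv_shift: "space_deriv b (\<lambda>z. f (z + a)) = (\<lambda>z. space_deriv b f (z + a))"
  by (simp add: fun_eq_iff space_deriv_def dir_deriv_shift)

lemma test_function_shift:
  assumes "test_function \<psi> K"
  shows "test_function (\<lambda>z. \<psi> (z + a)) ((\<lambda>z. z - a) ` K)"
    and "test_function.L (\<lambda>z. \<psi> (z + a)) = (\<lambda>z. test_function.L \<psi> (z + a))"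
proof -
  interpret test_function \<psi> K by fact
  show "test_function (\<lambda>z. \<psi> (z + a)) ((\<lambda>z. z - a) ` K)"
  proof
    have "continuous_on UNIV (\<lambda>z. \<psi> (z + a))"
      by (rule continuous_on_compose2[OF cont(1)]) (auto intro!: continuous_intros)
    then show "C21 (\<lambda>z. \<psi> (z + a))"
      using C21 unfolding C21_def by (auto simp: space_deriv_shift intro: C1_dir_shift)
    show "compact ((\<lambda>z. z - a) ` K)"
      by (intro compact_continuous_image K continuous_intros)
    show "\<psi> (z + a) = 0" if "z \<notin> (\<lambda>z. z - a) ` K" for z
    proof (rule out)
      show "z + a \<notin> K"
      proof
        assume "z + a \<in> K"
        then have "z + a - a \<in> (\<lambda>z. z - a) ` K" by (rule imageI)
        with that show False by simp
      qed
    qed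
  qed
  then interpret s: test_function "\<lambda>z. \<psi> (z + a)" "(\<lambda>z. z - a) ` K" .
  show "s.L = (\<lambda>z. L (z + a))"
    by (simp add: fun_eq_iff s.L_def L_def time_deriv_def laplacian_def space_deriv_shift dir_deriv_shift)
qed

lemma integral_lborel_shift:
  fixes f :: "'a::euclidean_space \<Rightarrow> real"
  assumes [measurable]: "f \<in> borel_measurable borel"
  shows "(\<integral>x. f (x + c) \<partial>lborel) = (\<integral>x. f x \<partial>lborel)"
proof -
  have "(\<integral>x. f x \<partial>lborel) = (\<integral>x. f x \<partial>distr lborel borel ((+) c))"
    by (simp add: lborel_distr_plus)
  also have "\<dots> = (\<integral>x. f (c + x) \<partial>lborel)"
    by (subst integral_distr) auto
  finally show ?thesis by (simp add: add.commute)
qed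

lemma integrable_lborel_shift:
  fixes f :: "'a::euclidean_space \<Rightarrow> real"
  assumes [measurable]: "integrable lborel f"
  shows "integrable lborel (\<lambda>x. f (x + c))"
proof -
  have "integrable (distr lborel borel ((+) c)) f"
    using assms by (simp add: lborel_distr_plus)
  then show ?thesis by (subst (asm) integrable_distr_eq) (auto simp: add.commute)
qed

context test_function
begin

lemma heat_fundamental: "(\<integral>z. hkr z * L (z + a) \<partial>lborel) = \<psi> a"
proof -
  interpret s: test_function "\<lambda>z. \<psi> (z + a)" "(\<lambda>z. z - a) ` K"
    by (rule test_function_shift) (rule test_function_axioms)
  show ?thesis
    using s.heat_fundamental_0 test_function_shift(2)[OF test_function_axioms, of a]
    by (simp add: zero_prod_def[symmetric])
qed

lemma heat_fundamental': "(\<integral>z. hkr (z - a) * L z \<partial>lborel) = \<psi> a"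
  using integral_lborel_shift[of "\<lambda>z. hkr (z - a) * L z" a] heat_fundamental[of a] by simp

end

text \<open>A correlation with \<open>g\<close> rather than a convolution. For
  \<open>g = hkr\<close> it is the potential that solves the backward heat equation with source
  \<open>f\<close>, hence the right function to test with in order to reach the Duhamel
  equation.\<close>

definition smooth :: "('b::euclidean_space \<Rightarrow> real) \<Rightarrow> ('b \<Rightarrow> real) \<Rightarrow> 'b \<Rightarrow> real" where
  "smooth g f z = (\<integral>q. g q * f (z + q) \<partial>lborel)"

text \<open>The kernel \<open>g\<close> is only integrable, since a truncated heat kernel is
  discontinuous; regularity comes from \<open>f\<close>, whose derivatives pass under the
  integral.\<close>

locale smoothing =
  fixes g :: "'b::euclidean_space \<Rightarrow> real" and S :: "'b set"
  assumes g_int: "integrable lborel g" and S: "compact S" and g_out: "\<And>q. q \<notin> S \<Longrightarrow> g q = 0"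
begin

lemma g_meas [measurable]: "g \<in> borel_measurable borel"
  using borel_measurable_integrable[OF g_int] by simp

lemma integrand:
  assumes "continuous_on UNIV f" "\<And>z. \<bar>f z\<bar> \<le> B"
  shows "integrable lborel (\<lambda>q. g q * f (z + q))"
proof (rule Bochner_Integration.integrable_bound)
  have [measurable]: "f \<in> borel_measurable borel"
    by (rule borel_measurable_continuous_onI) fact
  show "(\<lambda>q. g q * f (z + q)) \<in> borel_measurable lborel" by measurable
  show "integrable lborel (\<lambda>q. g q * B)" using g_int by simp
  show "AE q in lborel. norm (g q * f (z + q)) \<le> norm (g q * B)"
    using assms(2) by (auto simp: abs_mult intro!: mult_left_mono order_trans[OF assms(2)])
qed

lemma continuous_smooth:
  assumes f: "continuous_on UNIV f" "\<And>z. \<bar>f z\<bar> \<le> B"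
  shows "continuous_on UNIV (smooth g f)"
proof -
  have [measurable]: "f \<in> borel_measurable borel"
    by (rule borel_measurable_continuous_onI) fact
  have "(\<lambda>n. smooth g f (x n)) \<longlonglongrightarrow> smooth g f a" if x: "x \<longlonglongrightarrow> a" for x a
    unfolding smooth_def
  proof (rule integral_dominated_convergence[where w="\<lambda>q. \<bar>g q\<bar> * B"])
    show "integrable lborel (\<lambda>q. \<bar>g q\<bar> * B)" using g_int by simp
    have "(\<lambda>n. f (x n + q)) \<longlonglongrightarrow> f (a + q)" for q
      using f(1) by (intro isCont_tendsto_compose[of _ f] tendsto_intros x) (simp add: continuous_on_eq_continuous_at)
    then show "AE q in lborel. (\<lambda>n. g q * f (x n + q)) \<longlonglongrightarrow> g q * f (a + q)"
      by (intro AE_I2 tendsto_intros)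
    show "AE q in lborel. norm (g q * f (x n + q)) \<le> \<bar>g q\<bar> * B" for n
      using f(2) by (auto simp: abs_mult intro!: mult_left_mono)
  qed auto
  then show ?thesis
    by (auto simp: continuous_on_sequentially comp_def)
qed

lemma smooth_has_derivative:
  assumes f: "continuous_on UNIV f" "\<And>z. \<bar>f z\<bar> \<le> B"
    and D: "continuous_on UNIV D" "\<And>z. \<bar>D z\<bar> \<le> C"
    and der: "\<And>z. ((\<lambda>s. f (z + s *\<^sub>R v)) has_real_derivative D z) (at 0)"
  shows "((\<lambda>s. smooth g f (z + s *\<^sub>R v)) has_real_derivative smooth g D z) (at 0)"
proof -
  have [measurable]: "f \<in> borel_measurable borel" "D \<in> borel_measurable borel"
    by (rule borel_measurable_continuous_onI, fact)+
  have qb: "\<bar>(f (y + h *\<^sub>R v) - f y) / h\<bar> \<le> C" if "h \<noteq> 0" for h y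
  proof (cases "0 < h")
    case True
    then show ?thesis by (rule difference_quotient_bound[OF der D(2)])
  next
    case False
    then have "\<bar>(f ((y + h *\<^sub>R v) + (- h) *\<^sub>R v) - f (y + h *\<^sub>R v)) / (- h)\<bar> \<le> C"
      using that by (intro difference_quotient_bound[OF der D(2)]) auto
    then show ?thesis
      using that by (simp add: abs_minus_commute)
  qed
  have "(\<lambda>n. (smooth g f (z + h n *\<^sub>R v) - smooth g f z) / h n) \<longlonglongrightarrow> smooth g D z"
    if h: "h \<longlonglongrightarrow> 0" "\<And>n. h n \<noteq> 0" for h
  proof -
    have "(smooth g f (z + h n *\<^sub>R v) - smooth g f z) / h n
       = (\<integral>q. g q * ((f ((z + q) + h n *\<^sub>R v) - f (z + q)) / h n) \<partial>lborel)" for n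
    proof -
      have "smooth g f (z + h n *\<^sub>R v) - smooth g f z
         = (\<integral>q. g q * f (z + h n *\<^sub>R v + q) - g q * f (z + q) \<partial>lborel)"
        unfolding smooth_def by (rule Bochner_Integration.integral_diff[symmetric]) (rule integrand[OF f])+
      also have "\<dots> / h n = (\<integral>q. (g q * f (z + h n *\<^sub>R v + q) - g q * f (z + q)) / h n \<partial>lborel)"
        by simp
      finally show ?thesis by (simp add: algebra_simps)
    qed
    moreover have "(\<lambda>n. \<integral>q. g q * ((f ((z + q) + h n *\<^sub>R v) - f (z + q)) / h n) \<partial>lborel) \<longlonglongrightarrow> smooth g D z"
      unfolding smooth_def
    proof (rule integral_dominated_convergence[where w="\<lambda>q. \<bar>g q\<bar> * C"])
      show "integrable lborel (\<lambda>q. \<bar>g q\<bar> * C)" using g_int by simp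
      have "(\<lambda>n. (f ((z + q) + h n *\<^sub>R v) - f (z + q)) / h n) \<longlonglongrightarrow> D (z + q)" for q
      proof -
        have "((\<lambda>s. (f ((z + q) + s *\<^sub>R v) - f (z + q)) / s) \<longlongrightarrow> D (z + q)) (at 0)"
          using der[of "z + q"] by (simp add: DERIV_def)
        then show ?thesis
          by (rule filterlim_compose) (use h in \<open>auto simp: filterlim_at\<close>)
      qed
      then show "AE q in lborel. (\<lambda>n. g q * ((f ((z + q) + h n *\<^sub>R v) - f (z + q)) / h n)) \<longlonglongrightarrow> g q * D (z + q)"
        by (intro AE_I2 tendsto_intros)
      show "AE q in lborel. norm (g q * ((f ((z + q) + h n *\<^sub>R v) - f (z + q)) / h n)) \<le> \<bar>g q\<bar> * C" for n
        unfolding real_norm_def abs_mult by (intro AE_I2 mult_left_mono qb h) auto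
    qed auto
    ultimately show ?thesis by (simp only:)
  qed
  then show ?thesis
    unfolding DERIV_def by (auto simp: tendsto_at_iff_sequentially comp_def)
qed

lemma smooth_out:
  assumes "\<And>z. z \<notin> K \<Longrightarrow> f z = 0" and "z \<notin> (\<lambda>(a, b). a - b) ` (K \<times> S)"
  shows "smooth g f z = 0"
proof -
  have "g q * f (z + q) = 0" for q
  proof (cases "q \<in> S \<and> z + q \<in> K")
    case True
    then have "(\<lambda>(a, b). a - b) (z + q, q) \<in> (\<lambda>(a, b). a - b) ` (K \<times> S)" by (intro imageI) auto
    with assms(2) show ?thesis by simp
  qed (use assms(1) g_out in auto)
  then have "(\<lambda>q. g q * f (z + q)) = (\<lambda>q. 0)" by blast
  then show ?thesis unfolding smooth_def by (simp only: Bochner_Integration.integral_zero)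
qed

end

locale smoothed_test = test_function \<psi> K + smoothing g S
  for \<psi> :: "'a::euclidean_space \<times> real \<Rightarrow> real" and K and g :: "'a \<times> real \<Rightarrow> real" and S
begin

lemma dd_smooth:
  assumes "continuous_on UNIV f" "\<And>z. z \<notin> K \<Longrightarrow> f z = 0"
    "continuous_on UNIV D" "\<And>z. z \<notin> K \<Longrightarrow> D z = 0"
    "\<And>z. ((\<lambda>s. f (z + s *\<^sub>R v)) has_real_derivative D z) (at 0)"
  shows "C1_dir v (smooth g f)" "dir_deriv v (smooth g f) = smooth g D"
proof -
  obtain B where B: "\<And>z. \<bar>f z\<bar> \<le> B" using bounded_compact_support[OF assms(1) K assms(2)] by blast
  obtain C where C: "\<And>z. \<bar>D z\<bar> \<le> C" using bounded_compact_support[OF assms(3) K assms(4)] by blast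
  show "C1_dir v (smooth g f)" "dir_deriv v (smooth g f) = smooth g D"
    using C1_dirI[OF smooth_has_derivative[OF assms(1) B assms(3) C assms(5)] continuous_smooth[OF assms(3) C]]
    by auto
qed

lemma time_smooth: "C1_dir (0, 1) (smooth g \<psi>)" "time_deriv (smooth g \<psi>) = smooth g (time_deriv \<psi>)"
  using dd_smooth[OF cont(1) out cont(2) out_time deriv_time] by (auto simp: time_deriv_def)

lemma space_smooth:
  assumes "b \<in> Basis"
  shows "C1_dir (b, 0) (smooth g \<psi>)" "space_deriv b (smooth g \<psi>) = smooth g (space_deriv b \<psi>)"
  using dd_smooth[OF cont(1) out cont(3)[OF assms] out_space[OF assms] deriv_space[OF assms]]
  by (auto simp: space_deriv_def fun_eq_iff)

lemma space_smooth2: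
  assumes b: "b \<in> Basis" and c: "c \<in> Basis"
  shows "C1_dir (c, 0) (smooth g (space_deriv b \<psi>))"
    "space_deriv c (smooth g (space_deriv b \<psi>)) = smooth g (space_deriv c (space_deriv b \<psi>))"
  using dd_smooth[OF cont(3)[OF b] out_space[OF b] cont(4)[OF b c] out_space2[OF b c] deriv_space2[OF b c]]
  by (auto simp: space_deriv_def fun_eq_iff)

lemma test_function_smooth: "test_function (smooth g \<psi>) ((\<lambda>(a, b). a - b) ` (K \<times> S))"
proof
  obtain B where B: "\<And>z. \<bar>\<psi> z\<bar> \<le> B" using bounded_compact_support[OF cont(1) K out] by blast
  have "continuous_on UNIV (smooth g \<psi>)" by (rule continuous_smooth[OF cont(1) B])
  then show "C21 (smooth g \<psi>)"
    unfolding C21_def using time_smooth(1) space_smooth space_smooth2(1) by auto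
  show "compact ((\<lambda>(a, b). a - b) ` (K \<times> S))"
    unfolding case_prod_beta by (intro compact_continuous_image compact_Times K S continuous_intros)
  show "smooth g \<psi> z = 0" if "z \<notin> (\<lambda>(a, b). a - b) ` (K \<times> S)" for z
    using out that by (rule smooth_out)
qed

lemma L_smooth: "test_function.L (smooth g \<psi>) = smooth g L"
proof
  fix z
  interpret s: test_function "smooth g \<psi>" "(\<lambda>(a, b). a - b) ` (K \<times> S)" by (rule test_function_smooth)
  have i: "integrable lborel (\<lambda>q. g q * f (z + q))" if f: "continuous_on UNIV f" "\<And>z. z \<notin> K \<Longrightarrow> f z = 0" for f
  proof -
    obtain B where B: "\<And>z. \<bar>f z\<bar> \<le> B" using bounded_compact_support[OF f(1) K f(2)] by blast
    show ?thesis by (rule integrand[OF f(1) B])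
  qed
  have "laplacian (smooth g \<psi>) z = (\<Sum>b\<in>Basis. smooth g (space_deriv b (space_deriv b \<psi>)) z)"
    by (simp add: laplacian_def space_smooth(2) space_smooth2(2))
  also have "\<dots> = smooth g (laplacian \<psi>) z"
    unfolding smooth_def laplacian_def sum_distrib_left
    by (rule Bochner_Integration.integral_sum[symmetric]) (intro i cont out_space2; assumption)
  finally have l: "laplacian (smooth g \<psi>) z = smooth g (laplacian \<psi>) z" .
  have "smooth g L z = (\<integral>q. - (g q * time_deriv \<psi> (z + q)) - g q * laplacian \<psi> (z + q) \<partial>lborel)"
    unfolding smooth_def L_def by (simp add: algebra_simps)
  also have "\<dots> = - smooth g (time_deriv \<psi>) z - smooth g (laplacian \<psi>) z"
    unfolding smooth_def using i[OF cont(2) out_time] i[OF cont_laplacian out_laplacian]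
    by simp
  finally show "s.L z = smooth g L z"
    by (simp add: s.L_def l time_smooth)
qed

end

section \<open>Compactly supported bump functions\<close>

lemma pos_part_power_derivative:
  assumes "0 < n"
  shows "((\<lambda>x::real. max 0 x ^ Suc n) has_real_derivative real (Suc n) * max 0 x ^ n) (at x)"
proof -
  consider "0 < x" | "x < 0" | "x = 0" by linarith
  then show ?thesis
  proof cases
    case 1
    have "((\<lambda>x. x ^ Suc n) has_real_derivative real (Suc n) * x ^ n) (at x)"
      using DERIV_pow[of "Suc n" x] by simp
    then have "((\<lambda>x. max 0 x ^ Suc n) has_real_derivative real (Suc n) * x ^ n) (at x)"
      by (rule has_field_derivative_transform_within_open[of _ _ _ "{0<..}"]) (use 1 in auto)
    then show ?thesis using 1 by simp
  next
    case 2
    have "((\<lambda>x::real. 0) has_real_derivative 0) (at x)" by simp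
    then have "((\<lambda>x. max 0 x ^ Suc n) has_real_derivative 0) (at x)"
      by (rule has_field_derivative_transform_within_open[of _ _ _ "{..<0}"]) (use 2 in auto)
    then show ?thesis using 2 assms by (simp add: zero_power)
  next
    case 3
    have "((\<lambda>h::real. max 0 h ^ n) \<longlongrightarrow> max 0 0 ^ n) (at 0)"
      by (intro tendsto_intros)
    moreover have "(max 0 (0 + h) ^ Suc n - max 0 0 ^ Suc n) / h = max 0 h ^ n" for h :: real
      using assms by (auto simp: max_def power_0_left)
    ultimately show ?thesis
      using assms 3 unfolding DERIV_def by (simp add: power_0_left)
  qed
qed

text \<open>The cube is the least integer power for which the second derivatives are continuous
  across the sphere, as \<open>C21\<close> demands.\<close>

definition bump :: "'b::euclidean_space \<Rightarrow> real \<Rightarrow> 'b \<Rightarrow> real" where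
  "bump a \<rho> z = max 0 (\<rho>\<^sup>2 - (z - a) \<bullet> (z - a)) ^ 3"

lemma bump_nonneg [simp]: "0 \<le> bump a \<rho> z"
  by (simp add: bump_def)

lemma bump_pos: "z \<in> ball a \<rho> \<Longrightarrow> 0 < bump a \<rho> z"
proof -
  assume "z \<in> ball a \<rho>"
  then have "(norm (z - a))\<^sup>2 < \<rho>\<^sup>2"
    by (intro power_strict_mono) (auto simp: dist_norm norm_minus_commute)
  then show ?thesis by (simp add: bump_def power2_norm_eq_inner)
qed

lemma bump_out: "0 < \<rho> \<Longrightarrow> z \<notin> cball a \<rho> \<Longrightarrow> bump a \<rho> z = 0"
proof -
  assume "0 < \<rho>" "z \<notin> cball a \<rho>"
  then have "\<rho>\<^sup>2 \<le> (norm (z - a))\<^sup>2"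
    by (intro power_mono) (auto simp: dist_norm norm_minus_commute)
  then show ?thesis by (simp add: bump_def power2_norm_eq_inner)
qed

lemma sq_dist_along:
  fixes z a v :: "'b::real_inner"
  shows "((\<lambda>s. \<rho>\<^sup>2 - (z + s *\<^sub>R v - a) \<bullet> (z + s *\<^sub>R v - a)) has_real_derivative - 2 * ((z - a) \<bullet> v)) (at 0)"
proof -
  have e: "\<rho>\<^sup>2 - (z + s *\<^sub>R v - a) \<bullet> (z + s *\<^sub>R v - a)
      = (\<rho>\<^sup>2 - (z - a) \<bullet> (z - a)) - 2 * s * ((z - a) \<bullet> v) - s * s * (v \<bullet> v)" for s
    by (simp add: inner_simps inner_commute algebra_simps)
  show ?thesis
    unfolding e by (auto intro!: derivative_eq_intros)
qed

lemma bump_derivative: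
  fixes a v :: "'b::euclidean_space"
  shows "C1_dir v (bump a \<rho>)"
    and "dir_deriv v (bump a \<rho>) = (\<lambda>z. 3 * max 0 (\<rho>\<^sup>2 - (z - a) \<bullet> (z - a)) ^ 2 * (- 2 * ((z - a) \<bullet> v)))"
proof -
  let ?D = "\<lambda>z. 3 * max 0 (\<rho>\<^sup>2 - (z - a) \<bullet> (z - a)) ^ 2 * (- 2 * ((z - a) \<bullet> v))"
  have 1: "((\<lambda>s. bump a \<rho> (z + s *\<^sub>R v)) has_real_derivative ?D z) (at 0)" for z
    using DERIV_chain2[OF pos_part_power_derivative[of 2] sq_dist_along[of \<rho> z v a]]
    by (simp add: bump_def numeral_3_eq_3)
  have 2: "continuous_on UNIV ?D" by (intro continuous_intros)
  show "C1_dir v (bump a \<rho>)" "dir_deriv v (bump a \<rho>) = ?D"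
    using C1_dirI[OF 1 2] by auto
qed

lemma bump_derivative2:
  fixes a v w :: "'b::euclidean_space"
  shows "C1_dir w (dir_deriv v (bump a \<rho>))"
proof -
  let ?q = "\<lambda>z. \<rho>\<^sup>2 - (z - a) \<bullet> (z - a)"
  let ?D = "\<lambda>z. 3 * (2 * max 0 (?q z) * (- 2 * ((z - a) \<bullet> w))) * (- 2 * ((z - a) \<bullet> v))
      + 3 * max 0 (?q z) ^ 2 * (- 2 * (w \<bullet> v))"
  have 1: "((\<lambda>s. dir_deriv v (bump a \<rho>) (z + s *\<^sub>R w)) has_real_derivative ?D z) (at 0)" for z
  proof -
    have A: "((\<lambda>s. max 0 (?q (z + s *\<^sub>R w)) ^ 2) has_real_derivative 2 * max 0 (?q z) * (- 2 * ((z - a) \<bullet> w))) (at 0)"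
      using DERIV_chain2[OF pos_part_power_derivative[of 1] sq_dist_along[of \<rho> z w a]]
      by (simp add: numeral_2_eq_2)
    have B: "((\<lambda>s. (z + s *\<^sub>R w - a) \<bullet> v) has_real_derivative w \<bullet> v) (at 0)"
    proof -
      have "(z + s *\<^sub>R w - a) \<bullet> v = (z - a) \<bullet> v + s * (w \<bullet> v)" for s
        by (simp add: inner_simps)
      then show ?thesis by (auto intro!: derivative_eq_intros)
    qed
    show ?thesis
      unfolding bump_derivative(2)
      by (rule DERIV_cong[OF DERIV_mult[OF DERIV_cmult[OF A] DERIV_cmult[OF B]]]) (simp add: algebra_simps)
  qed
  show ?thesis
    by (rule C1_dirI(1)[OF 1]) (intro continuous_intros)
qed

lemma test_function_bump:
  fixes a :: "'a::euclidean_space \<times> real"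
  assumes "0 < \<rho>"
  shows "test_function (bump a \<rho>) (cball a \<rho>)"
proof
  have e: "space_deriv b (bump a \<rho>) = dir_deriv (b, 0) (bump a \<rho>)" for b
    by (simp add: fun_eq_iff space_deriv_def)
  have "continuous_on UNIV (bump a \<rho>)"
    unfolding bump_def[abs_def] by (intro continuous_intros)
  then show "C21 (bump a \<rho>)"
    unfolding C21_def e using bump_derivative(1) bump_derivative2 by blast
qed (use assms in \<open>auto intro: bump_out\<close>)

section \<open>Truncating the heat kernel to compact support\<close>

lemma integrable_hkr_shift:
  fixes f :: "'a::euclidean_space \<times> real \<Rightarrow> real"
  assumes f: "continuous_on UNIV f" "\<And>z. \<bar>f z\<bar> \<le> B" and R: "\<And>z. R \<le> snd z \<Longrightarrow> f z = 0" and z: "0 \<le> snd z"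
  shows "\<bar>hkr q * f (z + q)\<bar> \<le> B * (hkr q * indicator {..R} (snd q))"
    and "integrable lborel (\<lambda>q. hkr q * f (z + q))"
proof -
  have *: "\<bar>hkr q * f (z + q)\<bar> \<le> B * (hkr q * indicator {..R} (snd q))" for q
    using f(2)[of "z + q"] R[of "z + q"] z
    by (cases "R \<le> snd q") (auto simp: abs_mult mult.commute[of B] intro!: mult_left_mono split: split_indicator)
  then show "\<bar>hkr q * f (z + q)\<bar> \<le> B * (hkr q * indicator {..R} (snd q))" .
  show "integrable lborel (\<lambda>q. hkr q * f (z + q))"
  proof (rule Bochner_Integration.integrable_bound)
    show "integrable lborel (\<lambda>q::'a \<times> real. B * (hkr q * indicator {..R} (snd q)))"
      using integrable_hkr_strip[of "0::'a" R] by (simp add: zero_prod_def[symmetric])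
    have [measurable]: "f \<in> borel_measurable borel"
      by (rule borel_measurable_continuous_onI) fact
    show "(\<lambda>q. hkr q * f (z + q)) \<in> borel_measurable lborel" by measurable
    show "AE q in lborel. norm (hkr q * f (z + q)) \<le> norm (B * (hkr q * indicator {..R} (snd q)))"
      unfolding real_norm_def using order_trans[OF * abs_ge_self] by auto
  qed
qed

text \<open>Truncation provides the compact support that test functions must have. As the support
  set contains nonnegative times only, smoothing moves the support of a function to earlier times,
  so it stays below \<open>T\<close>.\<close>

definition cutoff :: "nat \<Rightarrow> 'a::euclidean_space \<times> real \<Rightarrow> real" where
  "cutoff n q = hkr q * indicator (cball 0 (real n) \<inter> {q. 0 \<le> snd q}) q"

lemma smoothing_cutoff: "smoothing (cutoff n) (cball 0 (real n) \<inter> {q::'a::euclidean_space \<times> real. 0 \<le> snd q})"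
proof
  show "compact (cball 0 (real n) \<inter> {q::'a \<times> real. 0 \<le> snd q})"
    by (intro compact_Int_closed compact_cball closed_Collect_le continuous_intros)
  then have [measurable]: "cball 0 (real n) \<inter> {q::'a \<times> real. 0 \<le> snd q} \<in> sets borel"
    by (rule borel_compact)
  show "integrable lborel (cutoff n :: 'a \<times> real \<Rightarrow> real)"
  proof (rule Bochner_Integration.integrable_bound)
    show "integrable lborel (\<lambda>q::'a \<times> real. hkr q * indicator {..real n} (snd q))"
      using integrable_hkr_strip[of "0::'a" "real n"] by (simp add: zero_prod_def[symmetric])
    show "AE q::'a \<times> real in lborel. norm (cutoff n q :: real) \<le> norm (hkr q * indicator {..real n} (snd q))"
    proof (rule AE_I2)
      fix q :: "'a \<times> real"
      have "\<bar>snd q\<bar> \<le> norm q" using norm_snd_le[of "snd q" "fst q"] by simp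
      then show "norm (cutoff n q :: real) \<le> norm (hkr q * indicator {..real n} (snd q))"
        by (auto simp: cutoff_def split: split_indicator)
    qed
  qed (auto simp: cutoff_def[abs_def])
qed (auto simp: cutoff_def)

lemma cutoff_le: "\<bar>cutoff n q * r\<bar> \<le> \<bar>hkr q * r\<bar>"
  by (auto simp: cutoff_def abs_mult split: split_indicator)

lemma cutoff_tendsto: "(\<lambda>n. cutoff n q) \<longlonglongrightarrow> hkr q"
proof (rule tendsto_eventually)
  obtain N :: nat where N: "norm q \<le> real N" using real_arch_simple by blast
  show "\<forall>\<^sub>F n in sequentially. cutoff n q = hkr q"
    using eventually_ge_at_top[of N]
  proof eventually_elim
    case (elim n)
    then show ?case using N by (cases "0 \<le> snd q") (auto simp: cutoff_def indicator_def)
  qed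
qed

text \<open>The bound is uniform in the truncation: seen from a nonnegative time, the support of
  \<open>f\<close> meets only the part of the kernel up to time \<open>R\<close>, and that part has
  finite integral.\<close>

lemma smooth_cutoff:
  fixes f :: "'a::euclidean_space \<times> real \<Rightarrow> real"
  assumes f: "continuous_on UNIV f" "\<And>z. \<bar>f z\<bar> \<le> B" and R: "\<And>z. R \<le> snd z \<Longrightarrow> f z = 0" and z: "0 \<le> snd z"
  shows "(\<lambda>n. smooth (cutoff n) f z) \<longlonglongrightarrow> smooth hkr f z"
    and "\<bar>smooth (cutoff n) f z\<bar> \<le> B * (\<integral>q. hkr (q::'a \<times> real) * indicator {..R} (snd q) \<partial>lborel)"
proof -
  have [measurable]: "f \<in> borel_measurable borel"
    by (rule borel_measurable_continuous_onI) fact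
  have cm [measurable]: "cutoff n \<in> borel_measurable (borel :: ('a \<times> real) measure)" for n
    using smoothing.g_meas[OF smoothing_cutoff] .
  note b = integrable_hkr_shift[OF f R z]
  show "(\<lambda>n. smooth (cutoff n) f z) \<longlonglongrightarrow> smooth hkr f z"
    unfolding smooth_def
  proof (rule integral_dominated_convergence[where w="\<lambda>q. \<bar>hkr q * f (z + q)\<bar>"])
    show "integrable lborel (\<lambda>q. \<bar>hkr q * f (z + q)\<bar>)" using b(2) by (rule integrable_abs)
    show "AE q in lborel. (\<lambda>n. cutoff n q * f (z + q)) \<longlonglongrightarrow> hkr q * f (z + q)"
      by (intro AE_I2 tendsto_intros cutoff_tendsto)
    show "AE q in lborel. norm (cutoff n q * f (z + q)) \<le> \<bar>hkr q * f (z + q)\<bar>" for n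
      by (intro AE_I2) (simp only: real_norm_def cutoff_le)
  qed auto
  have i: "integrable lborel (\<lambda>q::'a \<times> real. B * (hkr q * indicator {..R} (snd q)))"
    using integrable_hkr_strip[of "0::'a" R] by (simp add: zero_prod_def[symmetric])
  have "\<bar>smooth (cutoff n) f z\<bar> \<le> (\<integral>q. B * (hkr (q::'a \<times> real) * indicator {..R} (snd q)) \<partial>lborel)"
    unfolding smooth_def
  proof (rule integral_abs_bound_integral)
    show "integrable lborel (\<lambda>q. cutoff n q * f (z + q))"
      by (rule smoothing.integrand[OF smoothing_cutoff f])
    show "\<bar>cutoff n q * f (z + q)\<bar> \<le> B * (hkr q * indicator {..R} (snd q))" for q
      using order_trans[OF cutoff_le b(1)] .
  qed (rule i)
  then show "\<bar>smooth (cutoff n) f z\<bar> \<le> B * (\<integral>q. hkr (q::'a \<times> real) * indicator {..R} (snd q) \<partial>lborel)"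
    by simp
qed

section \<open>Weak solutions and the Duhamel formula\<close>

lemma mem_QT: "p \<in> QT T \<longleftrightarrow> 0 < snd p \<and> snd p \<le> T"
  by (cases p) (auto simp: QT_def)

lemma QT_borel [measurable]: "QT T \<in> sets (borel :: ('a::euclidean_space \<times> real) measure)"
proof -
  have "QT T = {p::'a \<times> real. 0 < snd p} \<inter> {p. snd p \<le> T}"
    by (auto simp: mem_QT)
  moreover have "open {p::'a \<times> real. 0 < snd p}" "closed {p::'a \<times> real. snd p \<le> T}"
    by (intro open_Collect_less closed_Collect_le continuous_intros)+
  ultimately show ?thesis by (simp add: borel_open borel_closed sets.Int)
qed

locale weak_solution = bounded_potential W k
  for W :: "'a::euclidean_space \<times> real \<Rightarrow> real" and k :: real +
  fixes T :: real and y :: 'a and u :: "'a \<times> real \<Rightarrow> real"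
  assumes u_cont: "continuous_on (QT T) u"
    and u_bounds: "\<And>p. p \<in> QT T \<Longrightarrow> 0 \<le> u p \<and> u p \<le> hkr (p - (y, 0))"
    and u_out: "\<And>p. p \<notin> QT T \<Longrightarrow> u p = 0"
    and weak: "\<And>\<phi> K. test_function \<phi> K \<Longrightarrow> (\<And>z. z \<in> K \<Longrightarrow> snd z < T) \<Longrightarrow>
        (\<integral>z. u z * (test_function.L \<phi> z + W z * \<phi> z) \<partial>lborel) = \<phi> (y, 0)"
begin

lemma u_meas [measurable]: "u \<in> borel_measurable borel"
proof -
  have "(\<lambda>x. indicator (QT T) x *\<^sub>R u x) \<in> borel_measurable borel"
    by (rule borel_measurable_continuous_on_indicator[OF QT_borel u_cont])
  moreover have "(\<lambda>x. indicator (QT T) x *\<^sub>R u x) = u"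
    using u_out by (auto simp: fun_eq_iff indicator_def)
  ultimately show ?thesis by simp
qed

lemma u_nonneg [simp]: "0 \<le> u p"
  using u_bounds u_out by (cases "p \<in> QT T") auto

lemma u_le: "u p \<le> hkr (p - (y, 0))"
  using u_bounds u_out by (cases "p \<in> QT T") auto

lemma u_int: "integrable lborel u"
proof (rule Bochner_Integration.integrable_bound)
  show "integrable lborel (\<lambda>z. hkr (z - (y, 0)) * indicator {..T} (snd z))"
    by (rule integrable_hkr_strip)
  show "AE z in lborel. norm (u z) \<le> norm (hkr (z - (y, 0)) * indicator {..T} (snd z))"
  proof (rule AE_I2)
    fix z
    show "norm (u z) \<le> norm (hkr (z - (y, 0)) * indicator {..T} (snd z))"
      using u_le[of z] u_out[of z] by (cases "z \<in> QT T") (auto simp: mem_QT)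
  qed
qed simp

lemma u_out_time: "snd z \<le> 0 \<Longrightarrow> u z = 0"
  by (rule u_out) (simp add: mem_QT)

text \<open>Formally the test function is \<open>smooth hkr \<psi>\<close>, which the adjoint heat
  operator maps to \<open>\<psi>\<close>. It lacks compact support, so the truncated kernels are
  used; the passage to the limit is dominated by multiples of the integrable function
  \<open>u\<close>.\<close>

lemma tested:
  assumes "test_function \<psi> K" and KT: "\<And>z. z \<in> K \<Longrightarrow> snd z < T"
  shows "(\<integral>z. u z * (\<psi> z + W z * smooth hkr \<psi> z) \<partial>lborel) = smooth hkr \<psi> (y, 0)"
    and "integrable lborel (\<lambda>z. u z * (W z * smooth hkr \<psi> z))"
proof -
  interpret test_function \<psi> K by fact
  obtain R where R: "\<And>z. R \<le> snd z \<Longrightarrow> z \<notin> K" using time_bound by metis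
  obtain B where B: "\<And>z. \<bar>\<psi> z\<bar> \<le> B" using bounded_compact_support[OF cont(1) K out] by blast
  obtain C where C: "\<And>z. \<bar>L z\<bar> \<le> C" using bounded_compact_support[OF cont_L K out_L] by blast
  define I where "I = (\<integral>q. hkr (q::'a \<times> real) * indicator {..R} (snd q) \<partial>lborel)"
  have R\<psi>: "\<psi> z = 0" and RL: "L z = 0" if "R \<le> snd z" for z
    using out out_L R[OF that] by auto
  have sp: "0 \<le> snd z \<Longrightarrow> (\<lambda>n. smooth (cutoff n) \<psi> z) \<longlonglongrightarrow> smooth hkr \<psi> z"
      "0 \<le> snd z \<Longrightarrow> \<bar>smooth (cutoff n) \<psi> z\<bar> \<le> B * I" for z n
    unfolding I_def by (rule smooth_cutoff[OF cont(1) B]; (rule R\<psi>)?; assumption)+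
  have sL: "0 \<le> snd z \<Longrightarrow> (\<lambda>n. smooth (cutoff n) L z) \<longlonglongrightarrow> smooth hkr L z"
      "0 \<le> snd z \<Longrightarrow> \<bar>smooth (cutoff n) L z\<bar> \<le> C * I" for z n
    unfolding I_def by (rule smooth_cutoff[OF cont_L C]; (rule RL)?; assumption)+
  have tf: "test_function (smooth (cutoff n) \<psi>) ((\<lambda>(a, b). a - b) ` (K \<times> (cball 0 (real n) \<inter> {q. 0 \<le> snd q})))"
    and Ln: "test_function.L (smooth (cutoff n) \<psi>) = smooth (cutoff n) L" for n
  proof -
    interpret smoothing "cutoff n" "cball 0 (real n) \<inter> {q::'a \<times> real. 0 \<le> snd q}"
      by (rule smoothing_cutoff)
    interpret smoothed_test \<psi> K "cutoff n" "cball 0 (real n) \<inter> {q::'a \<times> real. 0 \<le> snd q}" ..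
    show "test_function (smooth (cutoff n) \<psi>) ((\<lambda>(a, b). a - b) ` (K \<times> (cball 0 (real n) \<inter> {q. 0 \<le> snd q})))"
      by (rule test_function_smooth)
    show "test_function.L (smooth (cutoff n) \<psi>) = smooth (cutoff n) L"
      by (rule L_smooth)
  qed
  have eq: "(\<integral>z. u z * (smooth (cutoff n) L z + W z * smooth (cutoff n) \<psi> z) \<partial>lborel) = smooth (cutoff n) \<psi> (y, 0)" for n
    unfolding Ln[symmetric] by (rule weak[OF tf]) (use KT in force)
  have [measurable]: "smooth (cutoff n) \<psi> \<in> borel_measurable borel" "smooth (cutoff n) L \<in> borel_measurable borel" for n
    using borel_measurable_continuous_onI[OF smoothing.continuous_smooth[OF smoothing_cutoff cont(1) B]]
      borel_measurable_continuous_onI[OF smoothing.continuous_smooth[OF smoothing_cutoff cont_L C]] .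
  have sm [measurable]: "smooth hkr \<psi> \<in> borel_measurable borel"
  proof -
    have "(\<lambda>z. \<integral>q. hkr q * \<psi> (z + q) \<partial>lborel) \<in> borel_measurable borel"
      by (rule lborel.borel_measurable_lebesgue_integral) measurable
    then show ?thesis by (simp add: smooth_def[abs_def])
  qed
  \<comment> \<open>The smoothed functions are controlled only at nonnegative times; at the others
    the factor \<open>u\<close> vanishes.\<close>
  have u_mult: "\<bar>u z * a\<bar> \<le> u z * b" if "0 \<le> snd z \<Longrightarrow> \<bar>a\<bar> \<le> b" for z a b
  proof (cases "0 \<le> snd z")
    case True
    have "u z * \<bar>a\<bar> \<le> u z * b" by (intro mult_left_mono that True) simp
    then show ?thesis by (simp only: abs_mult abs_of_nonneg[OF u_nonneg])
  qed (simp add: u_out_time)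
  have bnd: "\<bar>u z * smooth (cutoff n) \<psi> z\<bar> \<le> u z * (B * I)" for n z
    by (rule u_mult) (rule sp(2))
  have bnd': "\<bar>u z * smooth (cutoff n) L z\<bar> \<le> u z * (C * I)" for n z
    by (rule u_mult) (rule sL(2))
  have Wb: "\<bar>u z * (W z * a)\<bar> \<le> k * \<bar>u z * a\<bar>" for z a
  proof -
    have "W z * (\<bar>a\<bar> * u z) \<le> k * (\<bar>a\<bar> * u z)" using W_le[of z] by (intro mult_right_mono) auto
    then show ?thesis using W_nonneg[of z] by (simp add: abs_mult ac_simps)
  qed
  have lim: "(\<lambda>n. u z * (smooth (cutoff n) L z + W z * smooth (cutoff n) \<psi> z)) \<longlonglongrightarrow> u z * (\<psi> z + W z * smooth hkr \<psi> z)" for z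
  proof (cases "0 \<le> snd z")
    case True
    have "smooth hkr L z = \<psi> z"
      using heat_fundamental[of z] by (simp add: smooth_def add.commute)
    with sL(1)[OF True] have "(\<lambda>n. smooth (cutoff n) L z) \<longlonglongrightarrow> \<psi> z" by simp
    then show ?thesis by (intro tendsto_intros sp(1)[OF True])
  qed (simp add: u_out_time)
  have "(\<lambda>n. \<integral>z. u z * (smooth (cutoff n) L z + W z * smooth (cutoff n) \<psi> z) \<partial>lborel)
      \<longlonglongrightarrow> (\<integral>z. u z * (\<psi> z + W z * smooth hkr \<psi> z) \<partial>lborel)"
  proof (rule integral_dominated_convergence[where w="\<lambda>z. u z * (C * I) + k * (u z * (B * I))"])
    show "integrable lborel (\<lambda>z. u z * (C * I) + k * (u z * (B * I)))"
      using u_int by simp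
    show "AE z in lborel. norm (u z * (smooth (cutoff n) L z + W z * smooth (cutoff n) \<psi> z)) \<le> u z * (C * I) + k * (u z * (B * I))" for n
    proof (rule AE_I2)
      fix z
      have "norm (u z * (smooth (cutoff n) L z + W z * smooth (cutoff n) \<psi> z))
          \<le> \<bar>u z * smooth (cutoff n) L z\<bar> + \<bar>u z * (W z * smooth (cutoff n) \<psi> z)\<bar>"
        by (simp add: distrib_left)
      also have "\<dots> \<le> u z * (C * I) + k * \<bar>u z * smooth (cutoff n) \<psi> z\<bar>"
        by (intro add_mono bnd' Wb)
      also have "\<dots> \<le> u z * (C * I) + k * (u z * (B * I))"
        using k_pos by (intro add_left_mono mult_left_mono bnd) auto
      finally show "norm (u z * (smooth (cutoff n) L z + W z * smooth (cutoff n) \<psi> z)) \<le> u z * (C * I) + k * (u z * (B * I))" .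
    qed
  qed (use lim in auto)
  moreover have "(\<lambda>n. smooth (cutoff n) \<psi> (y, 0)) \<longlonglongrightarrow> smooth hkr \<psi> (y, 0)"
    by (rule sp(1)) simp
  ultimately show "(\<integral>z. u z * (\<psi> z + W z * smooth hkr \<psi> z) \<partial>lborel) = smooth hkr \<psi> (y, 0)"
    unfolding eq using LIMSEQ_unique by blast
  show "integrable lborel (\<lambda>z. u z * (W z * smooth hkr \<psi> z))"
  proof (rule Bochner_Integration.integrable_bound)
    show "integrable lborel (\<lambda>z. k * (u z * (B * I)))" using u_int by simp
    show "AE z in lborel. norm (u z * (W z * smooth hkr \<psi> z)) \<le> norm (k * (u z * (B * I)))"
    proof (rule AE_I2)
      fix z
      have "\<bar>u z * smooth hkr \<psi> z\<bar> \<le> u z * (B * I)"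
      proof (cases "0 \<le> snd z")
        case True
        have "(\<lambda>n. \<bar>u z * smooth (cutoff n) \<psi> z\<bar>) \<longlonglongrightarrow> \<bar>u z * smooth hkr \<psi> z\<bar>"
          by (intro tendsto_intros sp(1) True)
        then show ?thesis by (rule LIMSEQ_le_const2) (use bnd in blast)
      qed (simp add: u_out_time)
      then have "k * \<bar>u z * smooth hkr \<psi> z\<bar> \<le> k * (u z * (B * I))"
        using k_pos by (intro mult_left_mono) auto
      then have "\<bar>u z * (W z * smooth hkr \<psi> z)\<bar> \<le> k * (u z * (B * I))"
        using Wb order_trans by blast
      then show "norm (u z * (W z * smooth hkr \<psi> z)) \<le> norm (k * (u z * (B * I)))"
        by (simp only: real_norm_def)
    qed
  qed simp
qed

text \<open>Tonelli moves the heat kernel from the test function to \<open>W * u\<close>, so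
  \<open>tested\<close> becomes the Duhamel equation integrated against
  \<open>\<psi>\<close>.\<close>

lemma tested_nn:
  assumes tf: "test_function \<psi> K" and KT: "\<And>z. z \<in> K \<Longrightarrow> snd z < T" and nn: "\<And>z. 0 \<le> \<psi> z"
  shows "(\<integral>\<^sup>+ p. ennreal (\<psi> p) * (ennreal (u p) + conv hk (\<lambda>q. ennreal (W q) * ennreal (u q)) p) \<partial>lborel)
       = (\<integral>\<^sup>+ p. ennreal (\<psi> p) * hk_at y p \<partial>lborel)"
proof -
  interpret test_function \<psi> K by fact
  obtain R where R: "\<And>z. R \<le> snd z \<Longrightarrow> z \<notin> K" using time_bound by metis
  obtain B where B: "\<And>z. \<bar>\<psi> z\<bar> \<le> B" using bounded_compact_support[OF cont(1) K out] by blast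
  note S = tested[OF tf KT]
  have snn: "ennreal (smooth hkr \<psi> z) = (\<integral>\<^sup>+ p. hk (p - z) * ennreal (\<psi> p) \<partial>lborel)" if "0 \<le> snd z" for z
  proof -
    have "ennreal (smooth hkr \<psi> z) = (\<integral>\<^sup>+ q. ennreal (hkr q * \<psi> (z + q)) \<partial>lborel)"
      unfolding smooth_def
      by (rule nn_integral_eq_integral[symmetric, OF integrable_hkr_shift(2)[OF cont(1) B out[OF R] that]]) (auto simp: nn)
    also have "\<dots> = (\<integral>\<^sup>+ q. hk (z + q - z) * ennreal (\<psi> (z + q)) \<partial>lborel)"
      by (simp add: hk_eq_hkr ennreal_mult' nn)
    also have "\<dots> = (\<integral>\<^sup>+ p. hk (p - z) * ennreal (\<psi> p) \<partial>lborel)"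
      by (rule nn_integral_lborel_shift) simp
    finally show ?thesis .
  qed
  have iu: "integrable lborel (\<lambda>z. u z * \<psi> z)"
  proof (rule Bochner_Integration.integrable_bound)
    show "integrable lborel (\<lambda>z. u z * B)" using u_int by simp
    show "AE z in lborel. norm (u z * \<psi> z) \<le> norm (u z * B)"
    proof (rule AE_I2)
      fix z
      have "\<bar>\<psi> z\<bar> \<le> \<bar>B\<bar>" using B[of z] by linarith
      then show "norm (u z * \<psi> z) \<le> norm (u z * B)" by (simp add: abs_mult mult_left_mono)
    qed
  qed simp
  have s0: "0 \<le> smooth hkr \<psi> z" for z
    unfolding smooth_def by (intro Bochner_Integration.integral_nonneg) (simp add: nn)
  have A: "(\<integral>\<^sup>+ p. ennreal (\<psi> p) * ennreal (u p) \<partial>lborel) = ennreal (\<integral>z. u z * \<psi> z \<partial>lborel)"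
    using iu by (subst nn_integral_eq_integral[symmetric]) (auto simp: nn ennreal_mult' mult.commute)
  have "(\<integral>\<^sup>+ p. ennreal (\<psi> p) * conv hk (\<lambda>q. ennreal (W q) * ennreal (u q)) p \<partial>lborel)
     = (\<integral>\<^sup>+ p. \<integral>\<^sup>+ z. ennreal (W z) * ennreal (u z) * (hk (p - z) * ennreal (\<psi> p)) \<partial>lborel \<partial>lborel)"
    unfolding conv_def by (simp add: nn_integral_cmult[symmetric] ac_simps)
  also have "\<dots> = (\<integral>\<^sup>+ z. \<integral>\<^sup>+ p. ennreal (W z) * ennreal (u z) * (hk (p - z) * ennreal (\<psi> p)) \<partial>lborel \<partial>lborel)"
    by (rule lborel_pair.Fubini') simp
  also have "\<dots> = (\<integral>\<^sup>+ z. ennreal (u z * (W z * smooth hkr \<psi> z)) \<partial>lborel)"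
  proof (rule nn_integral_cong)
    fix z
    show "(\<integral>\<^sup>+ p. ennreal (W z) * ennreal (u z) * (hk (p - z) * ennreal (\<psi> p)) \<partial>lborel) = ennreal (u z * (W z * smooth hkr \<psi> z))"
    proof (cases "0 \<le> snd z")
      case True
      have "(\<integral>\<^sup>+ p. ennreal (W z) * ennreal (u z) * (hk (p - z) * ennreal (\<psi> p)) \<partial>lborel)
        = ennreal (W z) * ennreal (u z) * ennreal (smooth hkr \<psi> z)"
        unfolding snn[OF True] by (rule nn_integral_cmult) simp
      then show ?thesis by (simp add: ennreal_mult' W_nonneg ac_simps)
    qed (simp add: u_out_time)
  qed
  also have "\<dots> = ennreal (\<integral>z. u z * (W z * smooth hkr \<psi> z) \<partial>lborel)"
    by (rule nn_integral_eq_integral[OF S(2)]) (auto simp: W_nonneg s0)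
  finally have Bq: "(\<integral>\<^sup>+ p. ennreal (\<psi> p) * conv hk (\<lambda>q. ennreal (W q) * ennreal (u q)) p \<partial>lborel)
     = ennreal (\<integral>z. u z * (W z * smooth hkr \<psi> z) \<partial>lborel)" .
  have "(\<integral>\<^sup>+ p. ennreal (\<psi> p) * (ennreal (u p) + conv hk (\<lambda>q. ennreal (W q) * ennreal (u q)) p) \<partial>lborel)
     = ennreal (\<integral>z. u z * \<psi> z \<partial>lborel) + ennreal (\<integral>z. u z * (W z * smooth hkr \<psi> z) \<partial>lborel)"
    unfolding A[symmetric] Bq[symmetric] by (simp add: distrib_left nn_integral_add)
  also have "\<dots> = ennreal ((\<integral>z. u z * \<psi> z \<partial>lborel) + (\<integral>z. u z * (W z * smooth hkr \<psi> z) \<partial>lborel))"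
    by (intro ennreal_plus[symmetric] Bochner_Integration.integral_nonneg) (auto simp: nn s0 W_nonneg)
  also have "\<dots> = ennreal (\<integral>z. u z * (\<psi> z + W z * smooth hkr \<psi> z) \<partial>lborel)"
    using iu S(2) by (simp add: distrib_left)
  also have "\<dots> = ennreal (smooth hkr \<psi> (y, 0))"
    by (rule arg_cong[OF S(1)])
  also have "\<dots> = (\<integral>\<^sup>+ p. ennreal (\<psi> p) * hk_at y p \<partial>lborel)"
    by (subst snn) (simp_all add: mult.commute)
  finally show ?thesis .
qed

abbreviation F :: "'a \<times> real \<Rightarrow> ennreal" where
  "F p \<equiv> ennreal (u p) + conv hk (\<lambda>q. ennreal (W q) * ennreal (u q)) p"

lemma Wu_le: "ennreal (W q) * ennreal (u q) \<le> ennreal k * hk_at y q"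
  by (intro mult_mono W_le_k) (auto simp: hk_eq_hkr u_le intro!: ennreal_leI)

lemma F_tendsto:
  assumes p: "p \<longlonglongrightarrow> q" "\<And>n. p n \<in> QT T" "q \<in> QT T"
  shows "(\<lambda>n. F (p n)) \<longlonglongrightarrow> F q"
proof (intro tendsto_add tendsto_ennrealI)
  show "(\<lambda>n. u (p n)) \<longlonglongrightarrow> u q"
    using u_cont p unfolding continuous_on_sequentially comp_def by blast
  show "(\<lambda>n. conv hk (\<lambda>q. ennreal (W q) * ennreal (u q)) (p n)) \<longlonglongrightarrow> conv hk (\<lambda>q. ennreal (W q) * ennreal (u q)) q"
    by (rule conv_hk_tendsto[OF _ Wu_le p(1)]) (use p in \<open>auto simp: mem_QT\<close>)
qed

lemma F_measurable [measurable]: "F \<in> borel_measurable borel"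
  by measurable

text \<open>Both sides are continuous, so a strict inequality at one point would persist on a ball
  and be detected by a bump function supported there.\<close>

lemma F_eq_interior:
  assumes a: "0 < snd a" "snd a < T"
  shows "F a = hk_at y a"
proof (rule ccontr)
  define U where "U = {p::'a \<times> real. 0 < snd p \<and> snd p < T}"
  have U: "open U" "U \<subseteq> QT T" "a \<in> U"
    using a unfolding U_def by (auto simp: mem_QT intro!: open_Collect_conj open_Collect_less continuous_intros)
  have cF: "isCont F a"
  proof -
    have "continuous_on U F"
      unfolding continuous_on_sequentially comp_def using F_tendsto U(2) by blast
    then show ?thesis using U by (simp add: continuous_on_eq_continuous_at)
  qed
  have cG: "isCont (hk_at y) a"
  proof -
    have "continuous_on U (hk_at y)"
      unfolding continuous_on_sequentially comp_def using hk_at_tendsto[of _ _ y] by (auto simp: U_def)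
    then show ?thesis using U by (simp add: continuous_on_eq_continuous_at)
  qed
  have ctr: False
    if ab: "isCont A a" "isCont B a" "A a < B a" and [measurable]: "A \<in> borel_measurable borel" "B \<in> borel_measurable borel"
      and I: "\<And>\<psi> K. test_function \<psi> K \<Longrightarrow> (\<And>z. z \<in> K \<Longrightarrow> snd z < T) \<Longrightarrow> (\<And>z. 0 \<le> \<psi> z) \<Longrightarrow>
        (\<integral>\<^sup>+ p. ennreal (\<psi> p) * A p \<partial>lborel) = (\<integral>\<^sup>+ p. ennreal (\<psi> p) * B p \<partial>lborel)"
    for A B :: "'a \<times> real \<Rightarrow> ennreal"
  proof -
    \<comment> \<open>Two intermediate levels \<open>c < d\<close> separate the integrals by the
      strict inequality between \<open>J * c\<close> and \<open>J * d\<close>; a single level would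
      give only a weak one.\<close>
    obtain c where c: "A a < c" "c < B a" using dense[OF ab(3)] by blast
    obtain d where d: "c < d" "d < B a" using dense[OF c(2)] by blast
    have "\<forall>\<^sub>F p in nhds a. A p < c"
      using ab(1) c(1) by (auto simp: isCont_def eventually_nhds_conv_at intro: order_tendstoD)
    moreover have "\<forall>\<^sub>F p in nhds a. d < B p"
      using ab(2) d(2) by (auto simp: isCont_def eventually_nhds_conv_at intro: order_tendstoD)
    moreover have "\<forall>\<^sub>F p in nhds a. p \<in> U"
      using U by (intro eventually_nhds_in_open)
    ultimately have "\<forall>\<^sub>F p in nhds a. A p < c \<and> d < B p \<and> p \<in> U"
      by eventually_elim auto
    then obtain e where e: "0 < e" "\<And>p. dist p a < e \<Longrightarrow> A p < c \<and> d < B p \<and> p \<in> U"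
      by (auto simp: eventually_nhds_metric)
    define \<rho> where "\<rho> = e / 2"
    have \<rho>: "0 < \<rho>" "\<And>p. p \<in> cball a \<rho> \<Longrightarrow> A p < c \<and> d < B p \<and> p \<in> U"
      using e by (auto simp: \<rho>_def dist_commute)
    let ?b = "bump a \<rho>"
    interpret b: test_function ?b "cball a \<rho>" by (rule test_function_bump[OF \<rho>(1)])
    define J where "J = (\<integral>\<^sup>+ p. ennreal (?b p) \<partial>lborel)"
    have J_fin: "J < \<top>"
      using integrable_compact_support[OF b.cont(1) b.K b.out] unfolding J_def
      by (simp add: nn_integral_eq_integral)
    have J_pos: "J \<noteq> 0"
    proof
      assume "J = 0"
      then have "AE p in lborel. ennreal (?b p) = 0"
        unfolding J_def by (subst (asm) nn_integral_0_iff_AE) auto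
      then have "AE p in lborel. p \<notin> ball a \<rho>"
        by eventually_elim (use bump_pos in \<open>force simp: ennreal_eq_0_iff\<close>)
      then have "ball a \<rho> \<in> null_sets lborel"
        by (simp add: AE_iff_null_sets)
      then have "negligible (ball a \<rho>)"
        by (simp add: negligible_iff_null_sets null_sets_completionI)
      then show False
        using open_not_negligible[OF open_ball, of a \<rho>] \<rho>(1) by simp
    qed
    have "(\<integral>\<^sup>+ p. ennreal (?b p) * A p \<partial>lborel) \<le> (\<integral>\<^sup>+ p. ennreal (?b p) * c \<partial>lborel)"
    proof (rule nn_integral_mono)
      fix p
      show "ennreal (?b p) * A p \<le> ennreal (?b p) * c"
        using \<rho>(2)[of p] b.out[of p] by (cases "p \<in> cball a \<rho>") (auto intro!: mult_left_mono)
    qed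
    also have "\<dots> = J * c" unfolding J_def by (rule nn_integral_multc) simp
    also have "\<dots> < J * d"
      using J_fin J_pos d(1) by (intro ennreal_mult_strict_left_mono) (auto simp: zero_less_iff_neq_zero)
    also have "\<dots> = (\<integral>\<^sup>+ p. ennreal (?b p) * d \<partial>lborel)" unfolding J_def by (rule nn_integral_multc[symmetric]) simp
    also have "\<dots> \<le> (\<integral>\<^sup>+ p. ennreal (?b p) * B p \<partial>lborel)"
    proof (rule nn_integral_mono)
      fix p
      show "ennreal (?b p) * d \<le> ennreal (?b p) * B p"
        using \<rho>(2)[of p] b.out[of p] by (cases "p \<in> cball a \<rho>") (auto intro!: mult_left_mono)
    qed
    finally show False
      using I[OF test_function_bump[OF \<rho>(1)]] \<rho>(2) by (auto simp: U_def)
  qed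
  assume "F a \<noteq> hk_at y a"
  then consider "F a < hk_at y a" | "hk_at y a < F a" by (metis linorder_neqE)
  then show False
  proof cases
    case 1
    show False by (rule ctr[OF cF cG 1]) (simp, simp, rule tested_nn)
  next
    case 2
    show False by (rule ctr[OF cG cF 2]) (simp, simp, rule tested_nn[symmetric])
  qed
qed

lemma F_eq:
  assumes a: "a \<in> QT T"
  shows "F a = hk_at y a"
proof (cases "snd a < T")
  case True
  then show ?thesis using a F_eq_interior by (simp add: mem_QT)
next
  case False
  with a have T: "snd a = T" "0 < T" by (auto simp: mem_QT)
  \<comment> \<open>Test functions vanish near time \<open>T\<close>, so the top slice is reached by
    continuity from below. The double successor makes the factor \<open>1 - 1 / (n + 2)\<close>,
    which keeps the times positive from the start.\<close>
  define p where "p n = (fst a, T - T * inverse (real (Suc (Suc n))))" for n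
  have "(\<lambda>n. inverse (real (Suc (Suc n)))) \<longlonglongrightarrow> 0"
    using LIMSEQ_Suc[OF LIMSEQ_inverse_real_of_nat] .
  then have "p \<longlonglongrightarrow> (fst a, T - T * 0)"
    unfolding p_def by (intro tendsto_intros)
  then have p: "p \<longlonglongrightarrow> a" using T by (metis mult_zero_right diff_zero prod.collapse)
  have pT: "0 < snd (p n)" "snd (p n) < T" for n
    using T(2) by (auto simp: p_def field_simps add_pos_nonneg)
  have "(\<lambda>n. F (p n)) \<longlonglongrightarrow> F a"
    using pT a less_imp_le by (intro F_tendsto p) (auto simp: mem_QT)
  moreover have "(\<lambda>n. F (p n)) \<longlonglongrightarrow> hk_at y a"
    unfolding F_eq_interior[OF pT] by (rule hk_at_tendsto[OF p]) (use T in simp)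
  ultimately show ?thesis by (rule LIMSEQ_unique)
qed

lemma kern_finite: "kern W k y p < \<top>"
  using kern_le[of y p] hk_less_top(1)[of "p - (y, 0)"] by (rule le_less_trans)

text \<open>Both functions satisfy the Duhamel equation on the strip, so their distance obeys the
  Gronwall inequality; the common bound by the heat kernel supplies its a priori estimate.\<close>

lemma u_eq_kern:
  assumes a: "a \<in> QT T"
  shows "ennreal (u a) = kern W k y a"
proof -
  define v where "v p = enn2real (kern W k y p)" for p
  have v: "kern W k y p = ennreal (v p)" "0 \<le> v p" for p
    using kern_finite[of p] by (auto simp: v_def)
  have v_le: "v p \<le> hkr (p - (y, 0))" for p
    using kern_le[of y p] by (simp add: v hk_eq_hkr)
  have [measurable]: "v \<in> borel_measurable borel"
    unfolding v_def[abs_def] by measurable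
  \<comment> \<open>The distance is restricted to \<open>QT T\<close>, because \<open>u\<close> is
    cut off after time \<open>T\<close> and \<open>v\<close> is not. Nothing is lost: a Duhamel
    integral at a point of the strip sees earlier times only.\<close>
  define d where "d p = ennreal (\<bar>u p - v p\<bar> * indicator (QT T) p)" for p
  have [measurable]: "d \<in> borel_measurable borel"
    unfolding d_def[abs_def] by measurable
  have le1: "conv hk (\<lambda>q. ennreal (W q) * ennreal (f q)) p \<le> conv hk (\<lambda>q. ennreal (W q) * ennreal (g q)) p + ennreal k * conv hk d p"
    if p: "p \<in> QT T" and [measurable]: "f \<in> borel_measurable borel" "g \<in> borel_measurable borel"
      and f0: "\<And>q. snd q \<le> 0 \<Longrightarrow> f q = 0" and g0: "\<And>q. 0 \<le> g q"
      and le: "\<And>q. q \<in> QT T \<Longrightarrow> f q \<le> g q + \<bar>u q - v q\<bar>" for p f g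
  proof -
    have "conv hk (\<lambda>q. ennreal (W q) * ennreal (f q)) p \<le> conv hk (\<lambda>q. ennreal (W q) * ennreal (g q) + ennreal k * d q) p"
      unfolding conv_def
    proof (rule nn_integral_mono)
      fix q
      show "hk (p - q) * (ennreal (W q) * ennreal (f q)) \<le> hk (p - q) * (ennreal (W q) * ennreal (g q) + ennreal k * d q)"
      proof (cases "q \<in> QT T")
        case True
        have "ennreal (f q) \<le> ennreal (g q + \<bar>u q - v q\<bar>)" by (rule ennreal_leI[OF le[OF True]])
        also have "\<dots> = ennreal (g q) + d q" using True g0 by (simp add: d_def)
        finally have "ennreal (W q) * ennreal (f q) \<le> ennreal (W q) * (ennreal (g q) + d q)"
          by (rule mult_left_mono) simp
        also have "\<dots> \<le> ennreal (W q) * ennreal (g q) + ennreal k * d q"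
          by (simp add: distrib_left add_left_mono mult_right_mono W_le_k)
        finally show ?thesis by (rule mult_left_mono) simp
      next
        case False
        then show ?thesis using p f0[of q] by (cases "snd q \<le> 0") (auto simp: mem_QT)
      qed
    qed
    also have "\<dots> = conv hk (\<lambda>q. ennreal (W q) * ennreal (g q)) p + ennreal k * conv hk d p"
      by (simp add: conv_add conv_cmult)
    finally show ?thesis .
  qed
  have v0: "snd q \<le> 0 \<Longrightarrow> v q = 0" for q
    using v_le[of q] v(2)[of q] by simp
  have "d p \<le> ennreal k * conv hk d p" for p
  proof (cases "p \<in> QT T")
    case True
    let ?A = "conv hk (\<lambda>q. ennreal (W q) * ennreal (u q)) p"
    let ?B = "conv hk (\<lambda>q. ennreal (W q) * ennreal (v q)) p"
    let ?D = "ennreal k * conv hk d p"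
    have A_fin: "?A < \<top>" by (rule conv_hk_finite[OF Wu_le])
    have B_fin: "?B < \<top>"
      by (rule conv_hk_finite[of _ k y]) (intro mult_mono W_le_k; simp add: hk_eq_hkr ennreal_leI v_le)
    have e: "ennreal (u p) + ?A = ennreal (v p) + ?B"
      using F_eq[OF True] kern_duhamel[of y p] by (simp add: v)
    have AB: "?A \<le> ?B + ?D" by (rule le1[OF True]) (auto simp: u_out_time v)
    have BA: "?B \<le> ?A + ?D" by (rule le1[OF True]) (auto simp: v0)
    show ?thesis
    proof (cases "?D = \<top>")
      case False
      obtain A where A: "?A = ennreal A" "0 \<le> A" using A_fin by (cases ?A) auto
      obtain B where B: "?B = ennreal B" "0 \<le> B" using B_fin by (cases ?B) auto
      obtain D where D: "?D = ennreal D" "0 \<le> D" using False by (cases ?D) auto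
      have "ennreal (u p + A) = ennreal (v p + B)"
        using e A B v(2)[of p] by simp
      then have "u p + A = v p + B"
        using A B v(2)[of p] by (subst (asm) ennreal_inj) auto
      moreover have "A \<le> B + D" "B \<le> A + D"
        using AB BA unfolding A(1) B(1) D(1) using A(2) B(2) D(2)
        by (simp_all add: ennreal_plus[symmetric] del: ennreal_plus)
      ultimately have "\<bar>u p - v p\<bar> \<le> D" by linarith
      then show ?thesis
        unfolding D(1) using True by (simp add: d_def ennreal_leI)
    qed simp
  qed (simp add: d_def)
  moreover have "d p \<le> ennreal 1 * hk_at y p" for p
  proof -
    have "\<bar>u p - v p\<bar> \<le> hkr (p - (y, 0))"
      using u_le[of p] v_le[of p] u_nonneg[of p] v(2)[of p] by linarith
    then show ?thesis
      by (auto simp: d_def hk_eq_hkr indicator_def intro!: ennreal_leI)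
  qed
  ultimately have "d a = 0"
    using k_pos by (intro heat_gronwall[of d k 1 y]) auto
  then have "u a = v a" using a by (simp add: d_def)
  then show ?thesis by (simp add: v)
qed

end

section \<open>The constructed kernel as the unique weak solution\<close>

context bounded_potential
begin

definition kern_real :: "'a \<Rightarrow> 'a \<times> real \<Rightarrow> real" where
  "kern_real y p = enn2real (kern W k y p)"

lemma kern_eq_kern_real: "kern W k y p = ennreal (kern_real y p)"
  using kern_le[of y p] hk_less_top(1)[of "p - (y, 0)"]
  by (simp add: kern_real_def le_less_trans)

lemma kern_real_nonneg [simp]: "0 \<le> kern_real y p"
  by (simp add: kern_real_def)

lemma kern_real_le: "kern_real y p \<le> hkr (p - (y, 0))"
  using kern_le[of y p] by (simp add: kern_eq_kern_real hk_eq_hkr)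

lemma measurable_kern_real [measurable]: "kern_real y \<in> borel_measurable borel"
  unfolding kern_real_def[abs_def] by measurable

lemma conv_kern_le: "conv hk (\<lambda>q. ennreal (W q) * kern W k y q) p \<le> hk_at y p"
  unfolding kern_duhamel[of y p, symmetric] by simp

definition duhamel_real :: "'a \<Rightarrow> 'a \<times> real \<Rightarrow> real" where
  "duhamel_real y p = (\<integral>z. hkr (p - z) * (W z * kern_real y z) \<partial>lborel)"

lemma conv_kern_eq_duhamel_real: "conv hk (\<lambda>q. ennreal (W q) * kern W k y q) p = ennreal (duhamel_real y p)"
proof -
  have "conv hk (\<lambda>q. ennreal (W q) * kern W k y q) p = (\<integral>\<^sup>+ z. ennreal (hkr (p - z) * (W z * kern_real y z)) \<partial>lborel)"
    unfolding conv_def by (simp add: hk_eq_hkr kern_eq_kern_real ennreal_mult' W_nonneg)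
  moreover have "duhamel_real y p = enn2real (\<integral>\<^sup>+ z. ennreal (hkr (p - z) * (W z * kern_real y z)) \<partial>lborel)"
    unfolding duhamel_real_def by (rule integral_eq_nn_integral) (auto simp: W_nonneg)
  ultimately show ?thesis
    using conv_kern_le[of y p] hk_less_top(1)[of "p - (y, 0)"] by (simp add: le_less_trans)
qed

lemma duhamel_real_nonneg: "0 \<le> duhamel_real y p"
  unfolding duhamel_real_def by (intro Bochner_Integration.integral_nonneg) (simp add: W_nonneg)

lemma kern_real_eq: "kern_real y p = hkr (p - (y, 0)) - duhamel_real y p"
proof -
  have "ennreal (kern_real y p + duhamel_real y p) = ennreal (hkr (p - (y, 0)))"
    using kern_duhamel[of y p] unfolding conv_kern_eq_duhamel_real by (simp add: kern_eq_kern_real hk_eq_hkr duhamel_real_nonneg)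
  then show ?thesis
    using duhamel_real_nonneg[of y p] by (subst (asm) ennreal_inj) auto
qed

lemma kern_real_continuous: "continuous_on {p. 0 < snd p} (kern_real y)"
proof -
  have "(\<lambda>n. kern_real y (p n)) \<longlonglongrightarrow> kern_real y a" if p: "p \<longlonglongrightarrow> a" "0 < snd a" for p a
  proof -
    have "(\<lambda>n. conv hk (\<lambda>q. ennreal (W q) * kern W k y q) (p n)) \<longlonglongrightarrow> conv hk (\<lambda>q. ennreal (W q) * kern W k y q) a"
      by (rule conv_hk_tendsto[where C=k and y=y, OF _ _ p]) (auto intro!: mult_mono W_le_k kern_le)
    then have 1: "(\<lambda>n. duhamel_real y (p n)) \<longlonglongrightarrow> duhamel_real y a"
      unfolding conv_kern_eq_duhamel_real by (subst (asm) tendsto_ennreal_iff) (auto simp: duhamel_real_nonneg)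
    have 2: "(\<lambda>n. hkr (p n - (y, 0))) \<longlonglongrightarrow> hkr (a - (y, 0))"
      using hk_at_tendsto[OF p, of y] unfolding hk_eq_hkr by (subst (asm) tendsto_ennreal_iff) auto
    show ?thesis
      unfolding kern_real_eq by (intro tendsto_diff 1 2)
  qed
  then show ?thesis
    unfolding continuous_on_sequentially comp_def by auto
qed

lemma integrable_hkr_at:
  fixes f :: "'a \<times> real \<Rightarrow> real"
  assumes "continuous_on UNIV f" "compact S" "\<And>z. z \<notin> S \<Longrightarrow> f z = 0"
  shows "integrable lborel (\<lambda>z. hkr (z - (y::'a, 0)) * f z)"
proof -
  obtain B where B: "\<And>z. \<bar>f z\<bar> \<le> B" using bounded_compact_support[OF assms] by blast
  have "bounded (snd ` S)"
    using assms(2) by (intro compact_imp_bounded compact_continuous_image continuous_intros)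
  then obtain R where R: "\<forall>x\<in>snd ` S. norm x < R"
    unfolding bounded_pos_less by blast
  have "f z = 0" if "R \<le> snd z" for z
    using R that assms(3)[of z] by (cases "z \<in> S") force+
  then have "integrable lborel (\<lambda>q. hkr q * f ((y, 0) + q))"
    by (intro integrable_hkr_shift(2)[OF assms(1) B]) auto
  then have "integrable lborel (\<lambda>q. hkr (q + - (y, 0)) * f ((y, 0) + (q + - (y, 0))))"
    by (rule integrable_lborel_shift)
  moreover have "(y, 0) + (q + - (y, 0)) = q" "q + - (y, 0::real) = q - (y, 0)" for q :: "'a \<times> real"
    by (simp_all add: prod_eq_iff)
  ultimately show ?thesis by (simp only:)
qed

text \<open>After substitution of the Duhamel equation and an exchange of integrals, the adjoint
  operator meets heat kernels with pole at each \<open>z\<close>, where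
  \<open>heat_fundamental'\<close> returns \<open>\<phi> z\<close>. These terms cancel the ones with
  \<open>W\<close>. The exchange is justified since the Duhamel term is at most the heat
  kernel.\<close>

lemma kern_real_weak:
  assumes "test_function \<phi> S"
  shows "(\<integral>z. kern_real y z * (test_function.L \<phi> z + W z * \<phi> z) \<partial>lborel) = \<phi> (y, 0)"
proof -
  interpret test_function \<phi> S by fact
  have iL: "integrable lborel (\<lambda>z. hkr (z - (y, 0)) * L z)"
    by (rule integrable_hkr_at[OF cont_L K out_L])
  have i\<phi>: "integrable lborel (\<lambda>z. hkr (z - (y, 0)) * \<phi> z)"
    by (rule integrable_hkr_at[OF cont(1) K out])
  have ikL: "integrable lborel (\<lambda>z. kern_real y z * L z)"
  proof (rule Bochner_Integration.integrable_bound[OF iL])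
    show "AE z in lborel. norm (kern_real y z * L z) \<le> norm (hkr (z - (y, 0)) * L z)"
      by (intro AE_I2) (simp add: abs_mult mult_right_mono kern_real_le)
  qed simp
  have ik\<phi>: "integrable lborel (\<lambda>z. kern_real y z * (W z * \<phi> z))"
  proof (rule Bochner_Integration.integrable_bound[OF integrable_mult_right[OF i\<phi>, of k]])
    show "AE z in lborel. norm (kern_real y z * (W z * \<phi> z)) \<le> norm (k * (hkr (z - (y, 0)) * \<phi> z))"
    proof (rule AE_I2)
      fix z
      have "W z * (kern_real y z * \<bar>\<phi> z\<bar>) \<le> k * (hkr (z - (y, 0)) * \<bar>\<phi> z\<bar>)"
        using W_nonneg[of z] k_pos by (intro mult_mono W_le mult_right_mono kern_real_le) auto
      then show "norm (kern_real y z * (W z * \<phi> z)) \<le> norm (k * (hkr (z - (y, 0)) * \<phi> z))"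
        using W_nonneg[of z] k_pos by (simp add: abs_mult mult.left_commute)
    qed
  qed simp
  have "(\<integral>p. duhamel_real y p * L p \<partial>lborel) = (\<integral>p. (\<integral>z. hkr (p - z) * (W z * kern_real y z) * L p \<partial>lborel) \<partial>lborel)"
    unfolding duhamel_real_def by simp
  also have "\<dots> = (\<integral>z. (\<integral>p. hkr (p - z) * (W z * kern_real y z) * L p \<partial>lborel) \<partial>lborel)"
  proof (rule lborel_pair.Fubini_integral)
    show "integrable (lborel \<Otimes>\<^sub>M lborel) (\<lambda>(z, p). hkr (p - z) * (W z * kern_real y z) * L p)"
    proof (rule integrableI_bounded)
      have "(\<integral>\<^sup>+ x. ennreal (norm (case x of (z, p) \<Rightarrow> hkr (p - z) * (W z * kern_real y z) * L p)) \<partial>(lborel \<Otimes>\<^sub>M lborel))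
         = (\<integral>\<^sup>+ p. \<integral>\<^sup>+ z. ennreal (norm (hkr (p - z) * (W z * kern_real y z) * L p)) \<partial>lborel \<partial>lborel)"
        by (subst lborel_pair.nn_integral_snd[symmetric]) auto
      also have "\<dots> = (\<integral>\<^sup>+ p. conv hk (\<lambda>q. ennreal (W q) * kern W k y q) p * ennreal \<bar>L p\<bar> \<partial>lborel)"
        unfolding conv_def
        by (simp add: abs_mult ennreal_mult' hk_eq_hkr kern_eq_kern_real W_nonneg nn_integral_multc)
      also have "\<dots> \<le> (\<integral>\<^sup>+ p. ennreal (norm (hkr (p - (y, 0)) * L p)) \<partial>lborel)"
        using conv_kern_le by (intro nn_integral_mono) (simp add: abs_mult ennreal_mult' hk_eq_hkr mult_right_mono)
      also have "\<dots> < \<infinity>"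
        using iL by (simp add: integrable_iff_bounded)
      finally show "(\<integral>\<^sup>+ x. ennreal (norm (case x of (z, p) \<Rightarrow> hkr (p - z) * (W z * kern_real y z) * L p)) \<partial>(lborel \<Otimes>\<^sub>M lborel)) < \<infinity>" .
    qed measurable
  qed
  also have "\<dots> = (\<integral>z. (W z * kern_real y z) * (\<integral>p. hkr (p - z) * L p \<partial>lborel) \<partial>lborel)"
  proof -
    have e: "hkr (p - z) * (W z * kern_real y z) * L p = (W z * kern_real y z) * (hkr (p - z) * L p)" for z p
      by simp
    show ?thesis
      unfolding e by simp
  qed
  also have "\<dots> = (\<integral>z. kern_real y z * (W z * \<phi> z) \<partial>lborel)"
    unfolding heat_fundamental' by (simp add: ac_simps)
  finally have c: "(\<integral>p. duhamel_real y p * L p \<partial>lborel) = (\<integral>z. kern_real y z * (W z * \<phi> z) \<partial>lborel)" .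
  have icL: "integrable lborel (\<lambda>z. duhamel_real y z * L z)"
    using Bochner_Integration.integrable_diff[OF iL ikL] by (simp add: kern_real_eq algebra_simps)
  have "(\<integral>z. kern_real y z * L z \<partial>lborel) = \<phi> (y, 0) - (\<integral>p. duhamel_real y p * L p \<partial>lborel)"
    unfolding kern_real_eq left_diff_distrib using iL icL by (simp add: heat_fundamental')
  then show ?thesis
    using ikL ik\<phi> c by (simp add: distrib_left)
qed

text \<open>The weak formulation uses Lebesgue measure on the strip and a potential known almost
  everywhere; it is traded here for a Borel potential and an integral over all of
  space-time.\<close>

lemma weak_solution_integral:
  fixes w :: "'a \<times> real \<Rightarrow> real"
  assumes W0: "W0 \<in> borel_measurable (lebesgue_on (QT T))" "AE z in lebesgue_on (QT T). W0 z = W z"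
    and w: "continuous_on (QT T) w" and "test_function \<phi> S"
  shows "(LINT z:QT T|lebesgue. w z * (- time_deriv \<phi> z - laplacian \<phi> z + W0 z * \<phi> z))
    = (\<integral>z. (indicator (QT T) z * w z) * (test_function.L \<phi> z + W z * \<phi> z) \<partial>lborel)"
proof -
  interpret test_function \<phi> S by fact
  have wi [measurable]: "(\<lambda>x. indicator (QT T) x * w x) \<in> borel_measurable borel"
    using borel_measurable_continuous_on_indicator[OF QT_borel w] by simp
  have m: "(\<lambda>z. (indicator (QT T) z * w z) * (L z + W z * \<phi> z)) \<in> borel_measurable lborel"
    by measurable
  have Q: "QT T \<in> sets (lebesgue :: ('a \<times> real) measure)" by simp
  have wm [measurable]: "w \<in> borel_measurable (lebesgue_on (QT T))"
    by (rule continuous_imp_measurable_on_sets_lebesgue[OF w Q])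
  have b: "f \<in> borel_measurable (lebesgue_on (QT T))" if "f \<in> borel_measurable borel" for f :: "'a \<times> real \<Rightarrow> real"
    using that by (intro measurable_restrict_space1 measurable_completion) simp
  note [measurable] = b[OF meas(1)] b[OF measurable_L] b[OF W_measurable] W0(1)
  have "(LINT z:QT T|lebesgue. w z * (- time_deriv \<phi> z - laplacian \<phi> z + W0 z * \<phi> z))
     = (\<integral>z. w z * (L z + W0 z * \<phi> z) \<partial>lebesgue_on (QT T))"
    using Q by (subst integral_restrict_space) (auto simp: L_def set_lebesgue_integral_def)
  also have "\<dots> = (\<integral>z. w z * (L z + W z * \<phi> z) \<partial>lebesgue_on (QT T))"
  proof (rule integral_cong_AE)
    show "AE z in lebesgue_on (QT T). w z * (L z + W0 z * \<phi> z) = w z * (L z + W z * \<phi> z)"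
      using W0(2) by eventually_elim simp
  qed measurable
  also have "\<dots> = (\<integral>z. (indicator (QT T) z * w z) * (L z + W z * \<phi> z) \<partial>lebesgue)"
    using Q by (subst integral_restrict_space) (auto simp: set_lebesgue_integral_def mult.assoc)
  also have "\<dots> = (\<integral>z. (indicator (QT T) z * w z) * (L z + W z * \<phi> z) \<partial>lborel)"
    by (rule integral_completion[OF m])
  finally show ?thesis .
qed

lemma test_fun_iff:
  fixes \<phi> :: "'a \<times> real \<Rightarrow> real"
  shows "test_fun T \<phi> \<longleftrightarrow> (\<exists>S. test_function \<phi> S \<and> (\<forall>z\<in>S. snd z < T))"
proof -
  have "S \<subseteq> UNIV \<times> {..<T} \<longleftrightarrow> (\<forall>z\<in>S. snd z < T)" for S :: "('a \<times> real) set"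
    by (auto simp: subset_iff)
  then show ?thesis
    unfolding test_fun_def test_function_def by blast
qed

lemma fundamental_solution_kern_real:
  assumes W0: "W0 \<in> borel_measurable (lebesgue_on (QT T))" "AE z in lebesgue_on (QT T). W0 z = W z"
  shows "fundamental_solution T W0 y (\<lambda>z. indicator (QT T) z * kern_real y z)"
  unfolding fundamental_solution_def
proof (intro conjI allI impI)
  have "continuous_on (QT T) (kern_real y)"
    by (rule continuous_on_subset[OF kern_real_continuous]) (auto simp: mem_QT)
  then show c: "continuous_on (QT T) (\<lambda>z. indicator (QT T) z * kern_real y z)"
    by (rule continuous_on_eq) simp
  show "\<forall>(x, t)\<in>QT T. 0 \<le> indicator (QT T) (x, t) * kern_real y (x, t) \<and> indicator (QT T) (x, t) * kern_real y (x, t) \<le> heat (x - y) t"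
  proof safe
    fix x :: 'a and t assume "(x, t) \<in> QT T"
    then show "indicator (QT T) (x, t) * kern_real y (x, t) \<le> heat (x - y) t"
      using kern_real_le[of y "(x, t)"] by (simp add: mem_QT hkr_def)
  qed simp
  fix \<phi> :: "'a \<times> real \<Rightarrow> real" assume "test_fun T \<phi>"
  then obtain S where S: "test_function \<phi> S" "\<forall>z\<in>S. snd z < T"
    by (auto simp: test_fun_iff)
  interpret test_function \<phi> S by fact
  have "(LINT z:QT T|lebesgue. indicator (QT T) z * kern_real y z * (- time_deriv \<phi> z - laplacian \<phi> z + W0 z * \<phi> z))
     = (\<integral>z. (indicator (QT T) z * (indicator (QT T) z * kern_real y z)) * (L z + W z * \<phi> z) \<partial>lborel)"
    by (rule weak_solution_integral[OF W0 c S(1)])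
  also have "\<dots> = (\<integral>z. kern_real y z * (L z + W z * \<phi> z) \<partial>lborel)"
  proof (rule Bochner_Integration.integral_cong)
    fix z
    have "kern_real y z = 0" if "snd z \<le> 0" using kern_real_le[of y z] kern_real_nonneg[of y z] that by simp
    moreover have "L z = 0" "\<phi> z = 0" if "T < snd z"
      using that S(2) out[of z] out_L[of z] by force+
    ultimately show "(indicator (QT T) z * (indicator (QT T) z * kern_real y z)) * (L z + W z * \<phi> z) = kern_real y z * (L z + W z * \<phi> z)"
      by (cases "z \<in> QT T") (auto simp: mem_QT)
  qed simp
  also have "\<dots> = \<phi> (y, 0)" by (rule kern_real_weak[OF S(1)])
  finally show "(LINT z:QT T|lebesgue. indicator (QT T) z * kern_real y z * (- time_deriv \<phi> z - laplacian \<phi> z + W0 z * \<phi> z)) = \<phi> (y, 0)" .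
qed

lemma fundamental_solution_unique:
  assumes W0: "W0 \<in> borel_measurable (lebesgue_on (QT T))" "AE z in lebesgue_on (QT T). W0 z = W z"
    and w: "fundamental_solution T W0 y w" "\<And>z. z \<notin> QT T \<Longrightarrow> w z = 0"
  shows "w = (\<lambda>z. indicator (QT T) z * kern_real y z)"
proof -
  have c: "continuous_on (QT T) w" using w(1) by (simp add: fundamental_solution_def)
  interpret weak_solution W k T y w
  proof
    show "continuous_on (QT T) w" by (rule c)
    show "0 \<le> w p \<and> w p \<le> hkr (p - (y, 0))" if "p \<in> QT T" for p
      using w(1) that by (cases p) (auto simp: fundamental_solution_def hkr_def mem_QT)
    show "w p = 0" if "p \<notin> QT T" for p using w(2) that .
    fix \<phi> K assume K: "test_function \<phi> K" "\<And>z::'a \<times> real. z \<in> K \<Longrightarrow> snd z < T"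
    have "(LINT z:QT T|lebesgue. w z * (- time_deriv \<phi> z - laplacian \<phi> z + W0 z * \<phi> z)) = \<phi> (y, 0)"
    proof -
      have "test_fun T \<phi>" unfolding test_fun_iff using K by blast
      then show ?thesis using w(1) unfolding fundamental_solution_def by blast
    qed
    moreover have "indicator (QT T) z * w z = w z" for z using w(2)[of z] by (auto simp: indicator_def)
    ultimately show "(\<integral>z. w z * (test_function.L \<phi> z + W z * \<phi> z) \<partial>lborel) = \<phi> (y, 0)"
      using weak_solution_integral[OF W0 c K(1)] by simp
  qed
  show ?thesis
  proof
    fix z
    show "w z = indicator (QT T) z * kern_real y z"
    proof (cases "z \<in> QT T")
      case True
      then show ?thesis using u_eq_kern[OF True] by (simp add: kern_eq_kern_real)
    qed (simp add: w(2))
  qed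
qed

lemma heat_kernel_eq:
  assumes W0: "W0 \<in> borel_measurable (lebesgue_on (QT T))" "AE z in lebesgue_on (QT T). W0 z = W z"
    and t: "(x, t) \<in> QT T"
  shows "heat_kernel T W0 x y t = kern_real y (x, t)"
proof -
  have "(THE w. fundamental_solution T W0 y w \<and> (\<forall>z. z \<notin> QT T \<longrightarrow> w z = 0)) = (\<lambda>z. indicator (QT T) z * kern_real y z)"
    by (rule the_equality) (auto intro: fundamental_solution_kern_real[OF W0] fundamental_solution_unique[OF W0])
  then show ?thesis using t by (simp add: heat_kernel_def)
qed

end

section \<open>Singular potentials\<close>

definition slice_prop :: "('a::euclidean_space \<times> real \<Rightarrow> ennreal) \<Rightarrow> real \<Rightarrow> 'a \<times> real \<Rightarrow> ennreal" where
  "slice_prop f \<tau> p = (\<integral>\<^sup>+ z. hk (fst p - z, snd p - \<tau>) * f (z, \<tau>) \<partial>lborel)"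

lemma measurable_Pair_const [measurable]: "(\<lambda>z::'a::euclidean_space. (z, t::real)) \<in> borel_measurable borel"
  "(\<lambda>t::real. (z::'a, t)) \<in> borel_measurable borel"
  by (auto simp: borel_prod[symmetric])

lemma slice_prop_hk_at:
  assumes "0 < \<tau>" "\<tau> < snd p"
  shows "slice_prop (hk_at y) \<tau> p = hk_at y p"
  using hk_semigroup[OF assms(1), of "fst p" "snd p" y] assms(2)
  by (cases p) (simp add: slice_prop_def)

text \<open>What is produced before \<open>\<tau>\<close> is carried on by the semigroup law;
  sources at or after \<open>\<tau>\<close> have not reached the slice.\<close>

lemma slice_prop_conv:
  fixes f :: "'a::euclidean_space \<times> real \<Rightarrow> ennreal"
  assumes [measurable]: "f \<in> borel_measurable borel" and \<tau>: "0 < \<tau>" "\<tau> < snd p"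
  shows "slice_prop (conv hk f) \<tau> p = conv hk (\<lambda>q. f q * indicator {..<\<tau>} (snd q)) p"
proof -
  have "slice_prop (conv hk f) \<tau> p
      = (\<integral>\<^sup>+ z. \<integral>\<^sup>+ q. hk (fst p - z, snd p - \<tau>) * (hk ((z, \<tau>) - q) * f q) \<partial>lborel \<partial>lborel)"
    unfolding slice_prop_def conv_def by (simp add: nn_integral_cmult)
  also have "\<dots> = (\<integral>\<^sup>+ q. \<integral>\<^sup>+ z. hk (fst p - z, snd p - \<tau>) * (hk ((z, \<tau>) - q) * f q) \<partial>lborel \<partial>lborel)"
    by (rule lborel_pair.Fubini') measurable
  also have "\<dots> = (\<integral>\<^sup>+ q. hk (p - q) * (f q * indicator {..<\<tau>} (snd q)) \<partial>lborel)"
  proof (rule nn_integral_cong)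
    fix q :: "'a \<times> real"
    have e: "hk ((z, \<tau>) - q) = hk (z - fst q, \<tau> - snd q)" for z by (cases q) simp
    have "(\<integral>\<^sup>+ z. hk (fst p - z, snd p - \<tau>) * (hk ((z, \<tau>) - q) * f q) \<partial>lborel)
        = (\<integral>\<^sup>+ z. hk (fst p - z, snd p - \<tau>) * hk (z - fst q, \<tau> - snd q) \<partial>lborel) * f q"
      unfolding e mult.assoc[symmetric] by (rule nn_integral_multc) measurable
    also have "\<dots> = hk (p - q) * (f q * indicator {..<\<tau>} (snd q))"
    proof (cases "snd q < \<tau>")
      case True
      have "(\<integral>\<^sup>+ z. hk (fst p - z, (snd p - snd q) - (\<tau> - snd q)) * hk (z - fst q, \<tau> - snd q) \<partial>lborel)
          = hk (fst p - fst q, snd p - snd q)"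
        using True \<tau> by (subst hk_semigroup) auto
      then show ?thesis
        using True by (cases p; cases q) simp
    qed (simp add: hk_def)
    finally show "(\<integral>\<^sup>+ z. hk (fst p - z, snd p - \<tau>) * (hk ((z, \<tau>) - q) * f q) \<partial>lborel)
        = hk (p - q) * (f q * indicator {..<\<tau>} (snd q))" .
  qed
  finally show ?thesis by (simp add: conv_def)
qed

definition tau :: "nat \<Rightarrow> real" where "tau n = inverse (real (Suc n))"

lemma tau_pos [simp]: "0 < tau n" by (simp add: tau_def)

lemma tau_tendsto: "tau \<longlonglongrightarrow> 0"
  unfolding tau_def[abs_def] by (rule LIMSEQ_inverse_real_of_nat)

lemma tau_decseq: "decseq tau"
  unfolding tau_def[abs_def] decseq_def by (auto intro!: le_imp_inverse_le)

text \<open>Slices bounded by the heat kernel concentrate at the pole, so that only their mass matters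
  after propagation.\<close>

lemma slice_prop_tau:
  fixes f :: "'a::euclidean_space \<times> real \<Rightarrow> ennreal"
  assumes [measurable]: "f \<in> borel_measurable borel" and f: "\<And>q. f q \<le> hk_at y q"
    and p: "0 < snd p" and lim: "(\<lambda>n. slice_prop f (tau n) p) \<longlonglongrightarrow> h"
  shows "(\<lambda>n. (\<integral>\<^sup>+ z. f (z, tau n) \<partial>lborel) * hk_at y p) \<longlonglongrightarrow> h"
proof -
  obtain x t where xt: "p = (x, t)" by (cases p)
  have t: "0 < t" using p by (simp add: xt)
  define g where "g q = enn2real (f q)" for q
  have [measurable]: "g \<in> borel_measurable borel" unfolding g_def[abs_def] by measurable
  have fg: "f q = ennreal (g q)" "0 \<le> g q" for q
    using f[of q] hk_less_top(1)[of "q - (y, 0)"] by (auto simp: g_def le_less_trans)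
  have g_le: "g q \<le> hkr (q - (y, 0))" for q
    using f[of q] by (simp add: fg hk_eq_hkr)
  \<comment> \<open>From this index on the elapsed time \<open>t - s n\<close> exceeds
    \<open>t / 2\<close>, so the propagating kernel is bounded by \<open>B\<close>, its value at the
    origin at time \<open>t / 2\<close>.\<close>
  obtain N where N: "\<And>n. N \<le> n \<Longrightarrow> tau n < t / 2"
    using order_tendstoD(2)[OF tau_tendsto, of "t / 2"] t by (auto simp: eventually_sequentially)
  define s where "s n = tau (n + N)" for n
  have s: "0 < s n" "s n < t / 2" for n using N by (auto simp: s_def)
  have s_lim: "s \<longlonglongrightarrow> 0" unfolding s_def by (rule LIMSEQ_ignore_initial_segment[OF tau_tendsto])
  define F where "F n z = \<bar>heat (x - y - z) (t - s n) - heat (x - y) t\<bar>" for n z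
  define B where "B = (2 * pi * t) powr (- (real DIM('a) / 2))"
  have hB: "heat z r \<le> B" if "t / 2 \<le> r" for z :: 'a and r
  proof -
    have "heat z r \<le> (4 * pi * r) powr (- (real DIM('a) / 2)) * 1"
      unfolding heat_def using that t by (intro mult_left_mono) auto
    also have "\<dots> \<le> B" unfolding B_def using that t by (simp, intro powr_mono2') auto
    finally show ?thesis .
  qed
  have conc: "(\<lambda>n. \<integral>z. heat z (s n) * F n z \<partial>lborel) \<longlonglongrightarrow> 0"
  proof (rule heat_concentrates[where B="2 * B"])
    show "\<bar>F n z\<bar> \<le> 2 * B" for n z
    proof -
      have "heat (x - y - z) (t - s n) \<le> B" "heat (x - y) t \<le> B" using s[of n] t by (auto intro!: hB)
      then show ?thesis
        unfolding F_def using heat_nonneg[of "x - y - z" "t - s n"] heat_nonneg[of "x - y" t] by linarith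
    qed
    fix v :: 'a
    have "(\<lambda>n. F n (sqrt (s n) *\<^sub>R v)) \<longlonglongrightarrow> \<bar>heat (x - y - sqrt 0 *\<^sub>R v) (t - 0) - heat (x - y) t\<bar>"
      unfolding F_def using t by (intro tendsto_intros tendsto_heat s_lim) auto
    then show "(\<lambda>n. F n (sqrt (s n) *\<^sub>R v)) \<longlonglongrightarrow> 0" by simp
  qed (use s in \<open>auto simp: F_def[abs_def]\<close>)
  have gi: "integrable lborel (\<lambda>z. g (z, r))" if "0 < r" for r
  proof (rule Bochner_Integration.integrable_bound)
    have "integrable lborel (\<lambda>z::'a. heat (z + - y) r)"
      by (rule integrable_lborel_shift[OF integrable_heat[OF that]])
    then show "integrable lborel (\<lambda>z. heat (z - y) r)" by simp
    show "AE z in lborel. norm (g (z, r)) \<le> norm (heat (z - y) r)"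
    proof (rule AE_I2)
      fix z
      show "norm (g (z, r)) \<le> norm (heat (z - y) r)"
        using g_le[of "(z, r)"] fg(2)[of "(z, r)"] that by (simp add: hkr_def)
    qed
  qed measurable
  have gi2: "integrable lborel (\<lambda>z. heat (x - z) (t - s n) * g (z, s n))" for n
  proof (rule Bochner_Integration.integrable_bound)
    show "integrable lborel (\<lambda>z. B * g (z, s n))" using gi[OF s(1)] by simp
    show "AE z in lborel. norm (heat (x - z) (t - s n) * g (z, s n)) \<le> norm (B * g (z, s n))"
    proof (rule AE_I2)
      fix z
      have "heat (x - z) (t - s n) \<le> B" using s[of n] by (auto intro!: hB)
      then show "norm (heat (x - z) (t - s n) * g (z, s n)) \<le> norm (B * g (z, s n))"
        using fg(2)[of "(z, s n)"] by (simp add: abs_mult mult_right_mono)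
    qed
  qed measurable
  define a where "a n = (\<integral>z. heat (x - z) (t - s n) * g (z, s n) \<partial>lborel)" for n
  define m where "m n = (\<integral>z. g (z, s n) \<partial>lborel)" for n
  have a: "slice_prop f (s n) p = ennreal (a n)" "0 \<le> a n" for n
  proof -
    have "slice_prop f (s n) p = (\<integral>\<^sup>+ z. ennreal (heat (x - z) (t - s n) * g (z, s n)) \<partial>lborel)"
      using s[of n] by (simp add: slice_prop_def xt hk_def fg ennreal_mult')
    also have "\<dots> = ennreal (a n)"
      unfolding a_def by (rule nn_integral_eq_integral[OF gi2]) (simp add: fg)
    finally show "slice_prop f (s n) p = ennreal (a n)" .
    show "0 \<le> a n" unfolding a_def by (intro Bochner_Integration.integral_nonneg) (simp add: fg)
  qed
  have m: "(\<integral>\<^sup>+ z. f (z, s n) \<partial>lborel) = ennreal (m n)" "0 \<le> m n" for n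
  proof -
    show "(\<integral>\<^sup>+ z. f (z, s n) \<partial>lborel) = ennreal (m n)"
      unfolding m_def fg(1) by (rule nn_integral_eq_integral[OF gi[OF s(1)]]) (simp add: fg)
    show "0 \<le> m n" unfolding m_def by (intro Bochner_Integration.integral_nonneg) (simp add: fg)
  qed
  \<comment> \<open>Only the bound of the slice by the heat kernel enters: replacing the propagating
    kernel by its value at the pole costs at most a heat average of the oscillation
    \<open>F n\<close>, which tends to \<open>0\<close> at the point of concentration.\<close>
  have diff: "\<bar>a n - m n * heat (x - y) t\<bar> \<le> (\<integral>z. heat z (s n) * F n z \<partial>lborel)" for n
  proof -
    have iF: "integrable lborel (\<lambda>z. heat z (s n) * F n z)"
    proof (rule Bochner_Integration.integrable_bound)
      show "integrable lborel (\<lambda>z::'a. heat z (s n) * (2 * B))"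
        by (intro integrable_mult_left integrable_heat s)
      show "AE z in lborel. norm (heat z (s n) * F n z) \<le> norm (heat z (s n) * (2 * B))"
      proof (rule AE_I2)
        fix z
        have "heat (x - y - z) (t - s n) \<le> B" "heat (x - y) t \<le> B" using s[of n] t by (auto intro!: hB)
        then have "\<bar>F n z\<bar> \<le> \<bar>2 * B\<bar>"
          unfolding F_def using heat_nonneg[of "x - y - z" "t - s n"] heat_nonneg[of "x - y" t] by linarith
        then show "norm (heat z (s n) * F n z) \<le> norm (heat z (s n) * (2 * B))"
          by (simp add: abs_mult mult_left_mono)
      qed
    qed (auto simp: F_def)
    have "a n - m n * heat (x - y) t
       = (\<integral>z. heat (x - z) (t - s n) * g (z, s n) - g (z, s n) * heat (x - y) t \<partial>lborel)"
      unfolding a_def m_def using gi2[of n] gi[OF s(1)] by simp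
    then have "\<bar>a n - m n * heat (x - y) t\<bar>
       = \<bar>\<integral>z. heat (x - z) (t - s n) * g (z, s n) - g (z, s n) * heat (x - y) t \<partial>lborel\<bar>" by simp
    also have "\<dots> \<le> (\<integral>z. heat (z + - y) (s n) * F n (z + - y) \<partial>lborel)"
    proof (rule integral_abs_bound_integral)
      show "integrable lborel (\<lambda>z. heat (x - z) (t - s n) * g (z, s n) - g (z, s n) * heat (x - y) t)"
        using gi2[of n] gi[OF s(1)] by simp
      show "integrable lborel (\<lambda>z. heat (z + - y) (s n) * F n (z + - y))"
        by (rule integrable_lborel_shift[OF iF])
      fix z
      have "\<bar>heat (x - z) (t - s n) * g (z, s n) - g (z, s n) * heat (x - y) t\<bar> = g (z, s n) * F n (z + - y)"
        using fg(2)[of "(z, s n)"] by (simp add: F_def mult.commute[of "heat (x - z) (t - s n)"] flip: right_diff_distrib)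
           (simp add: abs_mult)
      also have "\<dots> \<le> heat (z + - y) (s n) * F n (z + - y)"
        using g_le[of "(z, s n)"] s[of n] by (intro mult_right_mono) (auto simp: F_def hkr_def)
      finally show "\<bar>heat (x - z) (t - s n) * g (z, s n) - g (z, s n) * heat (x - y) t\<bar> \<le> heat (z + - y) (s n) * F n (z + - y)" .
    qed
    also have "\<dots> = (\<integral>z. heat z (s n) * F n z \<partial>lborel)"
      by (rule integral_lborel_shift[of "\<lambda>z. heat z (s n) * F n z"]) (auto simp: F_def)
    finally show ?thesis .
  qed
  have lim_s: "(\<lambda>n. slice_prop f (s n) p) \<longlonglongrightarrow> h"
    unfolding s_def using LIMSEQ_ignore_initial_segment[OF lim, of N] .
  have "slice_prop f (s n) p \<le> hk_at y p" for n
  proof -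
    have "slice_prop f (s n) p \<le> slice_prop (hk_at y) (s n) p"
      unfolding slice_prop_def by (intro nn_integral_mono mult_left_mono f) simp
    also have "\<dots> = hk_at y p"
      using s[of n] by (intro slice_prop_hk_at) (auto simp: xt)
    finally show ?thesis .
  qed
  then have "h \<le> hk_at y p"
    by (intro LIMSEQ_le_const2[OF lim_s]) auto
  then have h_fin: "h < \<top>" using hk_less_top(1) by (rule le_less_trans)
  then obtain H where H: "h = ennreal H" "0 \<le> H" by (cases h) auto
  have "(\<lambda>n. a n) \<longlonglongrightarrow> H"
    using lim_s unfolding a(1) H(1) by (subst (asm) tendsto_ennreal_iff) (auto simp: a H)
  moreover have "(\<lambda>n. a n - m n * heat (x - y) t) \<longlonglongrightarrow> 0"
    by (rule Lim_null_comparison[OF _ conc]) (use diff in auto)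
  ultimately have "(\<lambda>n. a n - (a n - m n * heat (x - y) t)) \<longlonglongrightarrow> H - 0"
    by (rule tendsto_diff)
  then have "(\<lambda>n. ennreal (m n * heat (x - y) t)) \<longlonglongrightarrow> ennreal H"
    by (intro tendsto_ennrealI) simp
  moreover have "ennreal (m n * heat (x - y) t) = (\<integral>\<^sup>+ z. f (z, s n) \<partial>lborel) * hk_at y p" for n
    using m[of n] t by (simp add: xt hk_def ennreal_mult')
  ultimately have "(\<lambda>n. (\<integral>\<^sup>+ z. f (z, s n) \<partial>lborel) * hk_at y p) \<longlonglongrightarrow> h"
    by (simp add: H)
  then show ?thesis
    unfolding s_def by (rule LIMSEQ_offset)
qed

section \<open>The limit of the kernels of truncated potentials\<close>

locale singular_potential =
  fixes V :: "'a::euclidean_space \<times> real \<Rightarrow> real" and T C1 :: real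
  assumes V_measurable [measurable]: "V \<in> borel_measurable borel"
    and V_nonneg: "\<And>p. 0 \<le> V p"
    and V_le: "\<And>p. p \<in> QT T \<Longrightarrow> V p \<le> C1 / snd p"
    and V_out: "\<And>p. p \<notin> QT T \<Longrightarrow> V p = 0"
    and T_pos: "0 < T" and C1_pos: "0 < C1"
begin

definition Vk :: "nat \<Rightarrow> 'a \<times> real \<Rightarrow> real" where "Vk n p = min (V p) (real n)"

lemma Vk_nonneg: "0 \<le> Vk n p" and Vk_le_V: "Vk n p \<le> V p" and Vk_mono: "Vk n p \<le> Vk (Suc n) p"
  using V_nonneg[of p] by (auto simp: Vk_def)

lemma measurable_Vk [measurable]: "Vk n \<in> borel_measurable borel"
  unfolding Vk_def[abs_def] by measurable

text \<open>The constant is \<open>n + 1\<close> because the bound of a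
  \<open>bounded_potential\<close> has to be positive, also for \<open>n = 0\<close>.\<close>

sublocale bp: bounded_potential "Vk n" "real n + 1" for n
  by unfold_locales (auto simp: V_nonneg Vk_def)

text \<open>\<open>wV y (x, t)\<close> is the paper's \<open>H\<^sub>V(x, y, t)\<close>.\<close>

definition w :: "nat \<Rightarrow> 'a \<Rightarrow> 'a \<times> real \<Rightarrow> ennreal" where "w n = kern (Vk n) (real n + 1)"

definition wV :: "'a \<Rightarrow> 'a \<times> real \<Rightarrow> ennreal" where "wV y p = (INF n. w n y p)"

lemma measurable_w [measurable]: "w n y \<in> borel_measurable borel"
  unfolding w_def by (rule bp.measurable_kern')

lemma measurable_wV [measurable]: "wV y \<in> borel_measurable borel"
  unfolding wV_def[abs_def] by measurable

lemma measurable_wV_pair: "case_prod wV \<in> borel_measurable (borel \<Otimes>\<^sub>M borel)"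
proof -
  have "(\<lambda>z. INF n. case_prod (w n) z) \<in> borel_measurable (borel \<Otimes>\<^sub>M borel)"
    unfolding w_def by (intro borel_measurable_INF bp.measurable_kern) auto
  then show ?thesis by (simp add: wV_def[abs_def] case_prod_beta')
qed

lemma w_le: "w n y p \<le> hk_at y p"
  unfolding w_def by (rule bp.kern_le)

lemma w_duhamel: "w n y p + conv hk (\<lambda>q. ennreal (Vk n q) * w n y q) p = hk_at y p"
  unfolding w_def by (rule bp.kern_duhamel)

lemma wV_le_w: "wV y p \<le> w n y p"
  unfolding wV_def by (rule INF_lower) simp

lemma wV_le: "wV y p \<le> hk_at y p"
  using wV_le_w w_le order_trans by blast

text \<open>The next kernel solves the equation of the present one with the increment of the
  truncation as additional absorption.\<close>

lemma w_Suc_le: "w (Suc n) y p \<le> w n y p"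
proof -
  have "w (Suc n) y p \<le> 1 * kern (Vk n) (real n + 1) y p"
  proof (rule bp.comparison[where f="\<lambda>q. ennreal (Vk (Suc n) q - Vk n q) * w (Suc n) y q"])
    fix p
    have s: "ennreal (Vk n q) * a + ennreal (Vk (Suc n) q - Vk n q) * a = ennreal (Vk (Suc n) q) * a" for q a
      using Vk_nonneg[of n q] Vk_mono[of n q]
      by (simp add: distrib_right[symmetric] ennreal_plus[symmetric] del: ennreal_plus)
    show "w (Suc n) y p + conv hk (\<lambda>q. ennreal (Vk n q) * w (Suc n) y q) p
       + conv hk (\<lambda>q. ennreal (Vk (Suc n) q - Vk n q) * w (Suc n) y q) p = 1 * hk_at y p"
      unfolding add.assoc by (subst conv_add[symmetric]) (auto simp: s w_duhamel)
  qed (auto simp: w_le)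
  then show ?thesis by (simp add: w_def)
qed

lemma decseq_w: "decseq (\<lambda>n. w n y p)"
  by (rule decseq_SucI) (rule w_Suc_le)

lemma w_tendsto: "(\<lambda>n. w n y p) \<longlonglongrightarrow> wV y p"
  unfolding wV_def by (rule LIMSEQ_INF[OF decseq_w])

lemma Vk_eq: "real n \<ge> V p \<Longrightarrow> Vk n p = V p"
  by (simp add: Vk_def)

lemma Vw_tendsto: "(\<lambda>n. ennreal (Vk n q) * w n y q) \<longlonglongrightarrow> ennreal (V q) * wV y q"
proof (rule tendsto_mult_ennreal[OF _ w_tendsto])
  obtain N :: nat where "V q \<le> real N" using real_arch_simple by blast
  then have "\<And>n. N \<le> n \<Longrightarrow> Vk n q = V q"
    by (intro Vk_eq) (simp add: order_trans)
  then have "\<forall>\<^sub>F n in sequentially. Vk n q = V q"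
    by (auto simp: eventually_sequentially)
  then show "(\<lambda>n. ennreal (Vk n q)) \<longlonglongrightarrow> ennreal (V q)"
    by (intro tendsto_ennrealI tendsto_eventually)
qed (use wV_le[of y q] in \<open>auto simp: top_unique\<close>)

lemma V_le_tau: "0 < \<tau> \<Longrightarrow> \<tau> \<le> snd q \<Longrightarrow> V q \<le> C1 / \<tau>"
proof (cases "q \<in> QT T")
  case True
  assume "0 < \<tau>" "\<tau> \<le> snd q"
  then have "C1 / snd q \<le> C1 / \<tau>" using C1_pos by (intro divide_left_mono) auto
  with V_le[OF True] show ?thesis by simp
qed (use C1_pos in \<open>simp add: V_out\<close>)

text \<open>The Duhamel equation at \<open>p\<close> is compared with the one on the slice,
  propagated to \<open>p\<close>. The contributions from before \<open>\<tau>\<close> are the same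
  in both; they are finite and cancel.\<close>

lemma propagate_k:
  assumes \<tau>: "0 < \<tau>" "\<tau> < snd p"
  shows "w n y p + conv hk (\<lambda>q. ennreal (Vk n q) * w n y q * indicator {\<tau>..} (snd q)) p = slice_prop (w n y) \<tau> p"
proof -
  let ?g = "\<lambda>q. ennreal (Vk n q) * w n y q"
  let ?A = "conv hk (\<lambda>q. ?g q * indicator {..<\<tau>} (snd q)) p"
  have A: "?A = slice_prop (conv hk ?g) \<tau> p"
    by (rule slice_prop_conv[symmetric]) (use \<tau> in auto)
  have fin: "?A < \<top>"
  proof -
    have "?A \<le> conv hk ?g p" by (intro conv_mono) (auto split: split_indicator)
    also have "\<dots> \<le> hk_at y p" unfolding w_duhamel[of n y p, symmetric] by simp
    also have "\<dots> < \<top>" by simp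
    finally show ?thesis .
  qed
  have "conv hk ?g p = conv hk (\<lambda>q. ?g q * indicator {..<\<tau>} (snd q) + ?g q * indicator {\<tau>..} (snd q)) p"
    by (intro arg_cong[where f="\<lambda>f. conv hk f p"]) (auto simp: fun_eq_iff split: split_indicator)
  also have "\<dots> = ?A + conv hk (\<lambda>q. ?g q * indicator {\<tau>..} (snd q)) p"
    by (rule conv_add) measurable
  finally have "?A + (w n y p + conv hk (\<lambda>q. ?g q * indicator {\<tau>..} (snd q)) p) = hk_at y p"
    using w_duhamel[of n y p] by (simp add: ac_simps)
  also have "\<dots> = slice_prop (hk_at y) \<tau> p"
    by (rule slice_prop_hk_at[OF \<tau>, symmetric])
  also have "\<dots> = slice_prop (w n y) \<tau> p + slice_prop (conv hk ?g) \<tau> p"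
    unfolding slice_prop_def w_duhamel[of n y, symmetric] distrib_left
    by (rule nn_integral_add) measurable
  finally have "?A + (w n y p + conv hk (\<lambda>q. ?g q * indicator {\<tau>..} (snd q)) p) = ?A + slice_prop (w n y) \<tau> p"
    by (simp add: A add.commute)
  then show ?thesis
    using fin by (auto simp only: ennreal_add_left_cancel infinity_ennreal_def less_irrefl)
qed

text \<open>After time \<open>\<tau>\<close> the products are dominated by
  \<open>C1 / \<tau>\<close> times the heat kernel, whose heat potential is finite. Near time
  \<open>0\<close> there is no such majorant, which is why the limit is taken in the restarted
  equation.\<close>

lemma propagate:
  assumes \<tau>: "0 < \<tau>" "\<tau> < snd p"
  shows "wV y p + conv hk (\<lambda>q. ennreal (V q) * wV y q * indicator {\<tau>..} (snd q)) p = slice_prop (wV y) \<tau> p"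
proof -
  let ?L = "\<lambda>n. conv hk (\<lambda>q. ennreal (Vk n q) * w n y q * indicator {\<tau>..} (snd q)) p"
  have "(\<lambda>n. ?L n) \<longlonglongrightarrow> conv hk (\<lambda>q. ennreal (V q) * wV y q * indicator {\<tau>..} (snd q)) p"
    unfolding conv_def
  proof (rule nn_integral_dominated_convergence[where w="\<lambda>q. hk (p - q) * (ennreal (C1 / \<tau>) * hk_at y q)"])
    show "AE q in lborel. hk (p - q) * (ennreal (Vk n q) * w n y q * indicator {\<tau>..} (snd q)) \<le> hk (p - q) * (ennreal (C1 / \<tau>) * hk_at y q)" for n
    proof (rule AE_I2)
      fix q
      show "hk (p - q) * (ennreal (Vk n q) * w n y q * indicator {\<tau>..} (snd q)) \<le> hk (p - q) * (ennreal (C1 / \<tau>) * hk_at y q)"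
      proof (cases "\<tau> \<le> snd q")
        case True
        then have "ennreal (Vk n q) \<le> ennreal (C1 / \<tau>)"
          using V_le_tau[OF \<tau>(1) True] Vk_le_V[of n q] by (intro ennreal_leI) simp
        then show ?thesis using True w_le[of n y q] by (auto intro!: mult_left_mono mult_mono)
      qed simp
    qed
    have "(\<integral>\<^sup>+ q. hk (p - q) * (ennreal (C1 / \<tau>) * hk_at y q) \<partial>lborel) = conv hk (\<lambda>q. ennreal (C1 / \<tau>) * hk_at y q) p"
      by (simp add: conv_def)
    also have "\<dots> < \<infinity>" unfolding infinity_ennreal_def by (rule conv_hk_finite[of _ "C1 / \<tau>" y]) simp
    finally show "(\<integral>\<^sup>+ q. hk (p - q) * (ennreal (C1 / \<tau>) * hk_at y q) \<partial>lborel) < \<infinity>" .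
    show "AE q in lborel. (\<lambda>n. hk (p - q) * (ennreal (Vk n q) * w n y q * indicator {\<tau>..} (snd q)))
      \<longlonglongrightarrow> hk (p - q) * (ennreal (V q) * wV y q * indicator {\<tau>..} (snd q))"
    proof (rule AE_I2)
      fix q
      have "wV y q \<noteq> \<top>" using wV_le[of y q] by (auto simp: top_unique)
      then show "(\<lambda>n. hk (p - q) * (ennreal (Vk n q) * w n y q * indicator {\<tau>..} (snd q)))
        \<longlonglongrightarrow> hk (p - q) * (ennreal (V q) * wV y q * indicator {\<tau>..} (snd q))"
        by (cases "\<tau> \<le> snd q")
          (auto intro!: tendsto_mult_ennreal tendsto_const Vw_tendsto simp: ennreal_mult_eq_top_iff)
    qed
  qed measurable
  then have 1: "(\<lambda>n. w n y p + ?L n) \<longlonglongrightarrow> wV y p + conv hk (\<lambda>q. ennreal (V q) * wV y q * indicator {\<tau>..} (snd q)) p"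
    by (intro tendsto_add w_tendsto)
  have "(\<lambda>n. slice_prop (w n y) \<tau> p) \<longlonglongrightarrow> slice_prop (wV y) \<tau> p"
    unfolding slice_prop_def
  proof (rule nn_integral_dominated_convergence[where w="\<lambda>z. hk (fst p - z, snd p - \<tau>) * hk_at y (z, \<tau>)"])
    show "AE z in lborel. hk (fst p - z, snd p - \<tau>) * w n y (z, \<tau>) \<le> hk (fst p - z, snd p - \<tau>) * hk_at y (z, \<tau>)" for n
      by (intro AE_I2 mult_left_mono w_le) simp
    show "(\<integral>\<^sup>+ z. hk (fst p - z, snd p - \<tau>) * hk_at y (z, \<tau>) \<partial>lborel) < \<infinity>"
      using slice_prop_hk_at[OF \<tau>, of y] by (simp add: slice_prop_def)
    show "AE z in lborel. (\<lambda>n. hk (fst p - z, snd p - \<tau>) * w n y (z, \<tau>)) \<longlonglongrightarrow> hk (fst p - z, snd p - \<tau>) * wV y (z, \<tau>)"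
    proof (rule AE_I2)
      fix z
      have "wV y (z, \<tau>) \<noteq> \<top>" using wV_le[of y "(z, \<tau>)"] by (auto simp: top_unique)
      then show "(\<lambda>n. hk (fst p - z, snd p - \<tau>) * w n y (z, \<tau>)) \<longlonglongrightarrow> hk (fst p - z, snd p - \<tau>) * wV y (z, \<tau>)"
        by (intro tendsto_mult_ennreal tendsto_const w_tendsto) auto
    qed
  qed measurable
  then have "(\<lambda>n. w n y p + ?L n) \<longlonglongrightarrow> slice_prop (wV y) \<tau> p"
    by (simp add: propagate_k[OF \<tau>])
  with 1 show ?thesis by (rule LIMSEQ_unique)
qed

text \<open>The caloric function that determines the reduced measure of the Dirac measure at \<open>y\<close>, which is
  \<open>trace_weight y\<close> times that Dirac measure.\<close>

definition hV :: "'a \<Rightarrow> 'a \<times> real \<Rightarrow> ennreal" where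
  "hV y p = wV y p + conv hk (\<lambda>q. ennreal (V q) * wV y q) p"

text \<open>As the restart time decreases, the restarted Duhamel integrals increase to the full one,
  since \<open>V\<close> vanishes at nonpositive times.\<close>

lemma slice_tendsto:
  assumes p: "0 < snd p"
  shows "(\<lambda>n. slice_prop (wV y) (tau n) p) \<longlonglongrightarrow> hV y p"
proof -
  have tau_le: "tau n \<le> tau m" if "m \<le> n" for m n
    using tau_decseq that by (auto simp: decseq_def)
  have inc: "incseq (\<lambda>n. ennreal (V q) * wV y q * indicator {tau n..} (snd q))" for q
    unfolding incseq_def by (auto intro!: mult_left_mono split: split_indicator dest!: tau_le)
  have "(\<lambda>n. conv hk (\<lambda>q. ennreal (V q) * wV y q * indicator {tau n..} (snd q)) p)
     \<longlonglongrightarrow> (SUP n. conv hk (\<lambda>q. ennreal (V q) * wV y q * indicator {tau n..} (snd q)) p)"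
    using inc by (intro LIMSEQ_SUP) (auto simp: incseq_def intro!: conv_mono)
  also have "(SUP n. conv hk (\<lambda>q. ennreal (V q) * wV y q * indicator {tau n..} (snd q)) p)
     = conv hk (\<lambda>q. SUP n. ennreal (V q) * wV y q * indicator {tau n..} (snd q)) p"
    by (intro conv_SUP[symmetric] inc) auto
  also have "(\<lambda>q. SUP n. ennreal (V q) * wV y q * indicator {tau n..} (snd q)) = (\<lambda>q. ennreal (V q) * wV y q)"
  proof
    fix q
    have "(\<lambda>n. ennreal (V q) * wV y q * indicator {tau n..} (snd q)) \<longlonglongrightarrow> ennreal (V q) * wV y q"
    proof (cases "0 < snd q")
      case True
      have "\<forall>\<^sub>F n in sequentially. ennreal (V q) * wV y q * indicator {tau n..} (snd q) = ennreal (V q) * wV y q"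
        using order_tendstoD(2)[OF tau_tendsto True] by eventually_elim simp
      then show ?thesis by (rule tendsto_eventually)
    next
      case False
      then show ?thesis by (simp add: V_out mem_QT)
    qed
    with LIMSEQ_SUP[OF inc[of q]] show "(SUP n. ennreal (V q) * wV y q * indicator {tau n..} (snd q)) = ennreal (V q) * wV y q"
      by (rule LIMSEQ_unique)
  qed
  finally have 1: "(\<lambda>n. wV y p + conv hk (\<lambda>q. ennreal (V q) * wV y q * indicator {tau n..} (snd q)) p) \<longlonglongrightarrow> hV y p"
    unfolding hV_def by (intro tendsto_add tendsto_const)
  have "\<forall>\<^sub>F n in sequentially. wV y p + conv hk (\<lambda>q. ennreal (V q) * wV y q * indicator {tau n..} (snd q)) p = slice_prop (wV y) (tau n) p"
    using order_tendstoD(2)[OF tau_tendsto p] by eventually_elim (simp add: propagate)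
  with 1 show ?thesis by (rule Lim_transform_eventually)
qed

section \<open>Initial mass and its zero-one law\<close>

definition mass :: "'a \<Rightarrow> real \<Rightarrow> ennreal" where
  "mass y t = (\<integral>\<^sup>+ z. wV y (z, t) \<partial>lborel)"

text \<open>A value of \<open>hV\<close> is used instead of a limit of masses: the limit then comes
  with its existence, and the weight is measurable in \<open>y\<close>. As \<open>hV y\<close> turns
  out to be a multiple of the heat kernel, every point at positive time gives the same
  factor.\<close>

definition trace_weight :: "'a \<Rightarrow> ennreal" where
  "trace_weight y = hV y (y, 1) / ennreal (heat (0::'a) 1)"

lemma mass_mult_tendsto: "0 < snd p \<Longrightarrow> (\<lambda>n. mass y (tau n) * hk_at y p) \<longlonglongrightarrow> hV y p"
  unfolding mass_def by (rule slice_prop_tau[OF measurable_wV wV_le _ slice_tendsto])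

lemma mass_tendsto: "(\<lambda>n. mass y (tau n)) \<longlonglongrightarrow> trace_weight y"
proof -
  let ?h = "ennreal (heat (0::'a) 1)"
  have h: "?h \<noteq> 0" "?h \<noteq> \<top>" using heat_pos[of 1 "0::'a"] by (auto simp: ennreal_eq_0_iff not_le)
  have "(\<lambda>n. mass y (tau n) * ?h / ?h) \<longlonglongrightarrow> trace_weight y"
    unfolding trace_weight_def divide_ennreal_def using mass_mult_tendsto[of "(y, 1)" y] h
    by (intro tendsto_mult_ennreal tendsto_const) (auto simp: hk_def ennreal_inverse_eq_top_iff)
  moreover have "a * ?h / ?h = a" for a
    using h by (simp add: ennreal_mult_divide_eq)
  ultimately show ?thesis by simp
qed

lemma mass_le_1: "0 < t \<Longrightarrow> mass y t \<le> 1"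
proof -
  assume t: "0 < t"
  have "mass y t \<le> (\<integral>\<^sup>+ z. ennreal (heat (z - y) t) \<partial>lborel)"
    unfolding mass_def using wV_le[of y "(_, t)"] t by (intro nn_integral_mono) (simp add: hk_def)
  also have "\<dots> = 1"
    using t nn_integral_lborel_shift_minus[of "\<lambda>z. ennreal (heat z t)" y] by (simp add: nn_integral_heat)
  finally show ?thesis .
qed

lemma trace_weight_le_1: "trace_weight y \<le> 1"
  by (rule LIMSEQ_le_const2[OF mass_tendsto]) (auto intro!: mass_le_1)

lemma hV_eq: "hV y p = trace_weight y * hk_at y p"
proof (cases "0 < snd p")
  case True
  have "(\<lambda>n. mass y (tau n) * hk_at y p) \<longlonglongrightarrow> trace_weight y * hk_at y p"
    using trace_weight_le_1[of y] by (intro tendsto_mult_ennreal mass_tendsto tendsto_const) (auto simp: top_unique)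
  with mass_mult_tendsto[OF True] show ?thesis by (rule LIMSEQ_unique)
next
  case False
  have "wV y p = 0" using wV_le[of y p] False by simp
  moreover have "conv hk (\<lambda>q. ennreal (V q) * wV y q) p = 0"
    unfolding conv_def
  proof (intro nn_integral_zero' AE_I2)
    fix q
    have "wV y q = 0" if "snd q \<le> 0" using wV_le[of y q] that by simp
    then show "hk (p - q) * (ennreal (V q) * wV y q) = 0"
      using False by (cases "snd q \<le> 0") auto
  qed
  ultimately show ?thesis using False by (simp add: hV_def)
qed

text \<open>The equation for \<open>wV\<close> has initial mass \<open>trace_weight y\<close>, and
  relative to a truncation the rest \<open>V - Vk n\<close> acts as additional absorption.
  Comparison with \<open>w n\<close> and the limit in \<open>n\<close> bound \<open>wV\<close> by a
  multiple of itself; with a weight at most \<open>1\<close> this leaves only \<open>0\<close> and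
  \<open>1\<close>.\<close>

lemma wV_le_trace_weight_wV: "wV y p \<le> trace_weight y * wV y p"
proof -
  have le: "wV y p \<le> trace_weight y * w n y p" for n
    unfolding w_def
  proof (rule bp.comparison[where f="\<lambda>q. ennreal (V q - Vk n q) * wV y q"])
    fix p
    have s: "ennreal (Vk n q) * a + ennreal (V q - Vk n q) * a = ennreal (V q) * a" for q a
      using Vk_nonneg[of n q] Vk_le_V[of n q]
      by (simp add: distrib_right[symmetric] ennreal_plus[symmetric] del: ennreal_plus)
    show "wV y p + conv hk (\<lambda>q. ennreal (Vk n q) * wV y q) p
       + conv hk (\<lambda>q. ennreal (V q - Vk n q) * wV y q) p = trace_weight y * hk_at y p"
      unfolding add.assoc hV_eq[symmetric] hV_def by (subst conv_add[symmetric]) (auto simp: s)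
  next
    show "trace_weight y < \<top>" using trace_weight_le_1[of y] by (rule le_less_trans) simp
  qed (auto simp: wV_le)
  have fin: "wV y p \<noteq> \<top>" "trace_weight y \<noteq> \<top>" using wV_le[of y p] trace_weight_le_1[of y] by (auto simp: top_unique)
  have "(\<lambda>n. trace_weight y * w n y p) \<longlonglongrightarrow> trace_weight y * wV y p"
    using fin by (intro tendsto_mult_ennreal w_tendsto tendsto_const) auto
  then show ?thesis by (rule LIMSEQ_le_const) (use le in auto)
qed

lemma trace_weight_cases: "trace_weight y = (if \<forall>p. wV y p = 0 then 0 else 1)"
proof (cases "\<forall>p. wV y p = 0")
  case True
  then have "wV y = (\<lambda>q. 0)" by auto
  then have "hV y (y, 1) = 0" by (simp add: hV_def conv_def)
  then show ?thesis using True by (simp add: trace_weight_def)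
next
  case False
  then obtain p where p: "wV y p \<noteq> 0" by blast
  have fin: "wV y p \<noteq> \<top>" using wV_le[of y p] by (auto simp: top_unique)
  have "1 \<le> trace_weight y"
  proof (rule ccontr)
    assume "\<not> 1 \<le> trace_weight y"
    then have "wV y p * trace_weight y < wV y p * 1"
      using p fin by (intro ennreal_mult_strict_left_mono) (auto simp: top.not_eq_extremum zero_less_iff_neq_zero)
    with wV_le_trace_weight_wV[of y p] show False by (simp add: mult.commute)
  qed
  with trace_weight_le_1[of y] False show ?thesis by (simp add: antisym)
qed

text \<open>The singular set looks only at the strip, the weight at all times. Since
  \<open>V\<close> vanishes off the strip, vanishing of \<open>wV\<close> on it makes
  \<open>hV\<close> vanish at \<open>(y, T)\<close>, where the heat kernel is positive.\<close>

lemma trace_weight_zero_iff: "trace_weight y = 0 \<longleftrightarrow> (\<forall>p\<in>QT T. wV y p = 0)"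
proof
  assume Q: "\<forall>p\<in>QT T. wV y p = 0"
  have z: "ennreal (V q) * wV y q = 0" for q
    using Q V_out[of q] by (cases "q \<in> QT T") auto
  have "hV y (y, T) = 0"
    unfolding hV_def conv_def z using Q T_pos by (simp add: mem_QT)
  then show "trace_weight y = 0"
    unfolding hV_eq using T_pos hk_pos[of "(y, T) - (y, 0)"] by auto
next
  assume "trace_weight y = 0"
  then show "\<forall>p\<in>QT T. wV y p = 0"
    by (auto simp: trace_weight_cases split: if_splits)
qed

lemma measurable_trace_weight [measurable]: "trace_weight \<in> borel_measurable borel"
proof -
  note [measurable] = measurable_wV_pair
  have [measurable]: "(\<lambda>y::'a. (y, 1::real)) \<in> borel_measurable borel" by simp
  have "(\<lambda>y. hV y (y, 1)) \<in> borel_measurable borel"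
    unfolding hV_def by measurable
  then show ?thesis unfolding trace_weight_def[abs_def] by measurable
qed

end

section \<open>Uniqueness of the initial trace\<close>

text \<open>Half of the Gaussian decay is split off at the price of doubling the time in the other
  half.\<close>

lemma heat_double_time:
  assumes "0 < t"
  shows "heat (x::'a::euclidean_space) t = 2 powr (real DIM('a) / 2) * heat x (2 * t) * exp (- (norm x)\<^sup>2 / (8 * t))"
proof -
  define a where "a = real DIM('a) / 2"
  have "(4 * pi * (2 * t)) powr (- a) = 2 powr (- a) * (4 * pi * t) powr (- a)"
    using assms by (subst powr_mult[symmetric]) (auto simp: mult_ac)
  then have "2 powr a * (4 * pi * (2 * t)) powr (- a) = (4 * pi * t) powr (- a)"
    by (simp add: mult.assoc[symmetric] powr_add[symmetric])
  moreover have "exp (- (norm x)\<^sup>2 / (4 * (2 * t))) * exp (- (norm x)\<^sup>2 / (8 * t)) = exp (- (norm x)\<^sup>2 / (4 * t))"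
    using assms by (simp add: exp_add[symmetric] field_simps)
  ultimately show ?thesis
    unfolding heat_def a_def[symmetric] by (metis mult.assoc)
qed

text \<open>The majorant is the weight of \<open>MT_nonneg\<close>. Far poles,
  \<open>|y| \<ge> 2 R\<close>, are at distance at least \<open>|y| / 2\<close> from the ball, and
  the decay split off, \<open>exp (- |y|^2 / (32 t))\<close>, lies below the weight as soon as
  \<open>t \<le> T / 8\<close>. At near poles the weight is at least
  \<open>exp (- R^2 / T)\<close>.\<close>

lemma heat_mean_bound:
  fixes f :: "'a::euclidean_space \<Rightarrow> ennreal"
  assumes [measurable]: "f \<in> borel_measurable borel" and f: "\<And>x. f x \<le> indicator (cball 0 R) x"
    and t: "0 < t" "t \<le> T / 8"
  shows "(\<integral>\<^sup>+ x. ennreal (heat (x - y) t) * f x \<partial>lborel)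
    \<le> ennreal (2 powr (real DIM('a) / 2) + exp (R\<^sup>2 / T)) * ennreal (exp (- (norm y)\<^sup>2 / (4 * T)))"
proof -
  have T: "0 < T" using t by simp
  have one: "(\<integral>\<^sup>+ x. ennreal (heat (x - y) s) \<partial>lborel) = 1" if "0 < s" for s
    using that nn_integral_lborel_shift_minus[of "\<lambda>z. ennreal (heat z s)" y] by (simp add: nn_integral_heat)
  show ?thesis
  proof (cases "2 * R \<le> norm y")
    case True
    let ?c = "2 powr (real DIM('a) / 2)" let ?e = "exp (- (norm y)\<^sup>2 / (4 * T))"
    have "(\<integral>\<^sup>+ x. ennreal (heat (x - y) t) * f x \<partial>lborel)
       \<le> (\<integral>\<^sup>+ x. ennreal (?c * ?e) * ennreal (heat (x - y) (2 * t)) \<partial>lborel)"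
    proof (rule nn_integral_mono)
      fix x
      show "ennreal (heat (x - y) t) * f x \<le> ennreal (?c * ?e) * ennreal (heat (x - y) (2 * t))"
      proof (cases "x \<in> cball 0 R")
        case x: True
        have "norm y \<le> norm (x - y) + norm x"
          using norm_triangle_ineq[of "y - x" x] by (simp add: norm_minus_commute)
        then have "norm y / 2 \<le> norm (x - y)" using x True by simp
        then have n: "(norm y)\<^sup>2 / 4 \<le> (norm (x - y))\<^sup>2"
          using power_mono[of "norm y / 2" "norm (x - y)" 2] by (simp add: power_divide)
        have "(norm y)\<^sup>2 / (4 * T) \<le> (norm y)\<^sup>2 / (32 * t)"
          using t T by (intro divide_left_mono) auto
        also have "\<dots> = ((norm y)\<^sup>2 / 4) / (8 * t)" by simp
        also have "\<dots> \<le> (norm (x - y))\<^sup>2 / (8 * t)"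
          using t n by (intro divide_right_mono) auto
        finally have "exp (- (norm (x - y))\<^sup>2 / (8 * t)) \<le> ?e" by simp
        then have "heat (x - y) t \<le> ?c * heat (x - y) (2 * t) * ?e"
          unfolding heat_double_time[OF t(1), of "x - y"] by (intro mult_left_mono) auto
        then have "ennreal (heat (x - y) t) \<le> ennreal (?c * ?e) * ennreal (heat (x - y) (2 * t))"
          by (simp add: ennreal_mult[symmetric] ennreal_leI mult_ac)
        moreover have "f x \<le> 1" using f[of x] x by simp
        ultimately show ?thesis
          using mult_mono[of "ennreal (heat (x - y) t)" _ "f x" 1] by simp
      next
        case False
        then show ?thesis using f[of x] by simp
      qed
    qed
    also have "\<dots> = ennreal (?c * ?e)"
      using t by (simp add: nn_integral_cmult one)
    also have "\<dots> \<le> ennreal (?c + exp (R\<^sup>2 / T)) * ennreal ?e"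
      by (simp add: ennreal_mult[symmetric] ennreal_leI distrib_right del: ennreal_plus)
    finally show ?thesis .
  next
    case False
    have "(norm y)\<^sup>2 \<le> (2 * R)\<^sup>2" using False by (intro power_mono) auto
    then have "(norm y)\<^sup>2 / (4 * T) \<le> R\<^sup>2 / T"
      using T by (simp add: field_simps power_mult_distrib)
    then have "1 \<le> exp (R\<^sup>2 / T) * exp (- (norm y)\<^sup>2 / (4 * T))"
      by (simp add: exp_add[symmetric])
    also have "\<dots> \<le> (2 powr (real DIM('a) / 2) + exp (R\<^sup>2 / T)) * exp (- (norm y)\<^sup>2 / (4 * T))"
      by (intro mult_right_mono) auto
    finally have "1 \<le> (2 powr (real DIM('a) / 2) + exp (R\<^sup>2 / T)) * exp (- (norm y)\<^sup>2 / (4 * T))" .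
    then have c: "1 \<le> ennreal (2 powr (real DIM('a) / 2) + exp (R\<^sup>2 / T)) * ennreal (exp (- (norm y)\<^sup>2 / (4 * T)))"
      by (metis ennreal_1 ennreal_leI ennreal_mult' add_nonneg_nonneg exp_ge_zero powr_ge_zero)
    have "(\<integral>\<^sup>+ x. ennreal (heat (x - y) t) * f x \<partial>lborel) \<le> (\<integral>\<^sup>+ x. ennreal (heat (x - y) t) * 1 \<partial>lborel)"
    proof (intro nn_integral_mono mult_left_mono)
      show "f x \<le> 1" for x using f[of x] by (rule order_trans) (simp split: split_indicator)
    qed simp
    also have "\<dots> = 1" using one[OF t(1)] by simp
    finally show ?thesis using c by (rule order_trans)
  qed
qed

lemma MT_nonneg_weight: "\<mu> \<in> MT_nonneg T \<Longrightarrow> (\<integral>\<^sup>+ y. ennreal (exp (- (norm y)\<^sup>2 / (4 * T))) \<partial>\<mu>) < \<infinity>"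
  by (simp add: MT_nonneg_def)

lemma MT_nonneg_sets: "\<mu> \<in> MT_nonneg T \<Longrightarrow> sets \<mu> = sets borel"
  by (simp add: MT_nonneg_def)

lemma MT_nonneg_sigma_finite:
  fixes \<mu> :: "'a::euclidean_space measure"
  assumes "\<mu> \<in> MT_nonneg T"
  shows "sigma_finite_measure \<mu>"
proof
  have s: "space \<mu> = UNIV" using sets_eq_imp_space_eq[OF MT_nonneg_sets[OF assms]] by simp
  show "\<exists>A. countable A \<and> A \<subseteq> sets \<mu> \<and> \<Union> A = space \<mu> \<and> (\<forall>a\<in>A. emeasure \<mu> a \<noteq> \<infinity>)"
  proof (intro exI conjI)
    show "countable (range (\<lambda>n. cball (0::'a) (real n)))" by simp
    show "range (\<lambda>n. cball (0::'a) (real n)) \<subseteq> sets \<mu>" by (auto simp: MT_nonneg_sets[OF assms])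
    show "\<Union> (range (\<lambda>n. cball (0::'a) (real n))) = space \<mu>"
      using real_arch_simple by (auto simp: s)
    have "emeasure \<mu> (cball 0 (real n)) < \<infinity>" for n
      using assms compact_cball by (auto simp: MT_nonneg_def)
    then show "\<forall>a\<in>range (\<lambda>n. cball (0::'a) (real n)). emeasure \<mu> a \<noteq> \<infinity>"
      by (metis (mono_tags, lifting) imageE less_irrefl)
  qed
qed

text \<open>Exchanging integrals moves the heat flow onto \<open>f\<close>, where it is an
  approximate identity. The factor \<open>T / 8\<close> keeps the times within the range of
  \<open>heat_mean_bound\<close>, which supplies the \<mu>-integrable majorant.\<close>

lemma heat_pot_test:
  fixes f :: "'a::euclidean_space \<Rightarrow> real"
  assumes \<mu>: "\<mu> \<in> MT_nonneg T" and T: "0 < T"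
    and f: "continuous_on UNIV f" "\<And>x. 0 \<le> f x" "\<And>x. f x \<le> indicator (cball 0 R) x"
  shows "(\<lambda>n. \<integral>\<^sup>+ x. ennreal (f x) * heat_pot \<mu> x (T / 8 * tau n) \<partial>lborel) \<longlonglongrightarrow> (\<integral>\<^sup>+ y. ennreal (f y) \<partial>\<mu>)"
proof -
  note sets_\<mu> [measurable_cong] = MT_nonneg_sets[OF \<mu>]
  interpret \<mu>: sigma_finite_measure \<mu> by (rule MT_nonneg_sigma_finite[OF \<mu>])
  interpret pair_sigma_finite lborel \<mu> ..
  have [measurable]: "f \<in> borel_measurable borel" by (rule borel_measurable_continuous_onI) fact
  let ?t = "\<lambda>n. T / 8 * tau n"
  have t: "0 < ?t n" "?t n \<le> T / 8" for n
    using T by (auto simp: tau_def field_simps)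
  have t_lim: "?t \<longlonglongrightarrow> 0"
    using tendsto_mult_right_zero[OF tau_tendsto] by simp
  have f1: "f x \<le> 1" for x using f(3)[of x] by (rule order_trans) (simp split: split_indicator)
  have swap: "(\<integral>\<^sup>+ x. ennreal (f x) * heat_pot \<mu> x s \<partial>lborel)
      = (\<integral>\<^sup>+ y. (\<integral>\<^sup>+ x. ennreal (heat (x - y) s) * ennreal (f x) \<partial>lborel) \<partial>\<mu>)" for s
  proof -
    have "(\<integral>\<^sup>+ x. ennreal (f x) * heat_pot \<mu> x s \<partial>lborel)
        = (\<integral>\<^sup>+ x. \<integral>\<^sup>+ y. ennreal (heat (x - y) s) * ennreal (f x) \<partial>\<mu> \<partial>lborel)"
      unfolding heat_pot_def
      by (intro nn_integral_cong, subst nn_integral_multc) (auto simp: mult.commute)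
    also have "\<dots> = (\<integral>\<^sup>+ y. (\<integral>\<^sup>+ x. ennreal (heat (x - y) s) * ennreal (f x) \<partial>lborel) \<partial>\<mu>)"
      by (rule Fubini'[symmetric]) measurable
    finally show ?thesis .
  qed
  have conv: "(\<lambda>n. \<integral>\<^sup>+ x. ennreal (heat (x - y) (?t n)) * ennreal (f x) \<partial>lborel) \<longlonglongrightarrow> ennreal (f y)" for y
  proof -
    have "(\<lambda>n. \<integral>z. heat z (?t n) * f (y + z) \<partial>lborel) \<longlonglongrightarrow> f y"
    proof (rule heat_concentrates[where B=1])
      show "\<bar>f (y + z)\<bar> \<le> 1" for z using f(2) f1 by simp
      fix v :: 'a
      have "(\<lambda>n. y + sqrt (?t n) *\<^sub>R v) \<longlonglongrightarrow> y + sqrt 0 *\<^sub>R v"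
        by (intro tendsto_intros t_lim)
      then have "(\<lambda>n. y + sqrt (?t n) *\<^sub>R v) \<longlonglongrightarrow> y" by simp
      moreover have "isCont f y" using f(1) by (simp add: continuous_on_eq_continuous_at)
      ultimately show "(\<lambda>n. f (y + sqrt (?t n) *\<^sub>R v)) \<longlonglongrightarrow> f y"
        by (rule isCont_tendsto_compose[rotated])
    qed (use t in auto)
    then have "(\<lambda>n. ennreal (\<integral>z. heat z (?t n) * f (y + z) \<partial>lborel)) \<longlonglongrightarrow> ennreal (f y)"
      by (rule tendsto_ennrealI)
    moreover have "ennreal (\<integral>z. heat z (?t n) * f (y + z) \<partial>lborel) = (\<integral>\<^sup>+ x. ennreal (heat (x - y) (?t n)) * ennreal (f x) \<partial>lborel)" for n
    proof -
      have "integrable lborel (\<lambda>z. heat z (?t n) * f (y + z))"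
      proof (rule Bochner_Integration.integrable_bound[OF integrable_heat[OF t(1)[of n]]])
        show "AE z in lborel. norm (heat z (?t n) * f (y + z)) \<le> norm (heat z (?t n))"
          using f(2) f1 by (auto simp: abs_mult mult_left_le)
      qed measurable
      then have "ennreal (\<integral>z. heat z (?t n) * f (y + z) \<partial>lborel) = (\<integral>\<^sup>+ z. ennreal (heat z (?t n) * f (y + z)) \<partial>lborel)"
        by (intro nn_integral_eq_integral[symmetric]) (auto simp: f(2))
      also have "\<dots> = (\<integral>\<^sup>+ z. ennreal (heat (y + z - y) (?t n)) * ennreal (f (y + z)) \<partial>lborel)"
        by (simp add: ennreal_mult' f(2))
      also have "\<dots> = (\<integral>\<^sup>+ x. ennreal (heat (x - y) (?t n)) * ennreal (f x) \<partial>lborel)"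
        by (rule nn_integral_lborel_shift) measurable
      finally show ?thesis .
    qed
    ultimately show ?thesis by simp
  qed
  show ?thesis
    unfolding swap
  proof (rule nn_integral_dominated_convergence)
    let ?c = "ennreal (2 powr (real DIM('a) / 2) + exp (R\<^sup>2 / T))"
    show "AE y in \<mu>. (\<integral>\<^sup>+ x. ennreal (heat (x - y) (?t n)) * ennreal (f x) \<partial>lborel)
        \<le> ?c * ennreal (exp (- (norm y)\<^sup>2 / (4 * T)))" for n
    proof (rule AE_I2, rule heat_mean_bound[OF _ _ t])
      show "ennreal (f x) \<le> indicator (cball 0 R) x" for x
        using f(3)[of x] by (auto simp: ennreal_le_1 ennreal_eq_0_iff split: split_indicator)
    qed measurable
    show "(\<integral>\<^sup>+ y. ?c * ennreal (exp (- (norm y)\<^sup>2 / (4 * T))) \<partial>\<mu>) < \<infinity>"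
      using MT_nonneg_weight[OF \<mu>] by (simp add: nn_integral_cmult ennreal_mult_less_top)
    show "AE y in \<mu>. (\<lambda>n. \<integral>\<^sup>+ x. ennreal (heat (x - y) (?t n)) * ennreal (f x) \<partial>lborel) \<longlonglongrightarrow> ennreal (f y)"
      by (intro AE_I2 conv)
  qed measurable
qed

text \<open>Equal potentials give equal integrals of continuous functions with bounded support, and
  these increase to the indicator of an open box.\<close>

lemma heat_pot_inject:
  fixes \<mu> \<nu> :: "'a::euclidean_space measure"
  assumes \<mu>: "\<mu> \<in> MT_nonneg T" and \<nu>: "\<nu> \<in> MT_nonneg T" and T: "0 < T"
    and eq: "\<And>x t. 0 < t \<Longrightarrow> t < T \<Longrightarrow> heat_pot \<mu> x t = heat_pot \<nu> x t"
  shows "\<mu> = \<nu>"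
proof -
  have int: "(\<integral>\<^sup>+ y. ennreal (f y) \<partial>\<mu>) = (\<integral>\<^sup>+ y. ennreal (f y) \<partial>\<nu>)"
    if f: "continuous_on UNIV f" "\<And>x. 0 \<le> f x" "\<And>x. f x \<le> indicator (cball 0 R) x" for f :: "'a \<Rightarrow> real" and R
  proof -
    have t: "0 < T / 8 * tau n" "T / 8 * tau n < T" for n
      using T by (auto simp: tau_def field_simps add_pos_nonneg)
    show ?thesis
      using heat_pot_test[OF \<mu> T f] heat_pot_test[OF \<nu> T f] unfolding eq[OF t] by (rule LIMSEQ_unique)
  qed
  have box: "emeasure \<mu> (box a b) = emeasure \<nu> (box a b)" for a b :: 'a
  proof -
    let ?U = "box a b"
    obtain R where R: "?U \<subseteq> cball 0 R"
      using bounded_box[of a b] by (auto simp: bounded_iff subset_iff)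
    \<comment> \<open>The distance to the empty set is \<open>0\<close> by convention, in which case
      \<open>f j\<close> would vanish identically.\<close>
    have ne: "- ?U \<noteq> {}"
      using bounded_box[of a b] not_bounded_UNIV by (metis Compl_empty_eq double_complement)
    define f where "f j x = min 1 (real j * infdist x (- ?U))" for j :: nat and x
    have f_in: "f j x = 0" if "x \<notin> ?U" for j x
      using that by (simp add: f_def infdist_zero)
    have f_nn: "0 \<le> f j x" for j x
      by (simp add: f_def infdist_nonneg)
    have fc: "continuous_on UNIV (f j)" for j
      unfolding f_def[abs_def] by (intro continuous_intros)
    have fR: "f j x \<le> indicator (cball 0 R) x" for j x
    proof (cases "x \<in> ?U")
      case True
      then show ?thesis using R by (auto simp: f_def)
    qed (simp add: f_in)
    have f_inc: "incseq (\<lambda>j. ennreal (f j x))" for x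
      unfolding incseq_def f_def
      by (intro allI impI ennreal_leI min.mono mult_right_mono infdist_nonneg) auto
    have f_lim: "(\<lambda>j. ennreal (f j x)) \<longlonglongrightarrow> indicator ?U x" for x
    proof (cases "x \<in> ?U")
      case True
      have "0 < infdist x (- ?U)"
        using True ne by (intro infdist_pos_not_in_closed) auto
      then obtain J :: nat where J: "1 < real J * infdist x (- ?U)" using reals_Archimedean3 by blast
      have "f j x = 1" if "J \<le> j" for j
      proof -
        have "1 < real j * infdist x (- ?U)"
          using J mult_right_mono[of "real J" "real j" "infdist x (- ?U)"] that infdist_nonneg[of x "- ?U"] by simp
        then show ?thesis by (simp add: f_def)
      qed
      then have "\<forall>\<^sub>F j in sequentially. ennreal (f j x) = indicator ?U x"
        using True by (auto simp: eventually_sequentially)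
      then show ?thesis by (rule tendsto_eventually)
    qed (simp add: f_in)
    have em: "emeasure M ?U = (SUP j. \<integral>\<^sup>+ y. ennreal (f j y) \<partial>M)" if M: "sets M = sets borel" for M
    proof -
      have [measurable]: "f j \<in> borel_measurable M" for j
        using borel_measurable_continuous_onI[OF fc] M by (simp cong: measurable_cong_sets)
      have "indicator ?U x = (SUP j. ennreal (f j x))" for x
        using LIMSEQ_unique[OF f_lim LIMSEQ_SUP[OF f_inc]] .
      then have "emeasure M ?U = (\<integral>\<^sup>+ x. (SUP j. ennreal (f j x)) \<partial>M)"
        using M by (simp flip: nn_integral_indicator)
      also have "\<dots> = (SUP j. \<integral>\<^sup>+ y. ennreal (f j y) \<partial>M)"
        using f_inc by (intro nn_integral_monotone_convergence_SUP) (auto simp: incseq_def le_fun_def)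
      finally show ?thesis .
    qed
    show ?thesis
      unfolding em[OF MT_nonneg_sets[OF \<mu>]] em[OF MT_nonneg_sets[OF \<nu>]] int[OF fc f_nn fR] ..
  qed
  show ?thesis
  proof (rule measure_eqI_generator_eq)
    let ?E = "range (\<lambda>(a, b). box a b::'a set)"
    show "Int_stable ?E"
      by (auto simp: Int_stable_def box_Int_box)
    show "?E \<subseteq> Pow UNIV" "sets \<mu> = sigma_sets UNIV ?E" "sets \<nu> = sigma_sets UNIV ?E"
      using MT_nonneg_sets[OF \<mu>] MT_nonneg_sets[OF \<nu>] by (simp_all add: borel_eq_box)
    let ?A = "\<lambda>n::nat. box (- (real n *\<^sub>R One)) (real n *\<^sub>R One) :: 'a set"
    show "range ?A \<subseteq> ?E" "(\<Union>i. ?A i) = UNIV"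
      unfolding UN_box_eq_UNIV by auto
    show "emeasure \<mu> X = emeasure \<nu> X" if "X \<in> ?E" for X
      using that box by auto
    show "emeasure \<mu> (?A i) \<noteq> \<infinity>" for i
    proof -
      have "emeasure \<mu> (?A i) \<le> emeasure \<mu> (cbox (- (real i *\<^sub>R One)) (real i *\<^sub>R One))"
        by (rule emeasure_mono[OF box_subset_cbox]) (simp add: MT_nonneg_sets[OF \<mu>])
      also have "\<dots> < \<infinity>" using \<mu> compact_cbox by (auto simp: MT_nonneg_def)
      finally show ?thesis by simp
    qed
  qed
qed

section \<open>A second moment bound\<close>

text \<open>The form with an inequality includes empty intervals, which occur below when the second
  time runs over a range that may be void.\<close>

lemma nn_integral_FTC_le:
  fixes F :: "real \<Rightarrow> real"
  assumes [measurable]: "f \<in> borel_measurable borel"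
    and der: "\<And>x. a \<le> x \<Longrightarrow> x \<le> b \<Longrightarrow> (F has_real_derivative f x) (at x)"
    and nn: "\<And>x. a \<le> x \<Longrightarrow> x \<le> b \<Longrightarrow> 0 \<le> f x"
    and le: "a \<le> b \<Longrightarrow> F b - F a \<le> C"
  shows "(\<integral>\<^sup>+ x. ennreal (f x) * indicator {a..b} x \<partial>lborel) \<le> ennreal C"
proof (cases "a \<le> b")
  case True
  have "(\<integral>\<^sup>+ x. ennreal (f x) * indicator {a..b} x \<partial>lborel) = ennreal (F b - F a)"
    by (rule nn_integral_FTC_Icc[OF _ der nn True]) auto
  then show ?thesis using le[OF True] by (simp add: ennreal_leI)
qed simp

lemma ennreal_mult_le_squares: "a * b \<le> a\<^sup>2 + (b::ennreal)\<^sup>2"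
proof (cases "a \<le> b")
  case True
  then have "a * b \<le> b * b" by (rule mult_right_mono) simp
  then show ?thesis by (simp add: power2_eq_square add_increasing)
next
  case False
  then have "a * b \<le> a * a" by (intro mult_left_mono) auto
  then show ?thesis by (simp add: power2_eq_square add_increasing2)
qed

text \<open>In logarithmic time the weight \<open>sqrt (r / s)\<close> decays exponentially in the distance, so every term
  beyond the product of the means is controlled by a single mean.\<close>

lemma time_double_bound:
  fixes f \<Psi> :: "real \<Rightarrow> ennreal"
  assumes [measurable]: "f \<in> borel_measurable borel" "\<Psi> \<in> borel_measurable borel"
    and \<sigma>: "0 < \<sigma>" and D: "0 \<le> D"
    and out: "\<And>s. s < \<sigma> \<or> t \<le> s \<Longrightarrow> f s = 0 \<and> \<Psi> s = 0"
    and b1: "\<And>s. \<sigma> \<le> s \<Longrightarrow> \<Psi> s \<le> ennreal (D / s)"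
    and b2: "\<And>s. \<sigma> \<le> s \<Longrightarrow> (\<Psi> s)\<^sup>2 \<le> f s * ennreal (D / s)"
  defines "m \<equiv> (\<integral>\<^sup>+ s. f s \<partial>lborel)"
  shows "(\<integral>\<^sup>+ s. \<integral>\<^sup>+ r. (f s + ennreal (sqrt (r / s)) * \<Psi> s) * (f r + ennreal (sqrt (r / s)) * \<Psi> r)
      * of_bool (16 * r < s) \<partial>lborel \<partial>lborel) \<le> m * m + ennreal (4 * D) * m"
proof -
  let ?I = "\<lambda>s r. indicator {\<sigma>..s / 16} r :: ennreal" and ?J = "\<lambda>s r. indicator {16 * r..t} s :: ennreal"
  \<comment> \<open>Parts of the expanded product. \<open>A1\<close> is the product of the means,
    and \<open>b1\<close> bounds the mixed terms by \<open>A2\<close> and \<open>A3\<close>. The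
    term \<open>(r / s) * \<Psi> s * \<Psi> r\<close> is split by
    \<open>ennreal_mult_le_squares\<close> with the whole factor \<open>r / s\<close> attached to
    \<open>\<Psi> r\<close>, and \<open>b2\<close> leads to \<open>A4\<close> and \<open>A5\<close>.
    In the last four one factor \<open>f\<close> remains, and the other time integrates to at most
    \<open>D\<close> on every scale.\<close>
  define A1 where "A1 s r = f s * f r" for s r
  define A2 where "A2 s r = f s * (ennreal (sqrt (r / s) * (D / r)) * ?I s r)" for s r
  define A3 where "A3 s r = f r * (ennreal (sqrt (r / s) * (D / s)) * ?J s r)" for s r
  define A4 where "A4 s r = f s * (ennreal (D / s) * ?I s r)" for s r
  define A5 where "A5 s r = f r * (ennreal (D / r * (r / s)\<^sup>2) * ?J s r)" for s r
  have [measurable]: "(\<lambda>(s, r). A1 s r) \<in> borel_measurable (borel \<Otimes>\<^sub>M borel)"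
    "(\<lambda>(s, r). A2 s r) \<in> borel_measurable (borel \<Otimes>\<^sub>M borel)"
    "(\<lambda>(s, r). A3 s r) \<in> borel_measurable (borel \<Otimes>\<^sub>M borel)"
    "(\<lambda>(s, r). A4 s r) \<in> borel_measurable (borel \<Otimes>\<^sub>M borel)"
    "(\<lambda>(s, r). A5 s r) \<in> borel_measurable (borel \<Otimes>\<^sub>M borel)"
    unfolding A1_def A2_def A3_def A4_def A5_def indicator_def atLeastAtMost_iff by measurable
  have pw: "(f s + ennreal (sqrt (r / s)) * \<Psi> s) * (f r + ennreal (sqrt (r / s)) * \<Psi> r) * of_bool (16 * r < s)
      \<le> A1 s r + A2 s r + A3 s r + A4 s r + A5 s r" for s r
  proof (cases "\<sigma> \<le> r \<and> 16 * r < s \<and> s < t")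
    case True
    then have r: "0 < r" "\<sigma> \<le> r" "\<sigma> \<le> s" "0 < s" and I: "?I s r = 1" "?J s r = 1" using \<sigma> by auto
    let ?\<rho> = "ennreal (sqrt (r / s))"
    have "?\<rho> * (f s * \<Psi> r) \<le> ?\<rho> * (f s * ennreal (D / r))"
      by (intro mult_left_mono b1 r) simp_all
    also have "\<dots> = A2 s r"
      unfolding A2_def I by (subst ennreal_mult') (use r in \<open>simp_all add: mult_ac\<close>)
    finally have 2: "?\<rho> * (f s * \<Psi> r) \<le> A2 s r" .
    have "?\<rho> * (\<Psi> s * f r) \<le> ?\<rho> * (ennreal (D / s) * f r)"
      by (intro mult_left_mono mult_right_mono b1 r) simp_all
    also have "\<dots> = A3 s r"
      unfolding A3_def I by (subst ennreal_mult') (use r in \<open>simp_all add: mult_ac\<close>)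
    finally have 3: "?\<rho> * (\<Psi> s * f r) \<le> A3 s r" .
    have "?\<rho> * ?\<rho> = ennreal (r / s)"
      using r by (simp add: ennreal_mult'[symmetric])
    then have "?\<rho> * ?\<rho> * (\<Psi> s * \<Psi> r) = \<Psi> s * (ennreal (r / s) * \<Psi> r)"
      by (simp add: mult_ac)
    also have "\<dots> \<le> (\<Psi> s)\<^sup>2 + (ennreal (r / s) * \<Psi> r)\<^sup>2"
      by (rule ennreal_mult_le_squares)
    also have "\<dots> = (\<Psi> s)\<^sup>2 + ennreal ((r / s)\<^sup>2) * (\<Psi> r)\<^sup>2"
      using r by (simp add: power_mult_distrib ennreal_power)
    also have "\<dots> \<le> f s * ennreal (D / s) + ennreal ((r / s)\<^sup>2) * (f r * ennreal (D / r))"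
      by (intro add_mono mult_left_mono b2 r) simp
    also have "\<dots> = A4 s r + A5 s r"
    proof -
      have e: "ennreal ((r / s)\<^sup>2) * ennreal (D / r) = ennreal (D / r * (r / s)\<^sup>2)"
        by (subst ennreal_mult'[symmetric]) (simp_all add: mult.commute)
      show ?thesis unfolding A4_def A5_def I e[symmetric] by (simp add: mult_ac)
    qed
    finally have 4: "?\<rho> * ?\<rho> * (\<Psi> s * \<Psi> r) \<le> A4 s r + A5 s r" .
    have "(f s + ?\<rho> * \<Psi> s) * (f r + ?\<rho> * \<Psi> r)
        = A1 s r + ?\<rho> * (f s * \<Psi> r) + ?\<rho> * (\<Psi> s * f r) + ?\<rho> * ?\<rho> * (\<Psi> s * \<Psi> r)"
      by (simp add: A1_def algebra_simps)
    also have "\<dots> \<le> A1 s r + A2 s r + A3 s r + (A4 s r + A5 s r)"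
      by (intro add_mono 2 3 4 order_refl)
    finally show ?thesis using True by (simp add: add.assoc)
  next
    case False
    then have "f s = 0 \<and> \<Psi> s = 0 \<or> f r = 0 \<and> \<Psi> r = 0 \<or> \<not> 16 * r < s"
      using out[of s] out[of r] by (meson not_le)
    then show ?thesis by auto
  qed
  have I1: "(\<integral>\<^sup>+ s. \<integral>\<^sup>+ r. A1 s r \<partial>lborel \<partial>lborel) = m * m"
    by (simp add: A1_def m_def nn_integral_cmult nn_integral_multc)
  have fin: "(\<integral>\<^sup>+ s. f s * g s \<partial>lborel) \<le> ennreal D * m" if "\<And>s. \<sigma> \<le> s \<Longrightarrow> g s \<le> ennreal D" for g
  proof -
    have "(\<integral>\<^sup>+ s. f s * g s \<partial>lborel) \<le> (\<integral>\<^sup>+ s. f s * ennreal D \<partial>lborel)"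
    proof (rule nn_integral_mono)
      fix s
      show "f s * g s \<le> f s * ennreal D"
        using that[of s] out[of s] by (cases "\<sigma> \<le> s") (auto intro: mult_left_mono)
    qed
    also have "\<dots> = m * ennreal D"
      unfolding m_def by (rule nn_integral_multc) simp
    finally show ?thesis by (simp add: mult.commute)
  qed
  have I2: "(\<integral>\<^sup>+ s. \<integral>\<^sup>+ r. A2 s r \<partial>lborel \<partial>lborel) \<le> ennreal D * m"
  proof -
    have "(\<integral>\<^sup>+ s. \<integral>\<^sup>+ r. A2 s r \<partial>lborel \<partial>lborel)
       = (\<integral>\<^sup>+ s. f s * (\<integral>\<^sup>+ r. ennreal (sqrt (r / s) * (D / r)) * ?I s r \<partial>lborel) \<partial>lborel)"
      unfolding A2_def by (simp add: nn_integral_cmult)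
    also have "\<dots> \<le> ennreal D * m"
    proof (rule fin)
      fix s assume s: "\<sigma> \<le> s"
      show "(\<integral>\<^sup>+ r. ennreal (sqrt (r / s) * (D / r)) * ?I s r \<partial>lborel) \<le> ennreal D"
      proof (rule nn_integral_FTC_le[where F="\<lambda>r. 2 * D * sqrt (r / s)"])
        fix r assume "\<sigma> \<le> r" "r \<le> s / 16"
        then have r: "0 < r" "0 < s" using \<sigma> s by auto
        have "((\<lambda>r. 2 * D * sqrt (r / s)) has_real_derivative 2 * D * (inverse (sqrt (r / s)) / 2 * (1 / s))) (at r)"
          by (rule DERIV_cmult[OF DERIV_chain2[OF DERIV_real_sqrt DERIV_cdivide[OF DERIV_ident]]])
             (rule divide_pos_pos[OF r])
        moreover have "2 * D * (inverse (sqrt (r / s)) / 2 * (1 / s)) = sqrt (r / s) * (D / r)"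
        proof -
          have "0 \<le> r / s" using r by simp
          then have "sqrt (r / s) * sqrt (r / s) = r / s" by (metis abs_of_nonneg real_sqrt_mult_self)
          moreover have "sqrt (r / s) \<noteq> 0" using r by simp
          ultimately show ?thesis using r by (simp add: field_simps)
        qed
        ultimately show "((\<lambda>r. 2 * D * sqrt (r / s)) has_real_derivative sqrt (r / s) * (D / r)) (at r)"
          by (simp only:)
        show "0 \<le> sqrt (r / s) * (D / r)"
          using r D by (intro mult_nonneg_nonneg real_sqrt_ge_zero divide_nonneg_nonneg) auto
      next
        have s0: "0 < s" using s \<sigma> by simp
        \<comment> \<open>The threshold \<open>16\<close> enters through its square root: at the end
          point \<open>s / 16\<close> the antiderivative equals \<open>2 * D / 4\<close>.\<close>
        have "sqrt (1 / 16) = sqrt ((1 / 4)\<^sup>2)" by (simp add: power2_eq_square)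
        then have q: "sqrt (s / 16 / s) = 1 / 4" using s0 by (simp add: real_sqrt_abs)
        have "0 \<le> 2 * D * sqrt (\<sigma> / s)" using D s0 \<sigma> by simp
        then show "2 * D * sqrt (s / 16 / s) - 2 * D * sqrt (\<sigma> / s) \<le> D"
          unfolding q using D by linarith
      qed measurable
    qed
    finally show ?thesis .
  qed
  have I4: "(\<integral>\<^sup>+ s. \<integral>\<^sup>+ r. A4 s r \<partial>lborel \<partial>lborel) \<le> ennreal D * m"
  proof -
    have "(\<integral>\<^sup>+ s. \<integral>\<^sup>+ r. A4 s r \<partial>lborel \<partial>lborel)
       = (\<integral>\<^sup>+ s. f s * (\<integral>\<^sup>+ r. ennreal (D / s) * ?I s r \<partial>lborel) \<partial>lborel)"
      unfolding A4_def by (simp add: nn_integral_cmult del: nn_integral_indicator)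
    also have "\<dots> \<le> ennreal D * m"
    proof (rule fin)
      fix s assume s: "\<sigma> \<le> s"
      show "(\<integral>\<^sup>+ r. ennreal (D / s) * ?I s r \<partial>lborel) \<le> ennreal D"
      proof (rule nn_integral_FTC_le[where F="\<lambda>r. D / s * r"])
        have s0: "0 < s" using s \<sigma> by simp
        have e: "D / s * (s / 16) = D / 16" using s0 by simp
        have "0 \<le> D / s * \<sigma>" using s0 \<sigma> D by simp
        then show "D / s * (s / 16) - D / s * \<sigma> \<le> D" unfolding e using D by linarith
        show "((\<lambda>r. D / s * r) has_real_derivative D / s) (at r)" for r
          by (rule DERIV_cmult_Id)
        show "0 \<le> D / s" using D s0 by simp
      qed simp
    qed
    finally show ?thesis .
  qed
  have swap: "(\<integral>\<^sup>+ s. \<integral>\<^sup>+ r. f r * (g s r) \<partial>lborel \<partial>lborel) = (\<integral>\<^sup>+ r. f r * (\<integral>\<^sup>+ s. g s r \<partial>lborel) \<partial>lborel)"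
    if [measurable]: "(\<lambda>(s, r). g s r) \<in> borel_measurable (borel \<Otimes>\<^sub>M borel)" for g :: "real \<Rightarrow> real \<Rightarrow> ennreal"
  proof -
    have "(\<integral>\<^sup>+ s. \<integral>\<^sup>+ r. f r * (g s r) \<partial>lborel \<partial>lborel) = (\<integral>\<^sup>+ r. \<integral>\<^sup>+ s. f r * (g s r) \<partial>lborel \<partial>lborel)"
      by (rule lborel_pair.Fubini') measurable
    also have "\<dots> = (\<integral>\<^sup>+ r. f r * (\<integral>\<^sup>+ s. g s r \<partial>lborel) \<partial>lborel)"
      by (simp add: nn_integral_cmult)
    finally show ?thesis .
  qed
  have I3: "(\<integral>\<^sup>+ s. \<integral>\<^sup>+ r. A3 s r \<partial>lborel \<partial>lborel) \<le> ennreal D * m"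
  proof -
    have "(\<integral>\<^sup>+ s. \<integral>\<^sup>+ r. A3 s r \<partial>lborel \<partial>lborel)
       = (\<integral>\<^sup>+ r. f r * (\<integral>\<^sup>+ s. ennreal (sqrt (r / s) * (D / s)) * ?J s r \<partial>lborel) \<partial>lborel)"
      unfolding A3_def indicator_def atLeastAtMost_iff by (rule swap) measurable
    also have "\<dots> \<le> ennreal D * m"
    proof (rule fin)
      fix r assume r: "\<sigma> \<le> r"
      then have r0: "0 < r" using \<sigma> by simp
      show "(\<integral>\<^sup>+ s. ennreal (sqrt (r / s) * (D / s)) * ?J s r \<partial>lborel) \<le> ennreal D"
      proof (rule nn_integral_FTC_le[where F="\<lambda>s. - 2 * D * sqrt (r / s)"])
        fix s assume "16 * r \<le> s" "s \<le> t"
        then have s: "0 < s" using r0 by simp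
        have "((\<lambda>s. - 2 * D * sqrt (r / s)) has_real_derivative - 2 * D * (inverse (sqrt (r / s)) / 2 * (- r / (s * s)))) (at s)"
        proof -
          have "((\<lambda>s. r / s) has_real_derivative - r / (s * s)) (at s)"
            using s by (auto intro!: derivative_eq_intros)
          from DERIV_cmult[OF DERIV_chain2[OF DERIV_real_sqrt[OF divide_pos_pos[OF r0 s]] this], of "- 2 * D"]
          show ?thesis by simp
        qed
        moreover have "- 2 * D * (inverse (sqrt (r / s)) / 2 * (- r / (s * s))) = sqrt (r / s) * (D / s)"
        proof -
          have "0 \<le> r / s" using r0 s by simp
          then have "sqrt (r / s) * sqrt (r / s) = r / s" by (metis abs_of_nonneg real_sqrt_mult_self)
          moreover have "sqrt (r / s) \<noteq> 0" using r0 s by simp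
          ultimately show ?thesis using r0 s by (simp add: field_simps)
        qed
        ultimately show "((\<lambda>s. - 2 * D * sqrt (r / s)) has_real_derivative sqrt (r / s) * (D / s)) (at s)"
          by (simp only:)
        show "0 \<le> sqrt (r / s) * (D / s)"
          using r0 s D by (intro mult_nonneg_nonneg real_sqrt_ge_zero divide_nonneg_nonneg) auto
      next
        assume t: "16 * r \<le> t"
        have "sqrt (1 / 16) = sqrt ((1 / 4)\<^sup>2)" by (simp add: power2_eq_square)
        then have q: "sqrt (r / (16 * r)) = 1 / 4" using r0 by (simp add: real_sqrt_abs)
        have "0 \<le> 2 * D * sqrt (r / t)" using D r0 t by simp
        then show "- 2 * D * sqrt (r / t) - - 2 * D * sqrt (r / (16 * r)) \<le> D"
          unfolding q using D by linarith
      qed measurable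
    qed
    finally show ?thesis .
  qed
  have I5: "(\<integral>\<^sup>+ s. \<integral>\<^sup>+ r. A5 s r \<partial>lborel \<partial>lborel) \<le> ennreal D * m"
  proof -
    have "(\<integral>\<^sup>+ s. \<integral>\<^sup>+ r. A5 s r \<partial>lborel \<partial>lborel)
       = (\<integral>\<^sup>+ r. f r * (\<integral>\<^sup>+ s. ennreal (D / r * (r / s)\<^sup>2) * ?J s r \<partial>lborel) \<partial>lborel)"
      unfolding A5_def indicator_def atLeastAtMost_iff by (rule swap) measurable
    also have "\<dots> \<le> ennreal D * m"
    proof (rule fin)
      fix r assume r: "\<sigma> \<le> r"
      then have r0: "0 < r" using \<sigma> by simp
      show "(\<integral>\<^sup>+ s. ennreal (D / r * (r / s)\<^sup>2) * ?J s r \<partial>lborel) \<le> ennreal D"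
      proof (rule nn_integral_FTC_le[where F="\<lambda>s. - D * (r / s)"])
        fix s assume "16 * r \<le> s" "s \<le> t"
        then have s: "0 < s" using r0 by simp
        have "((\<lambda>s. - D * (r / s)) has_real_derivative - D * (- r / (s * s))) (at s)"
          using r0 s by (auto intro!: derivative_eq_intros)
        moreover have "- D * (- r / (s * s)) = D / r * (r / s)\<^sup>2"
          using r0 s by (simp add: power2_eq_square)
        ultimately show "((\<lambda>s. - D * (r / s)) has_real_derivative D / r * (r / s)\<^sup>2) (at s)"
          by (simp only:)
        show "0 \<le> D / r * (r / s)\<^sup>2" using r0 D by simp
      next
        assume t: "16 * r \<le> t"
        have "r / (16 * r) = 1 / 16" using r0 by simp
        moreover have "0 \<le> D * (r / t)" using D r0 t by simp
        ultimately show "- D * (r / t) - - D * (r / (16 * r)) \<le> D" using D by simp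
      qed measurable
    qed
    finally show ?thesis .
  qed
  have "(\<integral>\<^sup>+ s. \<integral>\<^sup>+ r. (f s + ennreal (sqrt (r / s)) * \<Psi> s) * (f r + ennreal (sqrt (r / s)) * \<Psi> r)
      * of_bool (16 * r < s) \<partial>lborel \<partial>lborel)
      \<le> (\<integral>\<^sup>+ s. \<integral>\<^sup>+ r. A1 s r + A2 s r + A3 s r + A4 s r + A5 s r \<partial>lborel \<partial>lborel)"
    by (intro nn_integral_mono pw)
  also have "\<dots> = (\<integral>\<^sup>+ s. \<integral>\<^sup>+ r. A1 s r \<partial>lborel \<partial>lborel) + (\<integral>\<^sup>+ s. \<integral>\<^sup>+ r. A2 s r \<partial>lborel \<partial>lborel)
     + (\<integral>\<^sup>+ s. \<integral>\<^sup>+ r. A3 s r \<partial>lborel \<partial>lborel) + (\<integral>\<^sup>+ s. \<integral>\<^sup>+ r. A4 s r \<partial>lborel \<partial>lborel)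
     + (\<integral>\<^sup>+ s. \<integral>\<^sup>+ r. A5 s r \<partial>lborel \<partial>lborel)"
    by (simp add: nn_integral_add)
  also have "\<dots> \<le> m * m + ennreal D * m + ennreal D * m + ennreal D * m + ennreal D * m"
    using I1 by (intro add_mono I2 I3 I4 I5) simp
  also have "\<dots> = m * m + ennreal (4 * D) * m"
  proof -
    have "ennreal (4 * D) = ennreal D + ennreal D + ennreal D + ennreal D"
      using D by (simp add: ennreal_plus[symmetric] del: ennreal_plus)
    then show ?thesis by (simp add: distrib_right add.assoc)
  qed
  finally show ?thesis .
qed

text \<open>At widely separated times the kernel between two points almost equals the kernel from
  the origin. Only the cross term \<open>2 |x| |z| / (4 s)\<close> has to be paid for; in the
  variables \<open>|x| / sqrt s\<close> and \<open>|z| / sqrt r\<close> it carries the small factor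
  \<open>sqrt (r / s)\<close>. The constant comes from \<open>s - r \<ge> s / 2\<close>.\<close>

lemma heat_offdiagonal:
  fixes x z :: "'a::euclidean_space"
  assumes r: "0 < r" "16 * r < s"
  shows "heat (x - z) (s - r) \<le> 2 powr (real DIM('a) / 2) * heat x s
    * exp (sqrt (r / s) / 4 * ((norm x)\<^sup>2 / s)) * exp (sqrt (r / s) / 4 * ((norm z)\<^sup>2 / r))"
proof -
  define a where "a = real DIM('a) / 2"
  define \<rho> where "\<rho> = sqrt (r / s)"
  have s: "0 < s" "s / 2 \<le> s - r" "0 < s - r" using r by auto
  have 1: "(4 * pi * (s - r)) powr (- a) \<le> 2 powr a * (4 * pi * s) powr (- a)"
  proof -
    have "(4 * pi * (s - r)) powr (- a) \<le> (4 * pi * s * (1 / 2)) powr (- a)"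
      using s by (intro powr_mono2') (auto simp: a_def)
    also have "\<dots> = 2 powr a * (4 * pi * s) powr (- a)"
      using s by (subst powr_mult) (auto simp: powr_divide powr_minus_divide)
    finally show ?thesis .
  qed
  have e: "- (norm (x - z))\<^sup>2 / (4 * (s - r))
      \<le> - (norm x)\<^sup>2 / (4 * s) + \<rho> / 4 * ((norm x)\<^sup>2 / s) + \<rho> / 4 * ((norm z)\<^sup>2 / r)"
  proof -
    have n: "(norm x)\<^sup>2 - 2 * (norm x * norm z) \<le> (norm (x - z))\<^sup>2"
    proof -
      have "(norm x)\<^sup>2 - 2 * (norm x * norm z) \<le> (norm x - norm z)\<^sup>2"
        by (simp add: power2_diff)
      also have "\<dots> \<le> (norm (x - z))\<^sup>2"
        using norm_triangle_ineq3[of x z] by (metis abs_norm_cancel power2_le_iff_abs_le norm_ge_zero power2_abs)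
      finally show ?thesis .
    qed
    have "((norm x)\<^sup>2 - 2 * (norm x * norm z)) / (4 * s) \<le> (norm (x - z))\<^sup>2 / (4 * s)"
      using n s by (intro divide_right_mono) auto
    also have "\<dots> \<le> (norm (x - z))\<^sup>2 / (4 * (s - r))"
      using r s by (intro divide_left_mono) auto
    finally have A: "- (norm (x - z))\<^sup>2 / (4 * (s - r)) \<le> - (norm x)\<^sup>2 / (4 * s) + 2 * (norm x * norm z) / (4 * s)"
      by (simp add: diff_divide_distrib)
    define u v where "u = norm x / sqrt s" and "v = norm z / sqrt r"
    have uv: "norm x = u * sqrt s" "norm z = v * sqrt r" using r s by (auto simp: u_def v_def)
    have \<rho>e: "\<rho> = sqrt r / sqrt s" by (simp add: \<rho>_def real_sqrt_divide)
    have "norm x * norm z / s = \<rho> * (u * v)"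
      unfolding uv \<rho>e using s by (simp add: field_simps)
    moreover have "2 * (u * v) \<le> u\<^sup>2 + v\<^sup>2" using sum_squares_bound[of u v] by simp
    then have "\<rho> * (2 * (u * v)) \<le> \<rho> * (u\<^sup>2 + v\<^sup>2)" by (rule mult_left_mono) (use r s in \<open>simp add: \<rho>_def\<close>)
    moreover have "u\<^sup>2 = (norm x)\<^sup>2 / s" "v\<^sup>2 = (norm z)\<^sup>2 / r"
      using r s by (auto simp: u_def v_def power_divide)
    ultimately have "2 * (norm x * norm z) / (4 * s) \<le> \<rho> / 4 * ((norm x)\<^sup>2 / s) + \<rho> / 4 * ((norm z)\<^sup>2 / r)"
      by (simp add: distrib_left)
    with A show ?thesis by linarith
  qed
  have "heat (x - z) (s - r) = (4 * pi * (s - r)) powr (- a) * exp (- (norm (x - z))\<^sup>2 / (4 * (s - r)))"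
    by (simp add: heat_def a_def)
  also have "\<dots> \<le> (2 powr a * (4 * pi * s) powr (- a))
      * exp (- (norm x)\<^sup>2 / (4 * s) + \<rho> / 4 * ((norm x)\<^sup>2 / s) + \<rho> / 4 * ((norm z)\<^sup>2 / r))"
    using 1 e by (intro mult_mono) auto
  also have "\<dots> = 2 powr a * heat x s * exp (\<rho> / 4 * ((norm x)\<^sup>2 / s)) * exp (\<rho> / 4 * ((norm z)\<^sup>2 / r))"
    unfolding exp_add by (simp add: heat_def a_def)
  finally show ?thesis by (simp add: a_def \<rho>_def)
qed

text \<open>A coefficient for the first-order dependence of the error factor
  \<open>exp (\<rho> / 4 * \<xi>)\<close> on \<open>\<rho>\<close>, uniform for
  \<open>\<rho> \<le> 1 / 4\<close>; here \<open>\<xi>\<close> stands for \<open>|x|^2 / s\<close>,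
  and the range of \<open>\<rho>\<close> corresponds to times separated by the factor
  \<open>16\<close>.\<close>

definition moment_weight :: "real \<Rightarrow> real" where "moment_weight \<xi> = \<xi> * exp (\<xi> / 16)"

lemma moment_weight_nonneg: "0 \<le> \<xi> \<Longrightarrow> 0 \<le> moment_weight \<xi>"
  by (simp add: moment_weight_def)

lemma exp_le_moment_weight:
  assumes "0 \<le> \<rho>" "\<rho> \<le> 1 / 4" "0 \<le> \<xi>"
  shows "exp (\<rho> / 4 * \<xi>) \<le> 1 + \<rho> * moment_weight \<xi>"
proof -
  define x where "x = \<rho> / 4 * \<xi>"
  have x: "0 \<le> x" using assms by (simp add: x_def)
  have "1 - x \<le> exp (- x)" using exp_ge_add_one_self[of "- x"] by simp
  then have "(1 - x) * exp x \<le> exp (- x) * exp x" by (rule mult_right_mono) simp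
  then have 1: "exp x \<le> 1 + x * exp x" by (simp add: exp_minus algebra_simps)
  have "x \<le> \<xi> / 16" unfolding x_def using assms mult_right_mono[of \<rho> "1/4" \<xi>] by simp
  then have "x * exp x \<le> (\<rho> * \<xi>) * exp (\<xi> / 16)"
    using assms by (intro mult_mono) (auto simp: x_def)
  with 1 show ?thesis by (simp add: x_def moment_weight_def)
qed

text \<open>The quadratic Taylor bound at \<open>\<xi> / 16\<close> gives
  \<open>\<xi>^2 \<le> 512 exp (\<xi> / 16)\<close>, so the square of the weight grows at most like
  \<open>exp (3 \<xi> / 16)\<close>. The decay \<open>exp (- \<xi> / 4)\<close> leaves
  \<open>exp (- \<xi> / 16)\<close>, the Gaussian at time \<open>4 s\<close>, and the change of
  normalisation costs \<open>2 ^ DIM('a)\<close>.\<close>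

lemma moment_weight_square_moment:
  fixes y :: "'a::euclidean_space"
  assumes s: "0 < s"
  shows "(\<integral>\<^sup>+ x. ennreal (heat (x - y) s * (moment_weight ((norm (x - y))\<^sup>2 / s))\<^sup>2) \<partial>lborel) \<le> ennreal (512 * 2 ^ DIM('a))"
proof -
  have pw: "heat z s * (moment_weight ((norm z)\<^sup>2 / s))\<^sup>2 \<le> 512 * 2 ^ DIM('a) * heat z (4 * s)" for z :: 'a
  proof -
    define \<xi> where "\<xi> = (norm z)\<^sup>2 / s"
    have \<xi>: "0 \<le> \<xi>" using s by (simp add: \<xi>_def)
    have "(\<xi> / 16)\<^sup>2 / 2 \<le> exp (\<xi> / 16)"
      using exp_lower_Taylor_quadratic[of "\<xi> / 16"] \<xi> by simp
    then have q: "\<xi>\<^sup>2 \<le> 512 * exp (\<xi> / 16)" by (simp add: power2_eq_square)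
    have "(moment_weight \<xi>)\<^sup>2 = \<xi>\<^sup>2 * exp (\<xi> / 8)"
      by (simp add: moment_weight_def power_mult_distrib exp_double[symmetric])
    also have "\<dots> \<le> 512 * exp (\<xi> / 16) * exp (\<xi> / 8)"
      using q by (intro mult_right_mono) auto
    also have "\<dots> = 512 * exp (3 * \<xi> / 16)"
      by (simp add: exp_add[symmetric])
    finally have g: "(moment_weight \<xi>)\<^sup>2 \<le> 512 * exp (3 * \<xi> / 16)" .
    define a where "a = real DIM('a) / 2"
    have p: "(4 * pi * s) powr (- a) = 2 ^ DIM('a) * (4 * pi * (4 * s)) powr (- a)"
    proof -
      have "(4 * pi * (4 * s)) powr (- a) = 4 powr (- a) * (4 * pi * s) powr (- a)"
        using s by (subst powr_mult[symmetric]) (auto simp: mult_ac)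
      moreover have "4 powr (- a) = inverse (2 ^ DIM('a))"
      proof -
        have "(4::real) powr a = (2 powr 2) powr a" by simp
        also have "\<dots> = 2 powr (real DIM('a))" by (subst powr_powr) (simp add: a_def)
        also have "\<dots> = 2 ^ DIM('a)" by (simp add: powr_realpow)
        finally show ?thesis by (simp add: powr_minus)
      qed
      ultimately show ?thesis by simp
    qed
    have ex: "exp (- (norm z)\<^sup>2 / (4 * s)) * exp (3 * \<xi> / 16) = exp (- (norm z)\<^sup>2 / (4 * (4 * s)))"
      using s by (simp add: exp_add[symmetric] \<xi>_def field_simps)
    have "heat z s * (moment_weight \<xi>)\<^sup>2 \<le> heat z s * (512 * exp (3 * \<xi> / 16))"
      using g by (rule mult_left_mono) simp
    also have "\<dots> = 512 * ((4 * pi * s) powr (- a) * (exp (- (norm z)\<^sup>2 / (4 * s)) * exp (3 * \<xi> / 16)))"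
      by (simp add: heat_def a_def)
    also have "\<dots> = 512 * 2 ^ DIM('a) * heat z (4 * s)"
      unfolding ex p by (simp add: heat_def a_def)
    finally show ?thesis by (simp add: \<xi>_def)
  qed
  have "(\<integral>\<^sup>+ x. ennreal (heat (x - y) s * (moment_weight ((norm (x - y))\<^sup>2 / s))\<^sup>2) \<partial>lborel)
     \<le> (\<integral>\<^sup>+ x. ennreal (512 * 2 ^ DIM('a)) * ennreal (heat (x - y) (4 * s)) \<partial>lborel)"
    by (intro nn_integral_mono) (simp add: ennreal_mult[symmetric] ennreal_leI pw)
  also have "\<dots> = ennreal (512 * 2 ^ DIM('a))"
    using s nn_integral_lborel_shift_minus[of "\<lambda>z. ennreal (heat z (4 * s))" y]
    by (simp add: nn_integral_cmult nn_integral_heat)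
  finally show ?thesis .
qed

lemma nn_integral_heat_at:
  "0 < s \<Longrightarrow> (\<integral>\<^sup>+ x. ennreal (heat (x - y) s) \<partial>lborel) = 1" for y :: "'a::euclidean_space"
  using nn_integral_lborel_shift_minus[of "\<lambda>z. ennreal (heat z s)" y] by (simp add: nn_integral_heat)

text \<open>For Brownian motion started at \<open>y\<close> with generator \<Delta>,
  \<open>m\<close> is the mean of the time integral of \<open>U\<close> along the path and the left
  side is half of its second moment. Pairs of times within a factor \<open>16\<close> are bounded by
  the mean alone; at larger separation the path has forgotten its earlier position up to errors
  measured by \<open>moment_weight\<close>.\<close>

lemma second_moment_bound:
  fixes U :: "'a::euclidean_space \<times> real \<Rightarrow> real" and y :: 'a
  assumes [measurable]: "U \<in> borel_measurable borel" and U0: "\<And>q. 0 \<le> U q"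
    and \<sigma>: "0 < \<sigma>" and C1: "0 < C1"
    and out: "\<And>q. snd q < \<sigma> \<or> t \<le> snd q \<Longrightarrow> U q = 0"
    and le: "\<And>q. \<sigma> \<le> snd q \<Longrightarrow> U q \<le> C1 / snd q"
  defines "m \<equiv> (\<integral>\<^sup>+ q. ennreal (U q) * hk_at y q \<partial>lborel)"
    and "D \<equiv> C1 * (1 + 512 * 2 ^ DIM('a))"
  shows "(\<integral>\<^sup>+ q. ennreal (U q) * conv hk (\<lambda>r. ennreal (U r) * hk_at y r) q \<partial>lborel)
    \<le> ennreal (2 powr (real DIM('a) / 2)) * (m * m + ennreal (4 * D) * m) + ennreal (15 * C1) * m"
proof -
  define c0 where "c0 = 2 powr (real DIM('a) / 2)"
  define h where "h q = ennreal (U q) * hk_at y q" for q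
  define g where "g q = moment_weight ((norm (fst q - y))\<^sup>2 / snd q)" for q
  have [measurable]: "h \<in> borel_measurable borel" unfolding h_def[abs_def] by measurable
  have [measurable]: "g \<in> borel_measurable borel" unfolding g_def[abs_def] moment_weight_def by measurable
  have h0: "h q = 0" if "snd q < \<sigma> \<or> t \<le> snd q" for q using out[OF that] by (simp add: h_def)
  define f where "f s = (\<integral>\<^sup>+ x. h (x, s) \<partial>lborel)" for s
  define \<Psi> where "\<Psi> s = (\<integral>\<^sup>+ x. h (x, s) * ennreal (g (x, s)) \<partial>lborel)" for s
  have [measurable]: "f \<in> borel_measurable borel" "\<Psi> \<in> borel_measurable borel"
    unfolding f_def[abs_def] \<Psi>_def[abs_def] by measurable
  have mf: "m = (\<integral>\<^sup>+ s. f s \<partial>lborel)"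
    unfolding m_def f_def h_def[symmetric] by (rule nn_integral_lborel_pair(1)) simp
  have D: "0 \<le> D" using C1 by (simp add: D_def)
  have g0: "0 \<le> g q" if "0 < snd q" for q using that by (simp add: g_def moment_weight_nonneg)
  have h_slice: "h (x, s) \<le> ennreal (C1 / s) * ennreal (heat (x - y) s)" if "\<sigma> \<le> s" for x s
    using le[of "(x, s)"] that \<sigma> by (auto simp: h_def hk_def intro!: mult_right_mono ennreal_leI)
  have g2: "(\<integral>\<^sup>+ x. ennreal (heat (x - y) s * (g (x, s))\<^sup>2) \<partial>lborel) \<le> ennreal (512 * 2 ^ DIM('a))" if "0 < s" for s
    using moment_weight_square_moment[OF that, of y] by (simp add: g_def)
  \<comment> \<open>The estimate \<open>g \<le> 1 + g^2\<close> reduces the mean of the weight to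
    its second moment, which explains the two summands in \<open>D\<close>.\<close>
  have b1: "\<Psi> s \<le> ennreal (D / s)" if s: "\<sigma> \<le> s" for s
  proof -
    have s0: "0 < s" using s \<sigma> by simp
    have "\<Psi> s \<le> (\<integral>\<^sup>+ x. ennreal (C1 / s) * (ennreal (heat (x - y) s) + ennreal (heat (x - y) s * (g (x, s))\<^sup>2)) \<partial>lborel)"
      unfolding \<Psi>_def
    proof (rule nn_integral_mono)
      fix x
      have "2 * g (x, s) \<le> (g (x, s))\<^sup>2 + 1" using sum_squares_bound[of "g (x, s)" 1] by simp
      then have "g (x, s) \<le> 1 + (g (x, s))\<^sup>2" using g0[of "(x, s)"] s0 by simp
      then have "ennreal (g (x, s)) \<le> ennreal (1 + (g (x, s))\<^sup>2)" by (rule ennreal_leI)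
      then have "h (x, s) * ennreal (g (x, s)) \<le> (ennreal (C1 / s) * ennreal (heat (x - y) s)) * ennreal (1 + (g (x, s))\<^sup>2)"
        by (intro mult_mono h_slice s) auto
      also have "\<dots> = ennreal (C1 / s) * (ennreal (heat (x - y) s) + ennreal (heat (x - y) s * (g (x, s))\<^sup>2))"
        by (simp add: ennreal_mult' distrib_left mult_ac)
      finally show "h (x, s) * ennreal (g (x, s))
        \<le> ennreal (C1 / s) * (ennreal (heat (x - y) s) + ennreal (heat (x - y) s * (g (x, s))\<^sup>2))" .
    qed
    also have "\<dots> = ennreal (C1 / s) * (1 + (\<integral>\<^sup>+ x. ennreal (heat (x - y) s * (g (x, s))\<^sup>2) \<partial>lborel))"
      using s0 by (simp add: nn_integral_cmult nn_integral_add nn_integral_heat_at)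
    also have "\<dots> \<le> ennreal (C1 / s) * (1 + ennreal (512 * 2 ^ DIM('a)))"
      by (intro mult_left_mono add_left_mono g2 s0) simp
    also have "\<dots> = ennreal (C1 / s) * ennreal (1 + 512 * 2 ^ DIM('a))"
      by (subst ennreal_plus) simp_all
    also have "\<dots> = ennreal (D / s)"
      using C1 s0 by (subst ennreal_mult'[symmetric]) (simp_all add: D_def)
    finally show ?thesis .
  qed
  have b2: "(\<Psi> s)\<^sup>2 \<le> f s * ennreal (D / s)" if s: "\<sigma> \<le> s" for s
  proof -
    have s0: "0 < s" using s \<sigma> by simp
    \<comment> \<open>Writing \<open>h\<close> as the product of two square roots, Cauchy-Schwarz
      yields \<open>f s\<close> from one factor and the second moment of the weight from the other,
      so that one factor of the mean is kept.\<close>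
    define e where "e x = sqrt (U (x, s) * heat (x - y) s)" for x
    have [measurable]: "e \<in> borel_measurable borel" unfolding e_def[abs_def] by measurable
    have e0: "0 \<le> e x" for x by (simp add: e_def U0)
    have e2: "ennreal (e x) ^ 2 = h (x, s)" for x
      using s0 U0[of "(x, s)"] by (simp add: e_def h_def hk_def ennreal_power ennreal_mult')
    have "\<Psi> s = (\<integral>\<^sup>+ x. ennreal (e x) * ennreal (e x * g (x, s)) \<partial>lborel)"
      unfolding \<Psi>_def
    proof (rule nn_integral_cong)
      fix x
      show "h (x, s) * ennreal (g (x, s)) = ennreal (e x) * ennreal (e x * g (x, s))"
        unfolding e2[symmetric] using e0[of x] by (simp add: power2_eq_square ennreal_mult' mult.assoc)
    qed
    then have "(\<Psi> s)\<^sup>2 = (\<integral>\<^sup>+ x. ennreal (e x) * ennreal (e x * g (x, s)) \<partial>lborel)\<^sup>2" by simp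
    also have "\<dots> \<le> (\<integral>\<^sup>+ x. ennreal (e x) ^ 2 \<partial>lborel) * (\<integral>\<^sup>+ x. ennreal (e x * g (x, s)) ^ 2 \<partial>lborel)"
      by (rule Cauchy_Schwarz_nn_integral) measurable
    also have "(\<integral>\<^sup>+ x. ennreal (e x) ^ 2 \<partial>lborel) = f s" by (simp add: e2 f_def)
    also have "(\<integral>\<^sup>+ x. ennreal (e x * g (x, s)) ^ 2 \<partial>lborel) \<le> (\<integral>\<^sup>+ x. ennreal (C1 / s) * ennreal (heat (x - y) s * (g (x, s))\<^sup>2) \<partial>lborel)"
    proof (rule nn_integral_mono)
      fix x
      have "ennreal (e x * g (x, s)) ^ 2 = h (x, s) * ennreal ((g (x, s))\<^sup>2)"
        unfolding e2[symmetric] using e0[of x] g0[of "(x, s)"] s0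
        by (simp add: ennreal_mult' power_mult_distrib ennreal_power)
      also have "\<dots> \<le> (ennreal (C1 / s) * ennreal (heat (x - y) s)) * ennreal ((g (x, s))\<^sup>2)"
        by (intro mult_right_mono h_slice s) simp
      also have "\<dots> = ennreal (C1 / s) * ennreal (heat (x - y) s * (g (x, s))\<^sup>2)"
        by (simp add: ennreal_mult' mult_ac)
      finally show "ennreal (e x * g (x, s)) ^ 2 \<le> ennreal (C1 / s) * ennreal (heat (x - y) s * (g (x, s))\<^sup>2)" .
    qed
    also have "\<dots> = ennreal (C1 / s) * (\<integral>\<^sup>+ x. ennreal (heat (x - y) s * (g (x, s))\<^sup>2) \<partial>lborel)"
      by (rule nn_integral_cmult) measurable
    also have "\<dots> \<le> ennreal (C1 / s) * ennreal (512 * 2 ^ DIM('a))"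
      by (intro mult_left_mono g2 s0) simp
    also have "\<dots> \<le> ennreal (D / s)"
      using C1 s0 by (simp add: ennreal_mult'[symmetric] D_def ennreal_leI divide_right_mono)
    finally show ?thesis by (simp add: mult_left_mono)
  qed
  have f0: "f s = 0 \<and> \<Psi> s = 0" if "s < \<sigma> \<or> t \<le> s" for s
    using that by (simp add: f_def \<Psi>_def h0)
  let ?near = "\<lambda>q r::'a \<times> real. of_bool (snd q \<le> 16 * snd r) :: ennreal"
  let ?far = "\<lambda>q r::'a \<times> real. of_bool (16 * snd r < snd q) :: ennreal"
  have split: "(\<integral>\<^sup>+ q. ennreal (U q) * conv hk (\<lambda>r. ennreal (U r) * hk_at y r) q \<partial>lborel)
     = (\<integral>\<^sup>+ q. \<integral>\<^sup>+ r. ennreal (U q) * hk (q - r) * h r * ?near q r \<partial>lborel \<partial>lborel)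
     + (\<integral>\<^sup>+ q. \<integral>\<^sup>+ r. ennreal (U q) * hk (q - r) * h r * ?far q r \<partial>lborel \<partial>lborel)"
  proof -
    have "(\<integral>\<^sup>+ q. ennreal (U q) * conv hk (\<lambda>r. ennreal (U r) * hk_at y r) q \<partial>lborel)
       = (\<integral>\<^sup>+ q. \<integral>\<^sup>+ r. ennreal (U q) * hk (q - r) * h r \<partial>lborel \<partial>lborel)"
      unfolding conv_def h_def[symmetric]
      by (simp add: nn_integral_cmult[symmetric] mult.assoc)
    also have "\<dots> = (\<integral>\<^sup>+ q. \<integral>\<^sup>+ r. ennreal (U q) * hk (q - r) * h r * ?near q r + ennreal (U q) * hk (q - r) * h r * ?far q r \<partial>lborel \<partial>lborel)"
      by (intro nn_integral_cong) auto
    finally show ?thesis by (simp add: nn_integral_add)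
  qed
  \<comment> \<open>Near pairs: given the earlier point \<open>r\<close>, the potential is at most
    \<open>C1 / snd r\<close> during a time \<open>15 * snd r\<close>, and the heat flow from
    \<open>r\<close> has unit mass.\<close>
  have A: "(\<integral>\<^sup>+ q. \<integral>\<^sup>+ r. ennreal (U q) * hk (q - r) * h r * ?near q r \<partial>lborel \<partial>lborel) \<le> ennreal (15 * C1) * m"
  proof -
    have "(\<integral>\<^sup>+ q. \<integral>\<^sup>+ r. ennreal (U q) * hk (q - r) * h r * ?near q r \<partial>lborel \<partial>lborel)
       = (\<integral>\<^sup>+ r. \<integral>\<^sup>+ q. h r * (ennreal (U q) * hk (q - r) * ?near q r) \<partial>lborel \<partial>lborel)"
      by (subst lborel_pair.Fubini') (simp_all add: mult_ac)
    also have "\<dots> = (\<integral>\<^sup>+ r. h r * (\<integral>\<^sup>+ q. ennreal (U q) * hk (q - r) * ?near q r \<partial>lborel) \<partial>lborel)"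
      by (simp add: nn_integral_cmult)
    also have "\<dots> \<le> (\<integral>\<^sup>+ r. h r * ennreal (15 * C1) \<partial>lborel)"
    proof (rule nn_integral_mono)
      fix r
      show "h r * (\<integral>\<^sup>+ q. ennreal (U q) * hk (q - r) * ?near q r \<partial>lborel) \<le> h r * ennreal (15 * C1)"
      proof (cases "\<sigma> \<le> snd r")
        case True
        then have r0: "0 < snd r" using \<sigma> by simp
        have "(\<integral>\<^sup>+ q. ennreal (U q) * hk (q - r) * ?near q r \<partial>lborel)
           \<le> (\<integral>\<^sup>+ q. ennreal (C1 / snd r) * (indicator {..15 * snd r} (snd (q - r)) * hk (q - r)) \<partial>lborel)"
        proof (rule nn_integral_mono)
          fix q
          show "ennreal (U q) * hk (q - r) * ?near q r \<le> ennreal (C1 / snd r) * (indicator {..15 * snd r} (snd (q - r)) * hk (q - r))"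
          proof (cases "snd r < snd q \<and> snd q \<le> 16 * snd r")
            case q: True
            have "U q \<le> C1 / snd q" using q True by (intro le) simp
            also have "\<dots> \<le> C1 / snd r" using q r0 C1 by (intro divide_left_mono) auto
            finally have "ennreal (U q) \<le> ennreal (C1 / snd r)" by (rule ennreal_leI)
            then show ?thesis using q by (simp add: mult_right_mono)
          qed auto
        qed
        also have "\<dots> = ennreal (C1 / snd r) * (\<integral>\<^sup>+ q. indicator {..15 * snd r} (snd (q - r)) * hk (q - r) \<partial>lborel)"
          by (rule nn_integral_cmult) measurable
        also have "(\<integral>\<^sup>+ q. indicator {..15 * snd r} (snd (q - r)) * hk (q - r) \<partial>lborel)
           = (\<integral>\<^sup>+ q. indicator {..15 * snd r} (snd q) * hk (q :: 'a \<times> real) \<partial>lborel)"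
          by (rule nn_integral_lborel_shift_minus) measurable
        also have "\<dots> = (\<integral>\<^sup>+ s\<in>{0<..}. indicator {..15 * snd r} s \<partial>lborel)"
          using nn_integral_hk_strip[of "indicator {..15 * snd r}" "0::'a"] by (simp add: zero_prod_def[symmetric])
        also have "\<dots> = (\<integral>\<^sup>+ s. indicator {0<..15 * snd r} s \<partial>lborel)"
          by (intro nn_integral_cong) (auto split: split_indicator)
        also have "\<dots> = ennreal (15 * snd r)" using r0 by simp
        also have "ennreal (C1 / snd r) * ennreal (15 * snd r) = ennreal (15 * C1)"
          using r0 C1 by (simp add: ennreal_mult'[symmetric])
        finally show ?thesis by (rule mult_left_mono) simp
      qed (simp add: h0)
    qed
    also have "\<dots> = m * ennreal (15 * C1)"
      unfolding m_def h_def[symmetric] by (rule nn_integral_multc) measurable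
    finally show ?thesis by (simp add: mult.commute)
  qed
  \<comment> \<open>The density \<open>h\<close> multiplied by the error factor
    \<open>1 + \<rho> * g\<close>. Its space integral is \<open>f + \<rho> * \<Psi>\<close>, the
    factor in \<open>time_double_bound\<close>.\<close>
  define k where "k \<rho> q = h q + ennreal \<rho> * (h q * ennreal (g q))" for \<rho> q
  have [measurable]: "(\<lambda>z. k (a z) (b z)) \<in> borel_measurable M"
    if [measurable]: "a \<in> borel_measurable M" "b \<in> borel_measurable M" for a b and M :: "'z measure"
    unfolding k_def by measurable
  have pw: "ennreal (U q) * hk (q - r) * h r * ?far q r
      \<le> ennreal c0 * (k (sqrt (snd r / snd q)) q * k (sqrt (snd r / snd q)) r * ?far q r)" for q r
  proof (cases "\<sigma> \<le> snd r \<and> 16 * snd r < snd q")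
    case True
    then have r: "0 < snd r" "16 * snd r < snd q" "0 < snd q" "snd r < snd q" using \<sigma> by auto
    define \<rho> where "\<rho> = sqrt (snd r / snd q)"
    have \<rho>: "0 \<le> \<rho>" "\<rho> \<le> 1 / 4"
    proof -
      show "0 \<le> \<rho>" using r by (simp add: \<rho>_def)
      have "snd r / snd q \<le> (1 / 4)\<^sup>2" using r by (simp add: power2_eq_square field_simps)
      then have "sqrt (snd r / snd q) \<le> sqrt ((1 / 4)\<^sup>2)" by (rule real_sqrt_le_mono)
      then show "\<rho> \<le> 1 / 4" by (simp add: \<rho>_def)
    qed
    have ex: "exp (\<rho> / 4 * ((norm (fst p - y))\<^sup>2 / snd p)) \<le> 1 + \<rho> * g p" if "0 < snd p" for p
      unfolding g_def using that by (intro exp_le_moment_weight \<rho>) simp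
    have "heat (fst q - fst r) (snd q - snd r) = heat ((fst q - y) - (fst r - y)) (snd q - snd r)" by simp
    also have "\<dots> \<le> c0 * heat (fst q - y) (snd q) * exp (\<rho> / 4 * ((norm (fst q - y))\<^sup>2 / snd q))
        * exp (\<rho> / 4 * ((norm (fst r - y))\<^sup>2 / snd r))"
      unfolding c0_def \<rho>_def by (rule heat_offdiagonal) (use r in auto)
    also have "\<dots> \<le> c0 * heat (fst q - y) (snd q) * (1 + \<rho> * g q) * (1 + \<rho> * g r)"
      using g0[of q] g0[of r] r \<rho> by (intro mult_mono ex order_refl) (auto simp: c0_def)
    finally have "hk (q - r) \<le> ennreal (c0 * heat (fst q - y) (snd q) * (1 + \<rho> * g q) * (1 + \<rho> * g r))"
      using r by (simp add: hk_def ennreal_leI)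
    also have "\<dots> = ennreal c0 * hk_at y q * ennreal (1 + \<rho> * g q) * ennreal (1 + \<rho> * g r)"
      using r g0[of q] \<rho> by (simp add: hk_def c0_def ennreal_mult')
    finally have 1: "hk (q - r) \<le> ennreal c0 * hk_at y q * ennreal (1 + \<rho> * g q) * ennreal (1 + \<rho> * g r)" .
    have ke: "k \<rho> p = h p * ennreal (1 + \<rho> * g p)" if "0 < snd p" for p
      using g0[OF that] \<rho> by (simp add: k_def distrib_left ennreal_mult' mult_ac)
    have "ennreal (U q) * hk (q - r) * h r \<le> ennreal (U q) * (ennreal c0 * hk_at y q * ennreal (1 + \<rho> * g q) * ennreal (1 + \<rho> * g r)) * h r"
      by (intro mult_right_mono mult_left_mono 1) simp_all
    also have "\<dots> = ennreal c0 * (k \<rho> q * k \<rho> r)"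
      unfolding ke[OF r(1)] ke[OF r(3)] h_def[of q] by (simp add: mult_ac)
    finally show ?thesis using True by (simp add: \<rho>_def)
  next
    case False
    then show ?thesis using h0[of r] by (auto simp: not_le)
  qed
  have kint: "(\<integral>\<^sup>+ x. k \<rho> (x, s) \<partial>lborel) = f s + ennreal \<rho> * \<Psi> s" for \<rho> s
    unfolding k_def f_def \<Psi>_def by (simp add: nn_integral_add nn_integral_cmult)
  have B: "(\<integral>\<^sup>+ q. \<integral>\<^sup>+ r. ennreal (U q) * hk (q - r) * h r * ?far q r \<partial>lborel \<partial>lborel)
     \<le> ennreal c0 * (m * m + ennreal (4 * D) * m)"
  proof -
    let ?r = "\<lambda>s r. sqrt (r / s)"
    have "(\<integral>\<^sup>+ q. \<integral>\<^sup>+ r. ennreal (U q) * hk (q - r) * h r * ?far q r \<partial>lborel \<partial>lborel)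
       \<le> (\<integral>\<^sup>+ q. \<integral>\<^sup>+ r. ennreal c0 * (k (?r (snd q) (snd r)) q * k (?r (snd q) (snd r)) r * ?far q r) \<partial>lborel \<partial>lborel)"
      by (intro nn_integral_mono pw)
    also have "\<dots> = ennreal c0 * (\<integral>\<^sup>+ q. \<integral>\<^sup>+ r. k (?r (snd q) (snd r)) q * k (?r (snd q) (snd r)) r * ?far q r \<partial>lborel \<partial>lborel)"
      by (simp add: nn_integral_cmult)
    also have "(\<integral>\<^sup>+ q. \<integral>\<^sup>+ r. k (?r (snd q) (snd r)) q * k (?r (snd q) (snd r)) r * ?far q r \<partial>lborel \<partial>lborel)
       = (\<integral>\<^sup>+ s. \<integral>\<^sup>+ x. (\<integral>\<^sup>+ r. k (?r s (snd r)) (x, s) * k (?r s (snd r)) r * of_bool (16 * snd r < s) \<partial>lborel) \<partial>lborel \<partial>lborel)"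
      by (subst nn_integral_lborel_pair(1)) simp_all
    also have "\<dots> = (\<integral>\<^sup>+ s. \<integral>\<^sup>+ x. (\<integral>\<^sup>+ r. \<integral>\<^sup>+ z. (k (?r s r) (x, s) * of_bool (16 * r < s)) * k (?r s r) (z, r) \<partial>lborel \<partial>lborel) \<partial>lborel \<partial>lborel)"
      by (subst nn_integral_lborel_pair(1)) (simp_all add: mult_ac)
    also have "\<dots> = (\<integral>\<^sup>+ s. \<integral>\<^sup>+ x. (\<integral>\<^sup>+ r. k (?r s r) (x, s) * (of_bool (16 * r < s) * (f r + ennreal (?r s r) * \<Psi> r)) \<partial>lborel) \<partial>lborel \<partial>lborel)"
      by (subst nn_integral_cmult) (simp_all add: kint mult.assoc)
    also have "\<dots> = (\<integral>\<^sup>+ s. \<integral>\<^sup>+ r. (\<integral>\<^sup>+ x. k (?r s r) (x, s) * (of_bool (16 * r < s) * (f r + ennreal (?r s r) * \<Psi> r)) \<partial>lborel) \<partial>lborel \<partial>lborel)"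
      by (intro nn_integral_cong lborel_pair.Fubini') measurable
    also have "\<dots> = (\<integral>\<^sup>+ s. \<integral>\<^sup>+ r. (f s + ennreal (?r s r) * \<Psi> s) * (of_bool (16 * r < s) * (f r + ennreal (?r s r) * \<Psi> r)) \<partial>lborel \<partial>lborel)"
      by (subst nn_integral_multc) (simp_all add: kint)
    also have "\<dots> = (\<integral>\<^sup>+ s. \<integral>\<^sup>+ r. (f s + ennreal (?r s r) * \<Psi> s) * (f r + ennreal (?r s r) * \<Psi> r) * of_bool (16 * r < s) \<partial>lborel \<partial>lborel)"
      by (simp add: mult_ac)
    also have "\<dots> \<le> m * m + ennreal (4 * D) * m"
      unfolding mf by (rule time_double_bound[OF _ _ \<sigma> D f0 b1 b2]) auto
    finally show ?thesis by (simp add: mult_left_mono)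
  qed
  show ?thesis
    unfolding split c0_def[symmetric] using add_mono[OF A B] by (simp add: add.commute)
qed

section \<open>Mass loss and the set of infinite potential\<close>

lemma nn_integral_hk_slice:
  "0 < t \<Longrightarrow> (\<integral>\<^sup>+ x. hk_at y (x, t) \<partial>lborel) = 1" for y :: "'a::euclidean_space"
  using nn_integral_heat_at[of t y] by (simp add: hk_def)

text \<open>The heat flow conserves mass, so every source before time \<open>t\<close> counts in
  full.\<close>

lemma nn_integral_conv_slice:
  fixes f :: "'a::euclidean_space \<times> real \<Rightarrow> ennreal"
  assumes [measurable]: "f \<in> borel_measurable borel"
  shows "(\<integral>\<^sup>+ x. conv hk f (x, t) \<partial>lborel) = (\<integral>\<^sup>+ q. f q * indicator {..<t} (snd q) \<partial>lborel)"
proof -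
  have "(\<integral>\<^sup>+ x. conv hk f (x, t) \<partial>lborel) = (\<integral>\<^sup>+ q. \<integral>\<^sup>+ x. hk ((x, t) - q) * f q \<partial>lborel \<partial>lborel)"
    unfolding conv_def by (rule lborel_pair.Fubini') measurable
  also have "\<dots> = (\<integral>\<^sup>+ q. (\<integral>\<^sup>+ x. hk ((x, t) - q) \<partial>lborel) * f q \<partial>lborel)"
    by (simp add: nn_integral_multc)
  also have "\<dots> = (\<integral>\<^sup>+ q. f q * indicator {..<t} (snd q) \<partial>lborel)"
  proof (rule nn_integral_cong)
    fix q :: "'a \<times> real"
    show "(\<integral>\<^sup>+ x. hk ((x, t) - q) \<partial>lborel) * f q = f q * indicator {..<t} (snd q)"
      using nn_integral_heat_at[of "t - snd q" "fst q"]
      by (cases q; cases "snd q < t") (auto simp: hk_def)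
  qed
  finally show ?thesis .
qed

section \<open>Mass balance and mass loss\<close>

context singular_potential
begin

text \<open>For each truncation the mass left at time \<open>T\<close> and the mass absorbed before
  add up to one. Under the assumption \<open>V\<close> times the heat kernel is an integrable
  majorant down to time \<open>0\<close>, so both parts converge, and the sum of their limits is
  \<open>trace_weight y\<close>.\<close>

lemma trace_weight_of_finite:
  assumes fin: "(\<integral>\<^sup>+ q. ennreal (V q) * hk_at y q \<partial>lborel) < \<infinity>"
  shows "trace_weight y = 1"
proof -
  let ?B = "\<lambda>n. \<integral>\<^sup>+ q. (ennreal (Vk n q) * w n y q) * indicator {..<T} (snd q) \<partial>lborel"
  let ?B' = "\<integral>\<^sup>+ q. (ennreal (V q) * wV y q) * indicator {..<T} (snd q) \<partial>lborel"
  have one: "(\<integral>\<^sup>+ x. w n y (x, T) \<partial>lborel) + ?B n = 1" for n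
  proof -
    have "(\<integral>\<^sup>+ x. hk_at y (x, T) \<partial>lborel)
        = (\<integral>\<^sup>+ x. w n y (x, T) + conv hk (\<lambda>q. ennreal (Vk n q) * w n y q) (x, T) \<partial>lborel)"
      by (simp only: w_duhamel)
    also have "\<dots> = (\<integral>\<^sup>+ x. w n y (x, T) \<partial>lborel) + (\<integral>\<^sup>+ x. conv hk (\<lambda>q. ennreal (Vk n q) * w n y q) (x, T) \<partial>lborel)"
      by (rule nn_integral_add) measurable
    finally show ?thesis
      using T_pos by (simp add: nn_integral_hk_slice nn_integral_conv_slice del: diff_Pair)
  qed
  have trace_weight: "mass y T + ?B' = trace_weight y"
  proof -
    have "(\<integral>\<^sup>+ x. hV y (x, T) \<partial>lborel) = mass y T + (\<integral>\<^sup>+ x. conv hk (\<lambda>q. ennreal (V q) * wV y q) (x, T) \<partial>lborel)"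
      unfolding hV_def mass_def by (rule nn_integral_add) measurable
    moreover have "(\<integral>\<^sup>+ x. hV y (x, T) \<partial>lborel) = trace_weight y"
      unfolding hV_eq using T_pos by (simp add: nn_integral_cmult nn_integral_hk_slice del: diff_Pair)
    ultimately show ?thesis by (simp add: nn_integral_conv_slice)
  qed
  have "(\<lambda>n. \<integral>\<^sup>+ x. w n y (x, T) \<partial>lborel) \<longlonglongrightarrow> mass y T"
    unfolding mass_def
  proof (rule nn_integral_dominated_convergence[where w="\<lambda>x. hk_at y (x, T)"])
    show "AE x in lborel. w n y (x, T) \<le> hk_at y (x, T)" for n by (intro AE_I2 w_le)
    show "(\<integral>\<^sup>+ x. hk_at y (x, T) \<partial>lborel) < \<infinity>" using T_pos by (simp add: nn_integral_hk_slice del: diff_Pair)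
    show "AE x in lborel. (\<lambda>n. w n y (x, T)) \<longlonglongrightarrow> wV y (x, T)" by (intro AE_I2 w_tendsto)
  qed measurable
  moreover have "?B \<longlonglongrightarrow> ?B'"
  proof (rule nn_integral_dominated_convergence[where w="\<lambda>q. ennreal (V q) * hk_at y q"])
    show "AE q in lborel. (ennreal (Vk n q) * w n y q) * indicator {..<T} (snd q) \<le> ennreal (V q) * hk_at y q" for n
      by (intro AE_I2) (auto split: split_indicator intro!: mult_mono w_le ennreal_leI Vk_le_V)
    show "AE q in lborel. (\<lambda>n. (ennreal (Vk n q) * w n y q) * indicator {..<T} (snd q)) \<longlonglongrightarrow> (ennreal (V q) * wV y q) * indicator {..<T} (snd q)"
      using Vw_tendsto by (intro AE_I2) (auto split: split_indicator)
  qed (use fin in measurable)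
  ultimately have "(\<lambda>n. (\<integral>\<^sup>+ x. w n y (x, T) \<partial>lborel) + ?B n) \<longlonglongrightarrow> trace_weight y"
    unfolding trace_weight[symmetric] by (rule tendsto_add)
  then show ?thesis unfolding one using LIMSEQ_unique tendsto_const by blast
qed

text \<open>Away from time \<open>0\<close> the potential is bounded and lives on a strip of finite
  height, so an infinite integral must diverge at the initial time.\<close>

lemma V_tail_finite:
  assumes t: "0 < t"
  shows "(\<integral>\<^sup>+ q. ennreal (V q) * hk_at y q * indicator {t..} (snd q) \<partial>lborel) < \<infinity>"
proof -
  have "(\<integral>\<^sup>+ q. ennreal (V q) * hk_at y q * indicator {t..} (snd q) \<partial>lborel)
     \<le> (\<integral>\<^sup>+ q. ennreal (C1 / t) * (indicator {..T} (snd q) * hk_at y q) \<partial>lborel)"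
  proof (rule nn_integral_mono)
    fix q
    show "ennreal (V q) * hk_at y q * indicator {t..} (snd q) \<le> ennreal (C1 / t) * (indicator {..T} (snd q) * hk_at y q)"
    proof (cases "t \<le> snd q \<and> snd q \<le> T")
      case True
      then have "ennreal (V q) \<le> ennreal (C1 / t)" using V_le_tau[OF t] by (intro ennreal_leI) auto
      then show ?thesis using True by (simp add: mult_right_mono)
    next
      case False
      then show ?thesis using V_out[of q] by (auto simp: mem_QT)
    qed
  qed
  also have "\<dots> = ennreal (C1 / t) * (\<integral>\<^sup>+ s\<in>{0<..}. indicator {..T} s \<partial>lborel)"
    using nn_integral_hk_strip[of "indicator {..T}" y] by (simp add: nn_integral_cmult)
  also have "(\<integral>\<^sup>+ s\<in>{0<..}. indicator {..T} s \<partial>lborel) = (\<integral>\<^sup>+ s. indicator {0<..T} s \<partial>lborel)"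
    by (intro nn_integral_cong) (auto split: split_indicator)
  also have "ennreal (C1 / t) * \<dots> < \<infinity>"
    using T_pos by (simp add: ennreal_mult_less_top)
  finally show ?thesis .
qed

text \<open>Damping the truncated potential by a factor of order \<open>1/m\<close> balances its first moment \<open>m\<close> against
  its second moment, which is \<open>O(m\<^sup>2)\<close>: a fixed fraction of the mass is lost before time \<open>t\<close>.\<close>

lemma mass_loss:
  assumes \<sigma>: "0 < \<sigma>" and K: "K = 2 powr (real DIM('a) / 2) * (1 + 4 * (C1 * (1 + 512 * 2 ^ DIM('a)))) + 15 * C1"
    and m: "1 \<le> (\<integral>\<^sup>+ q. ennreal (V q * indicator {\<sigma>..<t} (snd q)) * hk_at y q \<partial>lborel)" and t: "0 < t"
  shows "mass y t \<le> ennreal (1 - 1 / (4 * K))"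
proof -
  \<comment> \<open>The cut at \<open>\<sigma>\<close> makes the first moment finite, and the cut at
    \<open>t\<close> places all absorption before time \<open>t\<close>.\<close>
  define U where "U q = V q * indicator {\<sigma>..<t} (snd q)" for q
  have [measurable]: "U \<in> borel_measurable borel" unfolding U_def[abs_def] by measurable
  have U0: "0 \<le> U q" for q by (simp add: U_def V_nonneg)
  have U_out: "U q = 0" if "snd q < \<sigma> \<or> t \<le> snd q" for q using that by (auto simp: U_def)
  have U_le_V: "U q \<le> V q" for q by (simp add: U_def V_nonneg split: split_indicator)
  have U_le: "U q \<le> C1 / snd q" if "\<sigma> \<le> snd q" for q
  proof (cases "q \<in> QT T")
    case True
    then show ?thesis using U_le_V[of q] V_le[of q] by linarith
  next
    case False
    have "0 \<le> C1 / snd q" using that \<sigma> C1_pos by simp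
    then show ?thesis using U_le_V[of q] V_out[OF False] by linarith
  qed
  define M where "M = (\<integral>\<^sup>+ q. ennreal (U q) * hk_at y q \<partial>lborel)"
  define Q where "Q = (\<integral>\<^sup>+ q. ennreal (U q) * conv hk (\<lambda>r. ennreal (U r) * hk_at y r) q \<partial>lborel)"
  define c0 where "c0 = 2 powr (real DIM('a) / 2)"
  define D where "D = C1 * (1 + 512 * 2 ^ DIM('a))"
  have c0: "1 \<le> c0" unfolding c0_def by (simp add: ge_one_powr_ge_zero)
  have D: "0 < D" using C1_pos by (simp add: D_def add_pos_pos)
  have K_eq: "K = c0 * (1 + 4 * D) + 15 * C1" by (simp add: K c0_def D_def)
  have K1: "1 \<le> K"
  proof -
    have "1 * 1 \<le> c0 * (1 + 4 * D)" using c0 D by (intro mult_mono) auto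
    then show ?thesis using C1_pos by (simp add: K_eq)
  qed
  have Q: "Q \<le> ennreal c0 * (M * M + ennreal (4 * D) * M) + ennreal (15 * C1) * M"
    unfolding Q_def M_def c0_def D_def
    by (rule second_moment_bound[OF _ U0 \<sigma> C1_pos U_out U_le]) auto
  have M_fin: "M < \<top>"
  proof -
    have "M \<le> (\<integral>\<^sup>+ q. ennreal (V q) * hk_at y q * indicator {\<sigma>..} (snd q) \<partial>lborel)"
      unfolding M_def U_def by (intro nn_integral_mono) (auto split: split_indicator)
    also have "\<dots> < \<infinity>" by (rule V_tail_finite[OF \<sigma>])
    finally show ?thesis by simp
  qed
  then obtain \<mu> where \<mu>: "M = ennreal \<mu>" "0 \<le> \<mu>" by (cases M) auto
  have \<mu>1: "1 \<le> \<mu>" using m \<mu> unfolding M_def[symmetric] U_def[symmetric] by simp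
  \<comment> \<open>With damping \<open>l = \<eta> / \<mu>\<close> the first-order loss is
    \<open>\<eta>\<close> and the second-order correction is at most \<open>K * \<eta>^2\<close>.
    The choice \<open>1 / (2 * K)\<close> maximises the difference, whose value is
    \<open>1 / (4 * K)\<close>.\<close>
  define \<eta> where "\<eta> = 1 / (2 * K)"
  have \<eta>: "0 < \<eta>" "\<eta> \<le> 1" using K1 by (auto simp: \<eta>_def field_simps)
  define l where "l = \<eta> / \<mu>"
  have l: "0 < l" "l \<le> 1" using \<eta> \<mu>1 by (auto simp: l_def field_simps)
  define W where "W q = l * U q" for q
  have W_le_U: "W q \<le> U q" for q using l U0[of q] by (simp add: W_def mult_left_le_one_le)
  interpret W: bounded_potential W "C1 / \<sigma>"
  proof
    show "W \<in> borel_measurable borel" unfolding W_def[abs_def] by measurable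
    show "0 \<le> W q" for q using l U0 by (simp add: W_def)
    show "0 < C1 / \<sigma>" using \<sigma> C1_pos by simp
    show "W q \<le> C1 / \<sigma>" for q
    proof (cases "\<sigma> \<le> snd q")
      case True
      then show ?thesis using W_le_U[of q] U_le_V[of q] V_le_tau[OF \<sigma> True] by linarith
    next
      case False
      then show ?thesis using U_out[of q] \<sigma> C1_pos by (simp add: W_def)
    qed
  qed
  let ?u = "kern W (C1 / \<sigma>) y"
  have W_le_V: "W q \<le> V q" for q using W_le_U U_le_V order_trans by blast
  \<comment> \<open>Comparison with the smaller potential \<open>W\<close> requires the Duhamel
    equation for \<open>wV\<close> with full initial mass, hence weight one. For the other value of
    the weight the mass is zero anyway.\<close>
  have u_ge: "wV y p \<le> ?u p" if "trace_weight y = 1" for p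
  proof -
    have "wV y p \<le> 1 * ?u p"
    proof (rule W.comparison[where f="\<lambda>q. ennreal (V q - W q) * wV y q"])
      fix p
      have s: "ennreal (W q) * a + ennreal (V q - W q) * a = ennreal (V q) * a" for q a
        using W.W_nonneg[of q] W_le_V[of q]
        by (simp add: distrib_right[symmetric] ennreal_plus[symmetric] del: ennreal_plus)
      have "wV y p + conv hk (\<lambda>q. ennreal (W q) * wV y q) p
         + conv hk (\<lambda>q. ennreal (V q - W q) * wV y q) p = hV y p"
        unfolding add.assoc hV_def by (subst conv_add[symmetric]) (auto simp: s)
      then show "wV y p + conv hk (\<lambda>q. ennreal (W q) * wV y q) p
         + conv hk (\<lambda>q. ennreal (V q - W q) * wV y q) p = 1 * hk_at y p"
        by (simp add: hV_eq that)
    qed (auto simp: wV_le)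
    then show ?thesis by simp
  qed
  show ?thesis
  proof (cases "trace_weight y = 1")
    case False
    then have "wV y = (\<lambda>p. 0)" using trace_weight_cases[of y] by (auto split: if_splits)
    then show ?thesis by (simp add: mass_def)
  next
    case True
    let ?Wu = "\<integral>\<^sup>+ q. ennreal (W q) * ?u q \<partial>lborel"
    have "?Wu + mass y t \<le> 1"
    proof -
      have "1 = (\<integral>\<^sup>+ x. ?u (x, t) + conv hk (\<lambda>q. ennreal (W q) * ?u q) (x, t) \<partial>lborel)"
        unfolding W.kern_duhamel using t by (simp only: nn_integral_hk_slice)
      also have "\<dots> = (\<integral>\<^sup>+ x. ?u (x, t) \<partial>lborel) + (\<integral>\<^sup>+ x. conv hk (\<lambda>q. ennreal (W q) * ?u q) (x, t) \<partial>lborel)"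
        by (rule nn_integral_add) measurable
      also have "(\<integral>\<^sup>+ x. conv hk (\<lambda>q. ennreal (W q) * ?u q) (x, t) \<partial>lborel) = ?Wu"
        using U_out by (subst nn_integral_conv_slice) (auto intro!: nn_integral_cong simp: W_def split: split_indicator)
      also have "(\<integral>\<^sup>+ x. ?u (x, t) \<partial>lborel) + ?Wu \<ge> mass y t + ?Wu"
        unfolding mass_def by (intro add_right_mono nn_integral_mono u_ge[OF True])
      finally show ?thesis by (simp add: add.commute)
    qed
    \<comment> \<open>A second-order expansion of the absorbed mass: the heat kernel is written as
      \<open>?u\<close> plus its Duhamel correction, and inside the correction \<open>?u\<close> is
      bounded by the heat kernel again, which produces \<open>Q\<close>.\<close>
    moreover have "ennreal \<eta> \<le> ?Wu + ennreal (l\<^sup>2) * Q"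
    proof -
      have lW: "ennreal (W q) = ennreal l * ennreal (U q)" for q
        using l by (simp add: W_def ennreal_mult')
      have "ennreal \<eta> = ennreal l * M"
        using l \<mu> \<mu>1 by (simp add: \<mu> ennreal_mult'[symmetric] l_def)
      also have "\<dots> = (\<integral>\<^sup>+ q. ennreal (W q) * hk_at y q \<partial>lborel)"
        unfolding M_def lW by (simp add: nn_integral_cmult[symmetric] mult.assoc)
      also have "\<dots> = (\<integral>\<^sup>+ q. ennreal (W q) * ?u q + ennreal (W q) * conv hk (\<lambda>q. ennreal (W q) * ?u q) q \<partial>lborel)"
        unfolding W.kern_duhamel[of y, symmetric] distrib_left ..
      also have "\<dots> = ?Wu + (\<integral>\<^sup>+ q. ennreal (W q) * conv hk (\<lambda>q. ennreal (W q) * ?u q) q \<partial>lborel)"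
        by (rule nn_integral_add) measurable
      also have "\<dots> \<le> ?Wu + (\<integral>\<^sup>+ q. ennreal (W q) * conv hk (\<lambda>q. ennreal (W q) * hk_at y q) q \<partial>lborel)"
        by (intro add_left_mono nn_integral_mono mult_left_mono conv_mono W.kern_le) simp_all
      also have "(\<integral>\<^sup>+ q. ennreal (W q) * conv hk (\<lambda>q. ennreal (W q) * hk_at y q) q \<partial>lborel) = ennreal (l\<^sup>2) * Q"
      proof -
        have "conv hk (\<lambda>q. ennreal (W q) * hk_at y q) q = ennreal l * conv hk (\<lambda>q. ennreal (U q) * hk_at y q) q" for q
          unfolding lW mult.assoc by (rule conv_cmult) measurable
        then have "(\<integral>\<^sup>+ q. ennreal (W q) * conv hk (\<lambda>q. ennreal (W q) * hk_at y q) q \<partial>lborel)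
           = (\<integral>\<^sup>+ q. (ennreal l * ennreal l) * (ennreal (U q) * conv hk (\<lambda>q. ennreal (U q) * hk_at y q) q) \<partial>lborel)"
          by (simp add: lW mult_ac)
        also have "\<dots> = (ennreal l * ennreal l) * Q"
          unfolding Q_def by (rule nn_integral_cmult) measurable
        finally show ?thesis using l by (simp add: ennreal_mult'[symmetric] power2_eq_square)
      qed
      finally show ?thesis .
    qed
    moreover have "ennreal (l\<^sup>2) * Q \<le> ennreal (\<eta> / 2)"
    proof -
      have "Q \<le> ennreal (c0 * (\<mu> * \<mu> + 4 * D * \<mu>) + 15 * C1 * \<mu>)"
        using Q c0 D \<mu>(2) C1_pos unfolding \<mu>(1)
        by (simp add: ennreal_mult'[symmetric] ennreal_plus[symmetric] del: ennreal_plus)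
      \<comment> \<open>The lower bound on the first moment, \<open>\<mu> \<ge> 1\<close>, absorbs
        the linear terms into the square; collecting the coefficients gives
        \<open>K\<close>.\<close>
      also have "\<dots> \<le> ennreal (K * \<mu>\<^sup>2)"
      proof (rule ennreal_leI)
        have "\<mu> * 1 \<le> \<mu> * \<mu>" using \<mu>1 by (intro mult_left_mono) auto
        then have "\<mu> \<le> \<mu> * \<mu>" by simp
        then have "c0 * (\<mu> * \<mu> + 4 * D * \<mu>) + 15 * C1 * \<mu> \<le> c0 * (\<mu> * \<mu> + 4 * D * (\<mu> * \<mu>)) + 15 * C1 * (\<mu> * \<mu>)"
          using c0 D C1_pos \<mu>(2) by (intro add_mono mult_left_mono) auto
        also have "\<dots> = K * \<mu>\<^sup>2" by (simp add: K_eq power2_eq_square algebra_simps)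
        finally show "c0 * (\<mu> * \<mu> + 4 * D * \<mu>) + 15 * C1 * \<mu> \<le> K * \<mu>\<^sup>2" .
      qed
      finally have "ennreal (l\<^sup>2) * Q \<le> ennreal (l\<^sup>2) * ennreal (K * \<mu>\<^sup>2)" by (rule mult_left_mono) simp
      also have "\<dots> = ennreal (l\<^sup>2 * (K * \<mu>\<^sup>2))" by (rule ennreal_mult'[symmetric]) simp
      also have "l\<^sup>2 * (K * \<mu>\<^sup>2) = \<eta> / 2"
        using \<mu>1 K1 by (simp add: l_def \<eta>_def power2_eq_square field_simps)
      finally show ?thesis .
    qed
    ultimately have le: "ennreal \<eta> + mass y t \<le> 1 + ennreal (\<eta> / 2)"
    proof -
      assume 1: "?Wu + mass y t \<le> 1" and 2: "ennreal \<eta> \<le> ?Wu + ennreal (l\<^sup>2) * Q" and 3: "ennreal (l\<^sup>2) * Q \<le> ennreal (\<eta> / 2)"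
      have "ennreal \<eta> + mass y t \<le> (?Wu + ennreal (\<eta> / 2)) + mass y t"
        by (intro add_right_mono order_trans[OF 2] add_left_mono 3)
      also have "\<dots> = (?Wu + mass y t) + ennreal (\<eta> / 2)" by (simp add: ac_simps)
      also have "\<dots> \<le> 1 + ennreal (\<eta> / 2)" by (intro add_right_mono 1)
      finally show ?thesis .
    qed
    have "mass y t < \<top>" using mass_le_1[OF t, of y] by (rule le_less_trans) simp
    then obtain b where b: "mass y t = ennreal b" "0 \<le> b" by (cases "mass y t") auto
    have "ennreal (\<eta> + b) \<le> ennreal (1 + \<eta> / 2)"
      using le \<eta> b by simp
    then have "\<eta> + b \<le> 1 + \<eta> / 2" using \<eta> by (subst (asm) ennreal_le_iff) auto
    then have "b \<le> 1 - 1 / (4 * K)" by (simp add: \<eta>_def field_simps)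
    then show ?thesis unfolding b(1) by (rule ennreal_leI)
  qed
qed

text \<open>The divergence sits at time \<open>0\<close>, so before any \<open>t\<close> there is
  still an infinite integral, and some cut \<open>tau j\<close> leaves a first moment above
  \<open>1\<close>. The fraction lost does not depend on \<open>t\<close>, while a weight of one
  would force the mass to tend to one.\<close>

lemma trace_weight_of_infinite:
  assumes inf: "(\<integral>\<^sup>+ q. ennreal (V q) * hk_at y q \<partial>lborel) = \<infinity>"
  shows "trace_weight y = 0"
proof (rule ccontr)
  assume "trace_weight y \<noteq> 0"
  then have 1: "trace_weight y = 1" using trace_weight_cases[of y] by (auto split: if_splits)
  define K where "K = 2 powr (real DIM('a) / 2) * (1 + 4 * (C1 * (1 + 512 * 2 ^ DIM('a)))) + 15 * C1"
  have K: "0 < K" using C1_pos by (simp add: K_def add_pos_pos)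
  have le: "mass y t \<le> ennreal (1 - 1 / (4 * K))" if t: "0 < t" for t
  proof -
    let ?I = "\<lambda>q. ennreal (V q) * hk_at y q"
    have "(\<integral>\<^sup>+ q. ?I q \<partial>lborel) = (\<integral>\<^sup>+ q. ?I q * indicator {..<t} (snd q) + ?I q * indicator {t..} (snd q) \<partial>lborel)"
      by (intro nn_integral_cong) (auto split: split_indicator)
    also have "\<dots> = (\<integral>\<^sup>+ q. ?I q * indicator {..<t} (snd q) \<partial>lborel) + (\<integral>\<^sup>+ q. ?I q * indicator {t..} (snd q) \<partial>lborel)"
      by (rule nn_integral_add) measurable
    finally have top: "(\<integral>\<^sup>+ q. ?I q * indicator {..<t} (snd q) \<partial>lborel) = \<top>"
      using inf V_tail_finite[OF t, of y] ennreal_add_eq_top[of "\<integral>\<^sup>+ q. ?I q * indicator {..<t} (snd q) \<partial>lborel"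
          "\<integral>\<^sup>+ q. ?I q * indicator {t..} (snd q) \<partial>lborel"]
      unfolding infinity_ennreal_def by (metis less_irrefl)
    have tau_le: "tau n \<le> tau m" if "m \<le> n" for m n
      using tau_decseq that by (auto simp: decseq_def)
    let ?J = "\<lambda>j q. ennreal (V q * indicator {tau j..<t} (snd q)) * hk_at y q"
    have inc1: "incseq (\<lambda>j. ?J j q)" for q
      unfolding incseq_def
      by (auto intro!: mult_right_mono ennreal_leI mult_left_mono V_nonneg split: split_indicator dest!: tau_le)
    have inc: "incseq ?J"
      unfolding incseq_def le_fun_def by (intro allI impI incseqD[OF inc1])
    have "(SUP j. ?J j q) = ?I q * indicator {..<t} (snd q)" for q
    proof -
      have "(\<lambda>j. ?J j q) \<longlonglongrightarrow> ?I q * indicator {..<t} (snd q)"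
      proof (cases "0 < snd q")
        case True
        have "\<forall>\<^sub>F j in sequentially. ?J j q = ?I q * indicator {..<t} (snd q)"
          using order_tendstoD(2)[OF tau_tendsto True] by eventually_elim (auto split: split_indicator)
        then show ?thesis by (rule tendsto_eventually)
      qed simp
      then show ?thesis by (rule LIMSEQ_unique[OF LIMSEQ_SUP[OF inc1]])
    qed
    then have "(SUP j. \<integral>\<^sup>+ q. ?J j q \<partial>lborel) = \<top>"
      using nn_integral_monotone_convergence_SUP[OF inc, of lborel] top by simp
    then have "1 < (SUP j. \<integral>\<^sup>+ q. ?J j q \<partial>lborel)"
      by (simp only: ennreal_one_less_top)
    then obtain j where "1 < (\<integral>\<^sup>+ q. ?J j q \<partial>lborel)"
      unfolding less_SUP_iff by blast
    then show ?thesis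
      using mass_loss[OF tau_pos[of j] K_def less_imp_le t] by simp
  qed
  have "trace_weight y \<le> ennreal (1 - 1 / (4 * K))"
    by (rule LIMSEQ_le_const2[OF mass_tendsto]) (auto intro!: le)
  also have "\<dots> < ennreal 1" using K by (intro ennreal_lessI) auto
  finally show False using 1 by simp
qed

lemma trace_weight_zero_iff_infinite: "trace_weight y = 0 \<longleftrightarrow> (\<integral>\<^sup>+ q. ennreal (V q) * hk_at y q \<partial>lborel) = \<infinity>"
proof (cases "(\<integral>\<^sup>+ q. ennreal (V q) * hk_at y q \<partial>lborel) = \<infinity>")
  case False
  then have "trace_weight y = 1" by (intro trace_weight_of_finite) (simp add: less_top)
  with False show ?thesis by simp
qed (simp add: trace_weight_of_infinite)

end

section \<open>The reduced measure\<close>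

text \<open>Here \<open>V0\<close> is the given potential and \<open>V\<close> the Borel version
  treated so far. The results are transferred to \<open>V0\<close>, whose singular set, infinity set
  and reduced measure are insensitive to null sets.\<close>

locale singular_representative = singular_potential V T C1
  for V :: "'a::euclidean_space \<times> real \<Rightarrow> real" and T C1 :: real +
  fixes V0 :: "'a \<times> real \<Rightarrow> real"
  assumes V0_measurable: "V0 \<in> borel_measurable (lebesgue_on (QT T))"
    and V0_AE: "AE z in lebesgue_on (QT T). V0 z = V z"
begin

lemma V0_AE': "AE z in lebesgue. z \<in> QT T \<longrightarrow> V0 z = V z"
proof -
  have "QT T \<inter> space lebesgue \<in> sets (lebesgue :: ('a \<times> real) measure)" by simp
  from AE_restrict_space_iff[OF this] V0_AE show ?thesis by simp
qed

lemma heat_kernel_kern_real: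
  assumes "(x, t) \<in> QT T"
  shows "heat_kernel T (\<lambda>z. min (V0 z) (real n)) x y t = bp.kern_real n y (x, t)"
proof (rule bp.heat_kernel_eq[OF _ _ assms])
  show "(\<lambda>z. min (V0 z) (real n)) \<in> borel_measurable (lebesgue_on (QT T))"
    using V0_measurable by measurable
  show "AE z in lebesgue_on (QT T). min (V0 z) (real n) = Vk n z"
    using V0_AE by eventually_elim (simp add: Vk_def)
qed

lemma wV_finite: "wV y p < \<top>"
  using wV_le[of y p] hk_less_top(1) by (rule le_less_trans)

lemma sing_kernel_eq:
  assumes "(x, t) \<in> QT T"
  shows "sing_kernel T V0 x y t = enn2real (wV y (x, t))"
proof -
  obtain b where b: "wV y (x, t) = ennreal b" "0 \<le> b" using wV_finite[of y "(x, t)"] by (cases "wV y (x, t)") auto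
  have "(\<lambda>n. ennreal (bp.kern_real n y (x, t))) \<longlonglongrightarrow> ennreal b"
    using w_tendsto[of y "(x, t)"] unfolding b(1) w_def bp.kern_eq_kern_real .
  then have "(\<lambda>n. bp.kern_real n y (x, t)) \<longlonglongrightarrow> b"
    using b(2) by (subst (asm) tendsto_ennreal_iff) auto
  then have "sing_kernel T V0 x y t = b"
    unfolding sing_kernel_def heat_kernel_kern_real[OF assms] by (rule limI)
  then show ?thesis by (simp add: b)
qed

lemma sing_kernel_wV: "(x, t) \<in> QT T \<Longrightarrow> ennreal (sing_kernel T V0 x y t) = wV y (x, t)"
  using wV_finite[of y "(x, t)"] by (simp add: sing_kernel_eq)

lemma Sing_eq: "Sing T V0 = {y. trace_weight y = 0}"
proof -
  have "(\<forall>(x, t)\<in>QT T. sing_kernel T V0 x y t = 0) \<longleftrightarrow> trace_weight y = 0" for y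
  proof -
    have "sing_kernel T V0 x y t = 0 \<longleftrightarrow> wV y (x, t) = 0" if "(x, t) \<in> QT T" for x t
      using wV_finite[of y "(x, t)"] by (auto simp: sing_kernel_eq[OF that] enn2real_eq_0_iff)
    then show ?thesis unfolding trace_weight_zero_iff by fastforce
  qed
  then show ?thesis by (simp add: Sing_def)
qed

lemma Sing_borel [measurable]: "Sing T V0 \<in> sets borel"
proof -
  have "{y \<in> space borel. trace_weight y = 0} \<in> sets borel" by measurable
  then show ?thesis by (simp add: Sing_eq)
qed

lemma trace_weight_indicator: "trace_weight y = indicator (- Sing T V0) y"
  using trace_weight_cases[of y] by (auto simp: Sing_eq split: if_splits)

lemma Zset_eq: "Zset T V0 = Sing T V0"
proof -
  have "(\<integral>\<^sup>+ (y, t) \<in> QT T. ennreal (heat (x - y) t * V0 (y, t)) \<partial>lebesgue) = (\<integral>\<^sup>+ q. ennreal (V q) * hk_at x q \<partial>lborel)" for x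
  proof -
    have "(\<integral>\<^sup>+ (y, t) \<in> QT T. ennreal (heat (x - y) t * V0 (y, t)) \<partial>lebesgue) = (\<integral>\<^sup>+ q. ennreal (V q) * hk_at x q \<partial>lebesgue)"
    proof (rule nn_integral_cong_AE)
      show "AE q in lebesgue. (case q of (y, t) \<Rightarrow> ennreal (heat (x - y) t * V0 (y, t))) * indicator (QT T) q = ennreal (V q) * hk_at x q"
        using V0_AE'
      proof eventually_elim
        case (elim q)
        show ?case
        proof (cases "q \<in> QT T")
          case True
          then show ?thesis using elim
            by (cases q) (simp add: mem_QT hk_def ennreal_mult'' V_nonneg heat_commute[of x] mult.commute)
        qed (simp add: V_out)
      qed
    qed
    then show ?thesis by (simp add: nn_integral_completion)
  qed
  then show ?thesis
    unfolding Sing_eq trace_weight_zero_iff_infinite by (simp add: Zset_def)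
qed

lemma kernel_pot_eq: "(x, t) \<in> QT T \<Longrightarrow> kernel_pot T V0 \<mu> x t = (\<integral>\<^sup>+ y. wV y (x, t) \<partial>\<mu>)"
  by (simp add: kernel_pot_def sing_kernel_wV)

text \<open>The identity \<open>hV_eq\<close> for single poles is integrated against \<mu>;
  sigma-finiteness of \<mu> allows the exchange with the space-time integral.\<close>

lemma kernel_pot_duhamel:
  assumes \<mu>: "\<mu> \<in> MT_nonneg T" and t: "0 < t" "t < T"
  shows "kernel_pot T V0 \<mu> x t +
        (\<integral>\<^sup>+ (y, s) \<in> UNIV \<times> {0<..<t}.
           ennreal (heat (x - y) (t - s) * V0 (y, s)) * kernel_pot T V0 \<mu> y s \<partial>lebesgue)
        = heat_pot (density \<mu> trace_weight) x t"
proof -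
  note sets_\<mu> [measurable_cong] = MT_nonneg_sets[OF \<mu>]
  interpret \<mu>: sigma_finite_measure \<mu> by (rule MT_nonneg_sigma_finite[OF \<mu>])
  interpret pair_sigma_finite lborel \<mu> ..
  note [measurable] = measurable_wV_pair
  have wm: "(\<lambda>y. wV y p) \<in> borel_measurable borel" for p
    by measurable
  have "(\<integral>\<^sup>+ (y, s) \<in> UNIV \<times> {0<..<t}. ennreal (heat (x - y) (t - s) * V0 (y, s)) * kernel_pot T V0 \<mu> y s \<partial>lebesgue)
     = (\<integral>\<^sup>+ q. hk ((x, t) - q) * (ennreal (V q) * (\<integral>\<^sup>+ y. wV y q \<partial>\<mu>)) \<partial>lebesgue)"
  proof (rule nn_integral_cong_AE)
    show "AE q in lebesgue. (case q of (y, s) \<Rightarrow> ennreal (heat (x - y) (t - s) * V0 (y, s)) * kernel_pot T V0 \<mu> y s)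
        * indicator (UNIV \<times> {0<..<t}) q = hk ((x, t) - q) * (ennreal (V q) * (\<integral>\<^sup>+ y. wV y q \<partial>\<mu>))"
      using V0_AE'
    proof eventually_elim
      case (elim q)
      obtain z s where q: "q = (z, s)" by (cases q)
      show ?case
      proof (cases "0 < s \<and> s < t")
        case True
        then have "(z, s) \<in> QT T" using t by (simp add: mem_QT)
        with elim True show ?thesis
          by (simp add: q kernel_pot_eq hk_def ennreal_mult'' V_nonneg mult.assoc)
      next
        \<comment> \<open>At times \<open>s \<ge> t\<close> the kernel \<open>hk\<close> vanishes
          and at \<open>s \<le> 0\<close> the potential, so the integral over the time interval
          extends to all of space-time.\<close>
        case False
        then show ?thesis using V_out[of q] by (auto simp: q mem_QT)
      qed
    qed
  qed
  also have "\<dots> = (\<integral>\<^sup>+ q. hk ((x, t) - q) * (ennreal (V q) * (\<integral>\<^sup>+ y. wV y q \<partial>\<mu>)) \<partial>lborel)"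
    by (rule nn_integral_completion)
  also have "\<dots> = (\<integral>\<^sup>+ q. \<integral>\<^sup>+ y. hk ((x, t) - q) * (ennreal (V q) * wV y q) \<partial>\<mu> \<partial>lborel)"
  proof (rule nn_integral_cong)
    fix q
    have [measurable]: "(\<lambda>y. wV y q) \<in> borel_measurable \<mu>" by measurable
    show "hk ((x, t) - q) * (ennreal (V q) * (\<integral>\<^sup>+ y. wV y q \<partial>\<mu>)) = (\<integral>\<^sup>+ y. hk ((x, t) - q) * (ennreal (V q) * wV y q) \<partial>\<mu>)"
      by (simp add: nn_integral_cmult)
  qed
  also have "\<dots> = (\<integral>\<^sup>+ y. \<integral>\<^sup>+ q. hk ((x, t) - q) * (ennreal (V q) * wV y q) \<partial>lborel \<partial>\<mu>)"
    by (rule Fubini'[symmetric]) measurable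
  also have "\<dots> = (\<integral>\<^sup>+ y. conv hk (\<lambda>q. ennreal (V q) * wV y q) (x, t) \<partial>\<mu>)"
    by (simp add: conv_def)
  finally have "kernel_pot T V0 \<mu> x t +
        (\<integral>\<^sup>+ (y, s) \<in> UNIV \<times> {0<..<t}. ennreal (heat (x - y) (t - s) * V0 (y, s)) * kernel_pot T V0 \<mu> y s \<partial>lebesgue)
     = (\<integral>\<^sup>+ y. wV y (x, t) \<partial>\<mu>) + (\<integral>\<^sup>+ y. conv hk (\<lambda>q. ennreal (V q) * wV y q) (x, t) \<partial>\<mu>)"
    using t by (simp add: kernel_pot_eq mem_QT)
  also have "\<dots> = (\<integral>\<^sup>+ y. hV y (x, t) \<partial>\<mu>)"
    unfolding hV_def by (rule nn_integral_add[symmetric]) measurable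
  also have "\<dots> = (\<integral>\<^sup>+ y. trace_weight y * ennreal (heat (x - y) t) \<partial>\<mu>)"
    using t by (simp add: hV_eq hk_def)
  also have "\<dots> = heat_pot (density \<mu> trace_weight) x t"
    unfolding heat_pot_def by (rule nn_integral_density[symmetric]) measurable
  finally show ?thesis .
qed

lemma density_trace_weight_MT:
  assumes \<mu>: "\<mu> \<in> MT_nonneg T"
  shows "density \<mu> trace_weight \<in> MT_nonneg T"
proof -
  note sets_\<mu> [measurable_cong] = MT_nonneg_sets[OF \<mu>]
  have le: "(\<integral>\<^sup>+ y. trace_weight y * f y \<partial>\<mu>) \<le> (\<integral>\<^sup>+ y. f y \<partial>\<mu>)" for f
    using mult_right_mono[OF trace_weight_le_1] by (intro nn_integral_mono) fastforce
  have "emeasure (density \<mu> trace_weight) A < \<infinity>" if "compact A" for A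
  proof -
    have A: "A \<in> sets \<mu>" using borel_compact[OF that] sets_\<mu> by simp
    have "emeasure (density \<mu> trace_weight) A = (\<integral>\<^sup>+ y. trace_weight y * indicator A y \<partial>\<mu>)"
      by (rule emeasure_density[OF _ A]) measurable
    also have "\<dots> \<le> (\<integral>\<^sup>+ y. indicator A y \<partial>\<mu>)" by (rule le)
    also have "\<dots> = emeasure \<mu> A" using A by simp
    also have "\<dots> < \<infinity>" using \<mu> that by (simp add: MT_nonneg_def)
    finally show ?thesis .
  qed
  moreover have "(\<integral>\<^sup>+ y. ennreal (exp (- (norm y)\<^sup>2 / (4 * T))) \<partial>density \<mu> trace_weight) < \<infinity>"
  proof -
    have "(\<integral>\<^sup>+ y. ennreal (exp (- (norm y)\<^sup>2 / (4 * T))) \<partial>density \<mu> trace_weight)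
       = (\<integral>\<^sup>+ y. trace_weight y * ennreal (exp (- (norm y)\<^sup>2 / (4 * T))) \<partial>\<mu>)"
      by (rule nn_integral_density) measurable
    also have "\<dots> \<le> (\<integral>\<^sup>+ y. ennreal (exp (- (norm y)\<^sup>2 / (4 * T))) \<partial>\<mu>)" by (rule le)
    also have "\<dots> < \<infinity>" by (rule MT_nonneg_weight[OF \<mu>])
    finally show ?thesis .
  qed
  ultimately show ?thesis
    by (simp add: MT_nonneg_def sets_\<mu>)
qed

text \<open>A reduced measure is specified only through its heat potential below time
  \<open>T\<close>. The measure \<open>density \<mu> trace_weight\<close> has the same potential,
  and the initial trace is unique.\<close>

lemma reduced_measure_eq:
  assumes \<mu>: "\<mu> \<in> MT_nonneg T" and red: "reduced_measure T V0 \<mu> \<mu>'"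
  shows "\<mu>' = density \<mu> (indicator (- Sing T V0))"
proof -
  have "\<mu>' = density \<mu> trace_weight"
  proof (rule heat_pot_inject[OF _ density_trace_weight_MT[OF \<mu>] T_pos])
    show "\<mu>' \<in> MT_nonneg T" using red by (simp add: reduced_measure_def)
    fix x t assume "0 < t" "t < T"
    then show "heat_pot \<mu>' x t = heat_pot (density \<mu> trace_weight) x t"
      using red kernel_pot_duhamel[OF \<mu>, of t x] by (simp add: reduced_measure_def)
  qed
  moreover have "trace_weight = indicator (- Sing T V0)" by (rule ext) (rule trace_weight_indicator)
  ultimately show ?thesis by simp
qed

end

text \<open>Besides Borel measurability the bounds have to hold at every point instead of almost
  every one, so a Borel version is clamped between \<open>0\<close> and \<open>C1 / t\<close> and
  set to \<open>0\<close> off the strip.\<close>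

lemma borel_representative:
  fixes V :: "'a::euclidean_space \<times> real \<Rightarrow> real"
  assumes T: "T > 0" and C1: "C1 > 0" and V: "V \<in> borel_measurable (lebesgue_on (QT T))"
    and bnd: "AE z in lebesgue_on (QT T). 0 \<le> V z \<and> V z \<le> C1 / snd z"
  obtains V' where "singular_representative V' T C1 V"
proof -
  have Q: "QT T \<inter> space lebesgue \<in> sets (lebesgue :: ('a \<times> real) measure)" by simp
  have "(\<lambda>z. indicator (QT T) z *\<^sub>R V z) \<in> borel_measurable lebesgue"
    using V Q by (subst (asm) borel_measurable_restrict_space_iff) simp_all
  then obtain g where g [measurable]: "g \<in> borel_measurable borel"
      and ae: "AE z in lborel. indicator (QT T) z *\<^sub>R V z = g z"
    using completion_ex_borel_measurable_real[of "\<lambda>z. indicator (QT T) z *\<^sub>R V z" lborel] by auto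
  define V' where "V' z = (if z \<in> QT T then max 0 (min (g z) (C1 / snd z)) else 0)" for z
  have "singular_representative V' T C1 V"
  proof
    show "V' \<in> borel_measurable borel" unfolding V'_def[abs_def] by measurable
    show "0 \<le> V' p" for p by (simp add: V'_def)
    show "V' p \<le> C1 / snd p" if "p \<in> QT T" for p
      using that C1 by (auto simp: V'_def mem_QT)
    show "V' p = 0" if "p \<notin> QT T" for p using that by (simp add: V'_def)
    show "AE z in lebesgue_on (QT T). V z = V' z"
    proof -
      have "AE z in lebesgue. indicator (QT T) z *\<^sub>R V z = g z" using ae by (rule AE_completion)
      then have "AE z in lebesgue_on (QT T). indicator (QT T) z *\<^sub>R V z = g z"
        unfolding AE_restrict_space_iff[OF Q] by eventually_elim (rule impI)
      then show ?thesis
        using bnd AE_space[of "lebesgue_on (QT T)"]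
      proof eventually_elim
        case (elim z)
        then have "z \<in> QT T" by (simp add: space_restrict_space)
        with elim show ?case by (auto simp: V'_def max_def min_def)
      qed
    qed
  qed (use assms in auto)
  then show thesis by (rule that)
qed

theorem theoremG:
  fixes T C1 :: real
    and V :: "'a::euclidean_space \<times> real \<Rightarrow> real"
    and \<mu> \<mu>' :: "'a measure"
  assumes "T > 0" and "C1 > 0"
    and "V \<in> Linf_loc (QT T)"
    and "AE z in lebesgue_on (QT T). 0 \<le> V z \<and> V z \<le> C1 / snd z"
    and "\<mu> \<in> MT_nonneg T"
    and "reduced_measure T V \<mu> \<mu>'"
  shows "(\<exists>\<rho>. is_diff_measure \<mu> \<mu>' \<rho> \<and> UNIV - Sing T V \<in> null_sets \<rho>) \<and>
         (UNIV - Sing T V \<in> null_sets \<mu> \<longrightarrow> \<mu>' = null_measure borel) \<and>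
         Sing T V = Zset T V"
proof -
  obtain V' where "singular_representative V' T C1 V"
    using borel_representative[OF assms(1,2) _ assms(4)] assms(3) by (auto simp: Linf_loc_def)
  then interpret singular_representative V' T C1 V .
  note sets_\<mu> [measurable_cong] = MT_nonneg_sets[OF assms(5)]
  let ?S = "Sing T V"
  have \<mu>': "\<mu>' = density \<mu> (indicator (- ?S))"
    by (rule reduced_measure_eq[OF assms(5,6)])
  have em': "emeasure \<mu>' A = emeasure \<mu> (A - ?S)" if "A \<in> sets borel" for A
  proof -
    have "emeasure \<mu>' A = (\<integral>\<^sup>+ y. indicator (- ?S) y * indicator A y \<partial>\<mu>)"
      unfolding \<mu>' using that sets_\<mu> by (intro emeasure_density) auto
    also have "\<dots> = (\<integral>\<^sup>+ y. indicator (A - ?S) y \<partial>\<mu>)"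
      by (intro nn_integral_cong) (auto split: split_indicator)
    also have "\<dots> = emeasure \<mu> (A - ?S)"
      using that sets_\<mu> by (intro nn_integral_indicator) auto
    finally show ?thesis .
  qed
  \<comment> \<open>The part of \<open>\<mu>\<close> on the singular set. As \<open>\<mu>'\<close>
    is the part on the complement, additivity over each Borel set replaces a subtraction of possibly
    infinite values.\<close>
  define \<rho> where "\<rho> = density \<mu> (indicator ?S)"
  have em: "emeasure \<rho> A = emeasure \<mu> (A \<inter> ?S)" if "A \<in> sets borel" for A
  proof -
    have "emeasure \<rho> A = (\<integral>\<^sup>+ y. indicator ?S y * indicator A y \<partial>\<mu>)"
      unfolding \<rho>_def using that sets_\<mu> by (intro emeasure_density) auto
    also have "\<dots> = (\<integral>\<^sup>+ y. indicator (A \<inter> ?S) y \<partial>\<mu>)"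
      by (intro nn_integral_cong) (auto split: split_indicator)
    also have "\<dots> = emeasure \<mu> (A \<inter> ?S)"
      using that sets_\<mu> by (intro nn_integral_indicator) auto
    finally show ?thesis .
  qed
  have "is_diff_measure \<mu> \<mu>' \<rho>"
    unfolding is_diff_measure_def
  proof (intro conjI ballI)
    show "sets \<rho> = sets borel" by (simp add: \<rho>_def sets_\<mu>)
    fix A :: "'a set" assume A: "A \<in> sets borel"
    then have "emeasure \<mu> (A - ?S) + emeasure \<mu> (A \<inter> ?S) = emeasure \<mu> ((A - ?S) \<union> (A \<inter> ?S))"
      using sets_\<mu> by (intro plus_emeasure) auto
    then show "emeasure \<mu> A = emeasure \<mu>' A + emeasure \<rho> A"
      unfolding em'[OF A] em[OF A] by (simp add: Un_Diff_Int)
  qed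
  moreover have "UNIV - ?S \<in> null_sets \<rho>"
    using em[of "UNIV - ?S"] by (simp add: null_sets_def \<rho>_def sets_\<mu> Diff_Int_distrib2)
  moreover have "\<mu>' = null_measure borel" if null: "UNIV - ?S \<in> null_sets \<mu>"
  proof (rule measure_eqI)
    show "sets \<mu>' = sets (null_measure borel)" by (simp add: \<mu>' sets_\<mu>)
    fix A assume "A \<in> sets \<mu>'"
    then have A: "A \<in> sets borel" by (simp add: \<mu>' sets_\<mu>)
    have "emeasure \<mu> (A - ?S) \<le> emeasure \<mu> (UNIV - ?S)"
      using null by (intro emeasure_mono) auto
    then show "emeasure \<mu>' A = emeasure (null_measure borel) A"
      using null unfolding em'[OF A] by (simp add: null_sets_def)
  qed
  ultimately show ?thesis by (simp add: Zset_eq) blast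
qed

end
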